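(* For every $N$ let $A=A(N)$ be a random Hermitian matrix of size $N$ with eigenvalues $\lambda_1(A)\le\dots\le\lambda_N(A)$. Assume that for every $r\in\mathbb{N}$ one has $$\lim_{N\to\infty}\log\mathbb{E}\left[HC(x_1,\dots,x_r,0^{N-r};\lambda_1(A),\dots,\lambda_N(A))\right]=\sum_{i=1}^r\Psi(x_i),$$ where $\Psi$ is a smooth function in a complex neighborhood of $0$ and the convergence is uniform in a complex neighborhood of $0^r$. Then for every $k\in\mathbb{N}$, the $k$-th moment of the random measure $\sum_{i=1}^N\delta\left(N^{-1}\lambda_i(A)\right)$, that is, the random variable $\sum_{i=1}^N\left(N^{-1}\lambda_i(A)\right)^k$, converges in probability, as $N\to\infty$, to $\dfrac{\Psi^{(k)}(0)}{(k-1)!}$.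
   Context: $\mathbb{N}=\{1,2,\dots\}$; $0^m$ denotes $m$ zeros $(0,\dots,0)$; $\delta(a)$ is the Dirac mass at $a$. For $x_1,\dots,x_N\in\mathbb{C}$ and $\lambda_1,\dots,\lambda_N\in\mathbb{R}$ the Harish-Chandra integral is $$HC(x_1,\dots,x_N;\lambda_1,\dots,\lambda_N)=\int_{U(N)}\exp\left(\operatorname{Tr}(D_\lambda U D_x U^* )\right)\mathbf{m}_N(dU),$$ where $D_\lambda=\operatorname{diag}(\lambda_1,\dots,\lambda_N)$, $D_x=\operatorname{diag}(x_1,\dots,x_N)$ and $\mathbf{m}_N$ is the Haar probability measure on the unitary group $U(N)$. The expectation $\mathbb{E}$ is over the random eigenvalues of $A$. The hypothesis implicitly includes that the expectations are finite and that the logarithm (the branch equal to $0$ at $x=0$) is well defined near the origin. "Smooth in a complex neighborhood" means complex differentiable (holomorphic). *)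

theory Defs
  imports
    "HOL-Probability.Probability"
    "HOL-Complex_Analysis.Complex_Analysis"
    "Jordan_Normal_Form.Schur_Decomposition"
begin

text \<open>Vectors and eigenvalue tuples are functions on \<^typ>\<open>nat\<close>, indexed from 0; in dimension
  \<open>N\<close> only the entries with index below \<open>N\<close> are used.\<close>

definition hermitian_mats :: "nat \<Rightarrow> complex mat set" where
  "hermitian_mats N = {A \<in> carrier_mat N N. mat_adjoint A = A}"

definition unitary_mats :: "nat \<Rightarrow> complex mat set" where
  "unitary_mats N = {U \<in> carrier_mat N N. U * mat_adjoint U = 1\<^sub>m N \<and> mat_adjoint U * U = 1\<^sub>m N}"

definition mat_trace :: "complex mat \<Rightarrow> complex" where
  "mat_trace A = (\<Sum>i<dim_row A. A $$ (i, i))"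

text \<open>The Borel space of complex \<open>N \<times> N\<close> matrices: the sigma-algebra is pulled back from
  the product of \<open>N * N\<close> copies of \<^typ>\<open>complex\<close> along the tuple of entries.\<close>

definition mat_borel :: "nat \<Rightarrow> complex mat measure" where
  "mat_borel N = vimage_algebra (carrier_mat N N)
     (\<lambda>A. \<lambda>ij \<in> {..<N} \<times> {..<N}. A $$ ij)
     (Pi\<^sub>M ({..<N} \<times> {..<N}) (\<lambda>_. borel))"

text \<open>\<open>m\<close> is the Haar probability measure on \<open>U(N)\<close>, characterised by translation invariance.
  Such a measure exists and is unique, and left invariance implies right invariance
  because \<open>U(N)\<close> is compact.\<close>

definition haar_prob :: "nat \<Rightarrow> complex mat measure \<Rightarrow> bool" where
  "haar_prob N m \<longleftrightarrow>
     prob_space m \<and>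
     space m = unitary_mats N \<and>
     sets m = sets (restrict_space (mat_borel N) (unitary_mats N)) \<and>
     (\<forall>V \<in> unitary_mats N. distr m m (\<lambda>U. V * U) = m)"

definition HC :: "complex mat measure \<Rightarrow> nat \<Rightarrow> (nat \<Rightarrow> complex) \<Rightarrow> (nat \<Rightarrow> real) \<Rightarrow> complex" where
  "HC m N x l =
     (\<integral>U. exp (mat_trace (mat_diag N (\<lambda>i. complex_of_real (l i)) * U * mat_diag N x * mat_adjoint U)) \<partial>m)"

text \<open>The eigenvalues in increasing order, with multiplicity. It is meant for Hermitian matrices,
  whose eigenvalues are real, so taking real parts loses nothing.\<close>

definition eigval :: "complex mat \<Rightarrow> nat \<Rightarrow> real" where
  "eigval A i = sorted_list_of_multiset (image_mset Re (proots (char_poly A))) ! i"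

definition random_hermitian :: "'a measure \<Rightarrow> nat \<Rightarrow> ('a \<Rightarrow> complex mat) \<Rightarrow> bool" where
  "random_hermitian M N A \<longleftrightarrow>
     A \<in> measurable M (mat_borel N) \<and> (\<forall>\<omega> \<in> space M. A \<omega> \<in> hermitian_mats N)"

text \<open>The polydisc of radius \<open>\<rho>\<close> around the origin of \<open>\<complex>\<^sup>r\<close>, each point being
  padded with zeros; the topology induced from the product topology on
  \<^typ>\<open>nat \<Rightarrow> complex\<close> is the usual one of \<open>\<complex>\<^sup>r\<close>. For \<open>N \<ge> r\<close>,
  the first \<open>N\<close> entries of a point are \<open>(x\<^sub>1, \<dots>, x\<^sub>r, 0\<^sup>N\<^sup>-\<^sup>r)\<close>.\<close>

definition polydisc :: "nat \<Rightarrow> real \<Rightarrow> (nat \<Rightarrow> complex) set" where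
  "polydisc r \<rho> = {x. (\<forall>i<r. norm (x i) < \<rho>) \<and> (\<forall>i\<ge>r. x i = 0)}"

text \<open>\<open>L\<close> is the branch of \<open>log F\<close> on \<open>S\<close> that vanishes at the origin (unique when \<open>S\<close> is
  connected and contains the origin).\<close>

definition log_branch ::
    "(nat \<Rightarrow> complex) set \<Rightarrow> ((nat \<Rightarrow> complex) \<Rightarrow> complex) \<Rightarrow> ((nat \<Rightarrow> complex) \<Rightarrow> complex) \<Rightarrow> bool" where
  "log_branch S F L \<longleftrightarrow>
     continuous_on S L \<and> L (\<lambda>_. 0) = 0 \<and> (\<forall>x\<in>S. exp (L x) = F x)"

text \<open>Convergence in probability to a constant. The variables may live on different probability
  spaces.\<close>

definition converges_in_prob :: "(nat \<Rightarrow> 'a measure) \<Rightarrow> (nat \<Rightarrow> 'a \<Rightarrow> complex) \<Rightarrow> complex \<Rightarrow> bool" where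
  "converges_in_prob M X c \<longleftrightarrow>
     (\<forall>\<^sub>F n in sequentially. X n \<in> borel_measurable (M n)) \<and>
     (\<forall>\<epsilon>>0. (\<lambda>n. measure (M n) {\<omega> \<in> space (M n). norm (X n \<omega> - c) > \<epsilon>}) \<longlonglongrightarrow> 0)"

end

theory Submission
  imports Defs "HOL-Real_Asymp.Real_Asymp"
begin

text \<open>Let \<open>U\<close> be a Haar unitary independent of \<open>A\<close>, and let \<open>B = U\<^sup>* A U\<close>, with entries
\<open>b\<^sub>i\<^sub>j\<close>. Then \<open>B\<close> has the spectrum of \<open>A\<close>, its law is invariant under unitary conjugation, and
\<open>HC(x\<^sub>1,\<dots>,x\<^sub>r,0,\<dots>,0; \<lambda>(A))\<close> is the expectation over \<open>U\<close> of \<open>exp(\<Sum> x\<^sub>i b\<^sub>i\<^sub>i)\<close>. So the hypothesis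
says that the Laplace transform of any fixed number of diagonal entries of \<open>B\<close> converges, uniformly
near the origin, to a product of factors \<open>exp(\<Psi>(x\<^sub>i))\<close>; by Cauchy's estimates all joint moments of these
diagonal entries converge (\<open>joint_moment_error\<close>, \<open>diagonal_power_limit\<close>).

The power sum \<open>\<Sum> \<lambda>\<^sub>i\<^sup>k = tr B\<^sup>k\<close> is a sum of products \<open>b\<^sub>p\<^sub>q b\<^sub>q\<^sub>s \<dots>\<close> over closed walks of length \<open>k\<close>. By
invariance under permutation matrices all walks with distinct vertices have the same expectation \<open>e\<^sub>k\<close>, that of
the product over the cycle \<open>0 \<rightarrow> 1 \<rightarrow> \<dots> \<rightarrow> k-1 \<rightarrow> 0\<close>. There are \<open>N(N-1)\<dots>(N-k+1)\<close> such walks. Each of the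
\<open>O(N\<^sup>k\<^sup>-\<^sup>1)\<close> remaining walks has a bounded expectation, because mixed moments of entries are bounded by moments
of one diagonal entry. Hence \<open>E tr B\<^sup>k / N\<^sup>k\<close> and \<open>e\<^sub>k\<close> have the same limit, and in the same way
\<open>E (tr B\<^sup>k)\<^sup>2 / N\<^sup>2\<^sup>k\<close> is governed by the product over two disjoint cycles (\<open>cyc_sum_moment\<close>).

It remains to compute \<open>e\<^sub>k\<close> from diagonal moments. Let \<open>\<zeta>\<close> be a primitive \<open>k\<close>-th root of unity. The Fourier matrix
diagonalises the cyclic shift, so \<open>\<Sum>\<^sub>j \<zeta>\<^sup>-\<^sup>j b\<^sub>j\<^sub>j\<close> has the law of \<open>\<Sum>\<^sub>l b\<^sub>l\<^sub>,\<^sub>l\<^sub>+\<^sub>1\<close> (\<open>diagonal_root_moment\<close>). In the \<open>k\<close>-th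
power of the latter, conjugation by diagonal phases kills every monomial except the full cycle, which occurs
\<open>k!\<close> times (\<open>block_power_moment\<close>). On the other side \<open>\<Psi>(0) = 0\<close>, as the logarithms vanish
at the origin, and \<open>\<Sum>\<^sub>j \<Psi>(\<zeta>\<^sup>-\<^sup>j s) = k \<Psi>\<^sup>(\<^sup>k\<^sup>)(0) s\<^sup>k / k! + O(s\<^sup>k\<^sup>+\<^sup>1)\<close>, so the
\<open>k\<close>-th moment tends to \<open>k \<Psi>\<^sup>(\<^sup>k\<^sup>)(0)\<close> and \<open>e\<^sub>k\<close> tends to \<open>\<Psi>\<^sup>(\<^sup>k\<^sup>)(0) / (k-1)!\<close>. For two disjoint cycles the limit
transform factorises, so the second moment tends to the square of this number (\<open>cyc_sum_limit\<close>), the variance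
tends to 0, and Chebyshev's inequality gives the theorem.

Two facts about matrices are needed: the spectral theorem, which identifies \<open>HC\<close> with the transform of the diagonal
entries (\<open>HC_eq_integral_conj_by\<close>), and the right invariance of the Haar measure, which makes the law of \<open>B\<close> invariant.\<close>

section \<open>Moments from Laplace transforms\<close>

lemma power_over_fact_le_exp:
  fixes x :: real
  assumes "x \<ge> 0"
  shows "(\<Sum>n<m. x ^ n / fact n) \<le> exp x"
proof -
  have "(\<Sum>n<m. inverse (fact n) * x ^ n) \<le> (\<Sum>n. inverse (fact n) * x ^ n)"
    by (rule sum_le_suminf[OF summable_exp]) (use assms in auto)
  then show ?thesis by (simp add: exp_def divide_inverse mult.commute)
qed

text \<open>The partial sums of the exponential series are dominated by \<open>|W| exp(R |Z|)\<close>, so the series may be integrated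
term by term. The weight \<open>W\<close> allows a transform in two variables to be treated one variable at a time.\<close>
lemma weighted_mgf:
  fixes Z W :: "'a \<Rightarrow> complex"
  assumes [measurable]: "Z \<in> borel_measurable M" "W \<in> borel_measurable M"
    and int: "integrable M (\<lambda>w. norm (W w) * exp (R * norm (Z w)))" and R: "R > 0"
  shows "integrable M (\<lambda>w. W w * Z w ^ n)"
    and "(\<lambda>s. \<integral>w. W w * exp (s * Z w) \<partial>M) holomorphic_on ball 0 R"
    and "(deriv ^^ n) (\<lambda>s. \<integral>w. W w * exp (s * Z w) \<partial>M) 0 = (\<integral>w. W w * Z w ^ n \<partial>M)"
proof -
  let ?m = "\<lambda>n. \<integral>w. W w * Z w ^ n \<partial>M"
  let ?t = "\<lambda>s n w. W w * (s * Z w) ^ n / fact n"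
  define g where "g = (\<lambda>s. \<integral>w. W w * exp (s * Z w) \<partial>M)"
  have part: "(\<Sum>n<m. norm (?t s n w)) \<le> norm (W w) * exp (R * norm (Z w))"
    if "norm s \<le> R" for s w m
  proof -
    have "(\<Sum>n<m. norm (?t s n w)) = norm (W w) * (\<Sum>n<m. (norm s * norm (Z w)) ^ n / fact n)"
      by (simp add: sum_distrib_left norm_mult norm_divide norm_power)
    also have "... \<le> norm (W w) * exp (norm s * norm (Z w))"
      by (intro mult_left_mono power_over_fact_le_exp) auto
    also have "... \<le> norm (W w) * exp (R * norm (Z w))"
      using that by (intro mult_left_mono) (auto intro: mult_right_mono)
    finally show ?thesis .
  qed
  have int_term: "integrable M (\<lambda>w. ?t s n w)" if "norm s \<le> R" for s n
  proof (rule Bochner_Integration.integrable_bound[OF int])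
    show "AE x in M. norm (W x * (s * Z x) ^ n / fact n) \<le> norm (norm (W x) * exp (R * norm (Z x)))"
    proof (rule AE_I2)
      fix x
      have "norm (W x * (s * Z x) ^ n / fact n) \<le> (\<Sum>n<Suc n. norm (W x * (s * Z x) ^ n / fact n))"
        by (simp add: sum_nonneg)
      also have "... \<le> norm (W x) * exp (R * norm (Z x))" by (rule part[OF that])
      finally show "norm (W x * (s * Z x) ^ n / fact n) \<le> norm (norm (W x) * exp (R * norm (Z x)))" by simp
    qed
  qed measurable
  show int_n: "integrable M (\<lambda>w. W w * Z w ^ n)" for n
  proof -
    have "integrable M (\<lambda>w. (fact n / of_real R ^ n) * (W w * (of_real R * Z w) ^ n / fact n))"
      using int_term[of "of_real R" n] R by (intro integrable_mult_right) auto
    then show ?thesis using R by (simp add: power_mult_distrib field_simps)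
  qed
  have sums: "(\<lambda>n. ?m n / fact n * s ^ n) sums g s" if "norm s < R" for s
  proof -
    have ptw: "(\<lambda>n. ?t s n w) sums (W w * exp (s * Z w))" for w
      using sums_mult[OF exp_converges[of "s * Z w"], of "W w"]
      by (simp add: scaleR_conv_of_real divide_inverse mult_ac)
    have "(\<lambda>n. \<integral>w. ?t s n w \<partial>M) sums (\<integral>w. (\<Sum>n. ?t s n w) \<partial>M)"
    proof (rule sums_integral)
      show "integrable M (\<lambda>w. ?t s n w)" for n
        using int_term that by simp
      show "AE w in M. summable (\<lambda>n. norm (?t s n w))"
        using part that by (intro AE_I2 summableI_nonneg_bounded) (auto intro: less_imp_le)
      show "summable (\<lambda>n. \<integral>w. norm (?t s n w) \<partial>M)"
      proof (rule summableI_nonneg_bounded)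
        fix m
        have "(\<Sum>n<m. \<integral>w. norm (?t s n w) \<partial>M) = (\<integral>w. (\<Sum>n<m. norm (?t s n w)) \<partial>M)"
          using int_term that by (subst Bochner_Integration.integral_sum) (auto intro: integrable_norm less_imp_le)
        also have "... \<le> (\<integral>w. norm (W w) * exp (R * norm (Z w)) \<partial>M)"
          using int_term that part by (intro integral_mono int Bochner_Integration.integrable_sum integrable_norm) auto
        finally show "(\<Sum>n<m. \<integral>w. norm (?t s n w) \<partial>M) \<le> (\<integral>w. norm (W w) * exp (R * norm (Z w)) \<partial>M)" .
      qed auto
    qed
    moreover have "(\<integral>w. ?t s n w \<partial>M) = ?m n / fact n * s ^ n" for n
    proof -
      have "(\<integral>w. ?t s n w \<partial>M) = (\<integral>w. (s ^ n / fact n) * (W w * Z w ^ n) \<partial>M)"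
        by (simp add: power_mult_distrib mult_ac)
      then show ?thesis by simp
    qed
    ultimately show ?thesis
      unfolding g_def using sums_unique[OF ptw] by simp
  qed
  show "g holomorphic_on ball 0 R" by (rule power_series_holomorphic[where a = "\<lambda>n. ?m n / fact n"])
       (use sums in auto)
  have "g has_fps_expansion Abs_fps (\<lambda>n. ?m n / fact n)"
  proof (rule has_fps_expansionI)
    have "eventually (\<lambda>s. s \<in> ball 0 R) (nhds (0::complex))"
      using R by (intro eventually_nhds_in_open) auto
    then show "\<forall>\<^sub>F u in nhds 0. (\<lambda>n. fps_nth (Abs_fps (\<lambda>n. ?m n / fact n)) n * u ^ n) sums g u"
      by eventually_elim (use sums in auto)
  qed
  from fps_nth_fps_expansion[OF this, of n]
  show "(deriv ^^ n) g 0 = ?m n" by simp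
qed

text \<open>Cauchy's inequality is applied in \<open>s\<close> for fixed \<open>t\<close>, and then in \<open>t\<close> to the \<open>k\<close>-th derivative at \<open>s = 0\<close>. The
constant does not depend on the measure, so the estimate can be used along a sequence of different probability
spaces.\<close>
lemma joint_moment_error:
  fixes Z1 Z2 :: "'a \<Rightarrow> complex" and g h :: "complex \<Rightarrow> complex"
  assumes [measurable]: "Z1 \<in> borel_measurable M" "Z2 \<in> borel_measurable M"
    and int: "integrable M (\<lambda>w. exp (R * norm (Z1 w) + R * norm (Z2 w)))"
    and hol: "g holomorphic_on ball 0 R" "h holomorphic_on ball 0 R"
    and close: "\<And>s t. norm s < R \<Longrightarrow> norm t < R \<Longrightarrow>
      norm ((\<integral>w. exp (s * Z1 w + t * Z2 w) \<partial>M) - g s * h t) \<le> e"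
    and r: "0 < r" "r < R"
  shows "norm ((\<integral>w. Z1 w ^ k * Z2 w ^ m \<partial>M) - (deriv ^^ k) g 0 * (deriv ^^ m) h 0)
    \<le> fact k * fact m * e / r ^ (k + m)"
proof -
  let ?X = "\<lambda>w. exp (R * norm (Z1 w) + R * norm (Z2 w))"
  have sub: "cball 0 r \<subseteq> ball (0::complex) R" "ball 0 r \<subseteq> ball (0::complex) R" and R: "R > 0"
    using r by auto
  have first: "norm ((\<integral>w. exp (t * Z2 w) * Z1 w ^ k \<partial>M) - (deriv ^^ k) g 0 * h t) \<le> fact k * e / r ^ k"
    if t: "norm t < R" for t
  proof -
    have i: "integrable M (\<lambda>w. norm (exp (t * Z2 w)) * exp (R * norm (Z1 w)))"
    proof (rule Bochner_Integration.integrable_bound[OF int])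
      show "AE w in M. norm (norm (exp (t * Z2 w)) * exp (R * norm (Z1 w)))
          \<le> norm (?X w)"
      proof (rule AE_I2)
        fix w
        have "norm (exp (t * Z2 w)) \<le> exp (norm (t * Z2 w))" by (rule norm_exp)
        also have "... \<le> exp (R * norm (Z2 w))"
          using t by (auto simp: norm_mult intro: mult_right_mono)
        finally show "norm (norm (exp (t * Z2 w)) * exp (R * norm (Z1 w)))
          \<le> norm (?X w)" by (simp add: exp_add mult.commute)
      qed
    qed measurable
    define f where "f = (\<lambda>s. \<integral>w. exp (t * Z2 w) * exp (s * Z1 w) \<partial>M)"
    have f: "f holomorphic_on ball 0 R" "(deriv ^^ k) f 0 = (\<integral>w. exp (t * Z2 w) * Z1 w ^ k \<partial>M)"
      unfolding f_def by (rule weighted_mgf[OF _ _ i R]; measurable)+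
    have d: "(\<lambda>s. f s - h t * g s) holomorphic_on ball 0 R" by (intro holomorphic_intros f hol)
    have "norm ((deriv ^^ k) (\<lambda>s. f s - h t * g s) 0) \<le> fact k * e / r ^ k"
    proof (rule Cauchy_inequality)
      show "(\<lambda>s. f s - h t * g s) holomorphic_on ball 0 r" by (rule holomorphic_on_subset[OF d sub(2)])
      show "continuous_on (cball 0 r) (\<lambda>s. f s - h t * g s)"
        by (rule continuous_on_subset[OF holomorphic_on_imp_continuous_on[OF d] sub(1)])
      show "norm (f s - h t * g s) \<le> e" if "norm (0 - s) = r" for s
        using close[of s t] that t r by (simp add: f_def exp_add mult.commute)
    qed (use r in auto)
    also have "(deriv ^^ k) (\<lambda>s. f s - h t * g s) 0 = (deriv ^^ k) f 0 - h t * (deriv ^^ k) g 0"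
      using R by (subst higher_deriv_diff[where S = "ball 0 R"])
        (auto intro!: holomorphic_intros f hol simp: higher_deriv_cmult[where A = "ball 0 R"] hol)
    finally show ?thesis by (simp add: f(2) mult.commute)
  qed
  have i: "integrable M (\<lambda>w. norm (Z1 w ^ k) * exp (R * norm (Z2 w)))"
  proof (rule Bochner_Integration.integrable_bound)
    show "integrable M (\<lambda>w. fact k / R ^ k * ?X w)" by (intro integrable_mult_right int)
    show "AE w in M. norm (norm (Z1 w ^ k) * exp (R * norm (Z2 w)))
        \<le> norm (fact k / R ^ k * ?X w)"
    proof (rule AE_I2)
      fix w
      have "(R * norm (Z1 w)) ^ k / fact k \<le> (\<Sum>n<Suc k. (R * norm (Z1 w)) ^ n / fact n)"
        using R by (simp add: sum_nonneg)
      also have "... \<le> exp (R * norm (Z1 w))"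
        using R by (intro power_over_fact_le_exp) auto
      finally have *: "norm (Z1 w) ^ k \<le> fact k / R ^ k * exp (R * norm (Z1 w))"
        using R by (simp add: field_simps)
      then show "norm (norm (Z1 w ^ k) * exp (R * norm (Z2 w)))
        \<le> norm (fact k / R ^ k * ?X w)"
        using R mult_right_mono[OF *, of "exp (R * norm (Z2 w))"]
        by (simp add: exp_add norm_power norm_mult abs_mult mult_ac)
    qed
  qed measurable
  define f where "f = (\<lambda>t. \<integral>w. Z1 w ^ k * exp (t * Z2 w) \<partial>M)"
  have f: "f holomorphic_on ball 0 R" "(deriv ^^ m) f 0 = (\<integral>w. Z1 w ^ k * Z2 w ^ m \<partial>M)"
    unfolding f_def by (rule weighted_mgf[OF _ _ i R]; measurable)+
  have d: "(\<lambda>t. f t - (deriv ^^ k) g 0 * h t) holomorphic_on ball 0 R" by (intro holomorphic_intros f hol)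
  have "norm ((deriv ^^ m) (\<lambda>t. f t - (deriv ^^ k) g 0 * h t) 0) \<le> fact m * (fact k * e / r ^ k) / r ^ m"
  proof (rule Cauchy_inequality)
    show "(\<lambda>t. f t - (deriv ^^ k) g 0 * h t) holomorphic_on ball 0 r" by (rule holomorphic_on_subset[OF d sub(2)])
    show "continuous_on (cball 0 r) (\<lambda>t. f t - (deriv ^^ k) g 0 * h t)"
      by (rule continuous_on_subset[OF holomorphic_on_imp_continuous_on[OF d] sub(1)])
    show "norm (f t - (deriv ^^ k) g 0 * h t) \<le> fact k * e / r ^ k" if "norm (0 - t) = r" for t
      using first[of t] that r by (simp add: f_def mult.commute)
  qed (use r in auto)
  also have "(deriv ^^ m) (\<lambda>t. f t - (deriv ^^ k) g 0 * h t) 0 = (deriv ^^ m) f 0 - (deriv ^^ k) g 0 * (deriv ^^ m) h 0"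
    using R by (subst higher_deriv_diff[where S = "ball 0 R"])
      (auto intro!: holomorphic_intros f hol simp: higher_deriv_cmult[where A = "ball 0 R"] hol)
  finally show ?thesis by (simp add: f(2) power_add mult_ac)
qed

text \<open>Leibniz' rule for \<open>(exp \<circ> h)' = h' (exp \<circ> h)\<close>: all terms but one contain a vanishing derivative of \<open>h\<close>.\<close>
lemma higher_deriv_exp_first_order:
  fixes h :: "complex \<Rightarrow> complex"
  assumes hol: "h holomorphic_on S" "open S" "z \<in> S"
    and zero: "\<And>n. 0 < n \<Longrightarrow> n < k \<Longrightarrow> (deriv ^^ n) h z = 0" and k: "k > 0"
  shows "(deriv ^^ k) (\<lambda>s. exp (h s)) z = (deriv ^^ k) h z * exp (h z)"
proof -
  obtain j where j: "k = Suc j" using k by (cases k) auto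
  have hd: "deriv h holomorphic_on S" and he: "(\<lambda>s. exp (h s)) holomorphic_on S"
    using hol by (auto intro!: holomorphic_intros holomorphic_deriv)
  have "(deriv ^^ k) (\<lambda>s. exp (h s)) z = (deriv ^^ j) (deriv (\<lambda>s. exp (h s))) z"
    by (simp add: j funpow_Suc_right del: funpow.simps)
  also have "... = (deriv ^^ j) (\<lambda>s. deriv h s * exp (h s)) z"
  proof (rule higher_deriv_transform_within_open[OF _ _ hol(2,3)])
    show "deriv (\<lambda>s. exp (h s)) holomorphic_on S" by (intro holomorphic_deriv he hol)
    show "(\<lambda>s. deriv h s * exp (h s)) holomorphic_on S" by (intro holomorphic_intros hd he)
    fix w assume w: "w \<in> S"
    have "(h has_field_derivative deriv h w) (at w)"
      using hol w holomorphic_derivI by blast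
    from DERIV_chain2[OF DERIV_exp this]
    show "deriv (\<lambda>s. exp (h s)) w = deriv h w * exp (h w)" by (simp add: DERIV_imp_deriv mult.commute)
  qed
  also have "... = (\<Sum>i = 0..j. of_nat (j choose i) * (deriv ^^ i) (deriv h) z * (deriv ^^ (j - i)) (\<lambda>s. exp (h s)) z)"
    by (rule higher_deriv_mult[OF hd he hol(2,3)])
  also have "... = (\<Sum>i \<in> {j}. of_nat (j choose i) * (deriv ^^ i) (deriv h) z * (deriv ^^ (j - i)) (\<lambda>s. exp (h s)) z)"
  proof (rule sum.mono_neutral_right; (intro ballI)?)
    fix i assume "i \<in> {0..j} - {j}"
    then have "(deriv ^^ Suc i) h z = 0" by (intro zero) (auto simp: j)
    then show "of_nat (j choose i) * (deriv ^^ i) (deriv h) z * (deriv ^^ (j - i)) (\<lambda>s. exp (h s)) z = 0"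
      by (simp add: funpow_Suc_right del: funpow.simps)
  qed auto
  also have "... = (deriv ^^ k) h z * exp (h z)" by (simp add: j funpow_Suc_right del: funpow.simps(2))
  finally show ?thesis .
qed

lemma sum_powers_root_of_unity:
  fixes q :: complex
  assumes "q ^ k = 1"
  shows "(\<Sum>j<k. q ^ j) = (if q = 1 then of_nat k else 0)"
  using assms by (auto simp: geometric_sum)

definition zeta :: "nat \<Rightarrow> complex" where "zeta k = cis (2 * pi / real k)"

lemma zeta_power: "zeta k ^ n = cis (2 * pi * real n / real k)"
  unfolding zeta_def Complex.DeMoivre by (simp add: mult_ac)

lemma zeta_power_eq_1_iff:
  assumes "k > 0"
  shows "zeta k ^ n = 1 \<longleftrightarrow> k dvd n"
proof -
  have "zeta k ^ n = exp (2 * of_real pi * \<i> * of_nat n / of_nat k)"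
    by (simp add: zeta_power cis_conv_exp mult_ac)
  then show ?thesis using complex_root_unity_eq_1[of k n] assms by simp
qed

lemma norm_zeta [simp]: "norm (zeta k) = 1" by (simp add: zeta_def)

lemma zeta_cnj_mult [simp]: "zeta k * cnj (zeta k) = 1" "cnj (zeta k) * zeta k = 1"
  using complex_norm_square[of "zeta k"] by (simp_all add: mult.commute)

lemma cnj_zeta_power:
  assumes "k > 0" "i \<le> k"
  shows "cnj (zeta k) ^ i = zeta k ^ (k - i)"
proof -
  have "cnj (zeta k) ^ i * zeta k ^ i = 1" by (simp flip: power_mult_distrib)
  moreover have "zeta k ^ (k - i) * zeta k ^ i = 1"
    using assms by (simp flip: power_add add: zeta_power_eq_1_iff)
  moreover have "zeta k ^ i \<noteq> 0" by (simp add: zeta_def)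
  ultimately show ?thesis by (metis mult_right_cancel)
qed

text \<open>Summing over the rotations by all \<open>k\<close>-th roots of unity keeps exactly the Taylor coefficients whose index is a
multiple of \<open>k\<close>.\<close>
lemma higher_deriv_root_sum:
  fixes \<Psi> :: "complex \<Rightarrow> complex"
  assumes hol: "\<Psi> holomorphic_on ball 0 R" and R: "R > 0" and k: "k > 0"
  shows "(deriv ^^ n) (\<lambda>s. \<Sum>j<k. \<Psi> (s * cnj (zeta k) ^ j)) 0
    = (if k dvd n then of_nat k * (deriv ^^ n) \<Psi> 0 else 0)"
proof -
  have inb: "w * cnj (zeta k) ^ j \<in> ball 0 R" "cnj (zeta k) ^ j * w \<in> ball 0 R" if "w \<in> ball 0 R" for w j
    using that by (auto simp: norm_mult norm_power)
  have hol': "(\<lambda>s. \<Psi> (s * cnj (zeta k) ^ j)) holomorphic_on ball 0 R" for j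
    using inb by (intro holomorphic_on_compose_gen[OF _ hol, unfolded o_def] holomorphic_intros) auto
  have "(deriv ^^ n) (\<lambda>s. \<Sum>j<l. \<Psi> (s * cnj (zeta k) ^ j)) 0
     = (\<Sum>j<l. (deriv ^^ n) (\<lambda>s. \<Psi> (s * cnj (zeta k) ^ j)) 0)" for l
  proof (induction l)
    case 0 then show ?case by simp
  next
    case (Suc l)
    then show ?case using R
      by (simp, subst higher_deriv_add[where S = "ball 0 R"]) (auto intro!: holomorphic_intros hol')
  qed
  also have "(\<Sum>j<k. (deriv ^^ n) (\<lambda>s. \<Psi> (s * cnj (zeta k) ^ j)) 0)
    = (\<Sum>j<k. (cnj (zeta k) ^ n) ^ j * (deriv ^^ n) \<Psi> 0)"
  proof (rule sum.cong[OF refl])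
    fix j
    have "(deriv ^^ n) (\<lambda>s. \<Psi> (cnj (zeta k) ^ j * s)) 0 = (cnj (zeta k) ^ j) ^ n * (deriv ^^ n) \<Psi> (cnj (zeta k) ^ j * 0)"
      using R inb by (intro higher_deriv_compose_linear[OF hol, where S = "ball 0 R"]) auto
    then show "(deriv ^^ n) (\<lambda>s. \<Psi> (s * cnj (zeta k) ^ j)) 0 = (cnj (zeta k) ^ n) ^ j * (deriv ^^ n) \<Psi> 0"
      by (simp add: mult.commute flip: power_mult)
  qed
  also have "... = (\<Sum>j<k. (cnj (zeta k) ^ n) ^ j) * (deriv ^^ n) \<Psi> 0" by (simp add: sum_distrib_right)
  also have "(\<Sum>j<k. (cnj (zeta k) ^ n) ^ j) = (if k dvd n then of_nat k else 0)"
  proof -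
    have "(cnj (zeta k) ^ n) ^ k = cnj (zeta k ^ (k * n))"
      by (simp add: mult.commute del: complex_cnj_power flip: power_mult complex_cnj_power)
    then have 1: "(cnj (zeta k) ^ n) ^ k = 1"
      using zeta_power_eq_1_iff[OF k, of "k * n"] by (metis complex_cnj_one dvd_triv_left)
    have "cnj (zeta k) ^ n = 1 \<longleftrightarrow> k dvd n"
      using zeta_power_eq_1_iff[OF k, of n] by (metis complex_cnj_cnj complex_cnj_one complex_cnj_power)
    then show ?thesis using sum_powers_root_of_unity[OF 1] by simp
  qed
  finally show ?thesis by simp
qed

section \<open>Conjugation by unitary matrices, entrywise\<close>

text \<open>Matrices are represented here by their entry functions, of which the entries with both indices below \<open>N\<close> are
relevant. The unitaries needed for the moment computation are all given by explicit entries.\<close>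
definition unitary_fun :: "nat \<Rightarrow> (nat \<Rightarrow> nat \<Rightarrow> complex) \<Rightarrow> bool" where
  "unitary_fun N W \<longleftrightarrow>
     (\<forall>i<N. \<forall>j<N. (\<Sum>a<N. cnj (W a i) * W a j) = (if i = j then 1 else 0))"

definition conj_by :: "nat \<Rightarrow> (nat \<Rightarrow> nat \<Rightarrow> complex) \<Rightarrow> (nat \<Rightarrow> nat \<Rightarrow> complex) \<Rightarrow> nat \<Rightarrow> nat \<Rightarrow> complex" where
  "conj_by N W c i j = (\<Sum>a<N. \<Sum>d<N. cnj (W a i) * c a d * W d j)"

definition perm_fun :: "(nat \<Rightarrow> nat) \<Rightarrow> nat \<Rightarrow> nat \<Rightarrow> complex" where
  "perm_fun \<sigma> i j = (if i = \<sigma> j then 1 else 0)"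

definition phase_fun :: "(nat \<Rightarrow> complex) \<Rightarrow> nat \<Rightarrow> nat \<Rightarrow> complex" where
  "phase_fun d i j = (if i = j then d i else 0)"

text \<open>The discrete Fourier transform on the coordinates \<open>s, \<dots>, s + n - 1\<close>, and the identity on the others.\<close>
definition fourier_fun :: "nat \<Rightarrow> nat \<Rightarrow> nat \<Rightarrow> nat \<Rightarrow> complex" where
  "fourier_fun s n i j =
     (if i \<in> {s..<s+n} \<and> j \<in> {s..<s+n} then zeta n ^ ((i - s) * (j - s)) / complex_of_real (sqrt (real n))
      else if i = j then 1 else 0)"

lemma if_zero_cnj_mult:
  fixes x y :: complex
  shows "(if P then x else 0) * y = (if P then x * y else 0)"
    and "y * (if P then x else 0) = (if P then y * x else 0)"
    and "cnj (if P then x else 0) = (if P then cnj x else 0)" by auto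

lemma conj_by_perm:
  assumes "bij_betw \<sigma> {..<N} {..<N}" "i < N" "j < N"
  shows "conj_by N (perm_fun \<sigma>) c i j = c (\<sigma> i) (\<sigma> j)"
proof -
  have "\<sigma> i < N" "\<sigma> j < N" using assms by (auto dest: bij_betwE)
  then show ?thesis
    unfolding conj_by_def perm_fun_def by (simp add: if_zero_cnj_mult sum.delta)
qed

lemma unitary_perm:
  assumes \<sigma>: "bij_betw \<sigma> {..<N} {..<N}"
  shows "unitary_fun N (perm_fun \<sigma>)"
  unfolding unitary_fun_def
proof (intro allI impI)
  fix i j assume ij: "i < N" "j < N"
  have "\<sigma> i < N" using \<sigma> ij by (auto dest: bij_betwE)
  moreover have "\<sigma> i = \<sigma> j \<longleftrightarrow> i = j"
    using \<sigma> ij by (auto simp: bij_betw_def inj_on_def)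
  ultimately show "(\<Sum>a<N. cnj (perm_fun \<sigma> a i) * perm_fun \<sigma> a j) = (if i = j then 1 else 0)"
    by (auto simp: perm_fun_def if_zero_cnj_mult sum.delta)
qed

lemma conj_by_phase:
  assumes "i < N" "j < N"
  shows "conj_by N (phase_fun d) c i j = cnj (d i) * c i j * d j"
proof -
  have "conj_by N (phase_fun d) c i j
      = (\<Sum>a<N. \<Sum>e<N. if e = j then (if a = i then cnj (d i) * c i j * d j else 0) else 0)"
    unfolding conj_by_def phase_fun_def by (intro sum.cong refl) auto
  then show ?thesis using assms by simp
qed

lemma unitary_phase:
  assumes d: "\<And>i. i < N \<Longrightarrow> norm (d i) = 1"
  shows "unitary_fun N (phase_fun d)"
  unfolding unitary_fun_def
proof (intro allI impI)
  fix i j assume ij: "i < N" "j < N"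
  have 1: "cnj (d l) * d l = 1" if "l < N" for l
    using complex_norm_square[of "d l"] d[OF that] by (simp add: mult.commute)
  have "(\<Sum>a<N. cnj (phase_fun d a i) * phase_fun d a j)
      = (\<Sum>a<N. if a = i then (if i = j then 1 else 0) else 0)"
    using ij by (intro sum.cong refl) (auto simp: phase_fun_def 1)
  then show "(\<Sum>a<N. cnj (phase_fun d a i) * phase_fun d a j) = (if i = j then 1 else 0)"
    using ij by simp
qed

lemma sum_block_split:
  fixes f :: "nat \<Rightarrow> 'b::comm_monoid_add"
  assumes "s + n \<le> N"
  shows "(\<Sum>a<N. f a) = (\<Sum>a<n. f (s + a)) + (\<Sum>a \<in> {..<N} - {s..<s+n}. f a)"
proof -
  have "(\<Sum>a<N. f a) = (\<Sum>a \<in> {s..<s+n}. f a) + (\<Sum>a \<in> {..<N} - {s..<s+n}. f a)"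
    using assms by (subst sum.subset_diff[of "{s..<s+n}"]) (auto simp: add.commute)
  also have "(\<Sum>a \<in> {s..<s+n}. f a) = (\<Sum>a<n. f (s + a))"
    by (rule sum.reindex_bij_witness[of _ "\<lambda>a. s + a" "\<lambda>a. a - s"]) auto
  finally show ?thesis .
qed

lemma cnj_zeta_mult_power_eq_1_iff:
  assumes "i \<le> n" "j < n"
  shows "cnj (zeta n) ^ i * zeta n ^ j = 1 \<longleftrightarrow> i = j \<or> (i = n \<and> j = 0)"
proof -
  have "cnj (zeta n) ^ i * zeta n ^ j = zeta n ^ (n - i + j)"
    using assms by (simp add: cnj_zeta_power flip: power_add)
  also have "... = 1 \<longleftrightarrow> n dvd (n - i + j)"
    using assms by (intro zeta_power_eq_1_iff) auto
  also have "... \<longleftrightarrow> i = j \<or> (i = n \<and> j = 0)"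
  proof
    assume "n dvd (n - i + j)"
    then obtain q where q: "n - i + j = n * q" by blast
    have "n * q < n * 2" unfolding q[symmetric] using assms by arith
    then have "q < 2" by (metis nat_mult_less_cancel_disj)
    then have "q = 0 \<or> q = 1" by auto
    then show "i = j \<or> (i = n \<and> j = 0)" using q assms by auto
  qed (use assms in auto)
  finally show ?thesis .
qed

lemma sum_cnj_zeta_zeta:
  assumes "i \<le> n" "j < n"
  shows "(\<Sum>a<n. (cnj (zeta n) ^ i * zeta n ^ j) ^ a) = (if i = j \<or> (i = n \<and> j = 0) then of_nat n else 0)"
proof -
  have n: "n > 0" using assms by auto
  have "zeta n ^ n = 1" using zeta_power_eq_1_iff[OF n, of n] by simp
  then have "(cnj (zeta n) ^ i * zeta n ^ j) ^ n = 1"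
    by (metis complex_cnj_one complex_cnj_power mult.commute mult_1 power_mult power_mult_distrib power_one)
  from sum_powers_root_of_unity[OF this] show ?thesis
    using cnj_zeta_mult_power_eq_1_iff[OF assms] by simp
qed

lemma fourier_fun_block:
  assumes "i < n" "j < n"
  shows "fourier_fun s n (s + i) (s + j) = (zeta n ^ j) ^ i / complex_of_real (sqrt (real n))"
  using assms by (simp add: fourier_fun_def mult.commute[of i j] power_mult)

lemma unitary_fourier:
  assumes sn: "s + n \<le> N"
  shows "unitary_fun N (fourier_fun s n)"
  unfolding unitary_fun_def
proof (intro allI impI)
  fix i j assume ij: "i < N" "j < N"
  show "(\<Sum>a<N. cnj (fourier_fun s n a i) * fourier_fun s n a j) = (if i = j then 1 else 0)"
  proof (cases "i \<in> {s..<s+n}")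
    case True
    have out: "(\<Sum>a \<in> {..<N} - {s..<s+n}. cnj (fourier_fun s n a i) * fourier_fun s n a j) = 0"
      using True by (intro sum.neutral) (auto simp: fourier_fun_def)
    show ?thesis
    proof (cases "j \<in> {s..<s+n}")
      case jT: True
      have sq: "complex_of_real (sqrt (real n)) * complex_of_real (sqrt (real n)) = of_nat n"
        by (simp flip: of_real_mult)
      have lt: "i - s < n" "j - s < n" "s + (i - s) = i" "s + (j - s) = j" using True jT by auto
      have "cnj (fourier_fun s n (s + a) i) * fourier_fun s n (s + a) j
          = (cnj (zeta n) ^ (i - s) * zeta n ^ (j - s)) ^ a / of_nat n" if a: "a < n" for a
        using fourier_fun_block[OF a lt(1), of s] fourier_fun_block[OF a lt(2), of s]
        by (simp add: sq power_mult_distrib lt)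
      then have "(\<Sum>a<n. cnj (fourier_fun s n (s + a) i) * fourier_fun s n (s + a) j)
          = (\<Sum>a<n. (cnj (zeta n) ^ (i - s) * zeta n ^ (j - s)) ^ a / of_nat n)" by simp
      also have "... = (\<Sum>a<n. (cnj (zeta n) ^ (i - s) * zeta n ^ (j - s)) ^ a) / of_nat n"
        by (simp add: sum_divide_distrib)
      also have "... = (if i = j then 1 else 0)"
        using True jT by (subst sum_cnj_zeta_zeta) auto
      finally show ?thesis by (subst sum_block_split[OF sn]) (simp add: out)
    next
      case False
      then have "i \<noteq> j" using True by auto
      moreover have "(\<Sum>a<N. cnj (fourier_fun s n a i) * fourier_fun s n a j) = 0"
        using True False by (intro sum.neutral) (auto simp: fourier_fun_def)
      ultimately show ?thesis by simp
    qed
  next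
    case False
    have "(\<Sum>a<N. cnj (fourier_fun s n a i) * fourier_fun s n a j)
        = (\<Sum>a<N. if a = i then fourier_fun s n i j else 0)"
      using False by (intro sum.cong) (auto simp: fourier_fun_def)
    also have "... = (if i = j then 1 else 0)" using False ij by (auto simp: fourier_fun_def)
    finally show ?thesis .
  qed
qed

lemma conj_by_fourier_outside:
  assumes "i < N" "j < N" "i \<notin> {s..<s+n}" "j \<notin> {s..<s+n}"
  shows "conj_by N (fourier_fun s n) c i j = c i j"
proof -
  have "conj_by N (fourier_fun s n) c i j = conj_by N (phase_fun (\<lambda>_. 1)) c i j"
    unfolding conj_by_def using assms
    by (intro sum.cong refl arg_cong2[of _ _ _ _ "(*)"]) (auto simp: fourier_fun_def phase_fun_def)
  then show ?thesis using assms by (simp add: conj_by_phase)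
qed

lemma conj_by_fourier_inside:
  assumes sn: "s + n \<le> N" and ij: "i < n" "j < n"
  shows "conj_by N (fourier_fun s n) c (s + i) (s + j)
    = (\<Sum>a<n. \<Sum>d<n. (cnj (zeta n) ^ i) ^ a * (zeta n ^ j) ^ d * c (s + a) (s + d)) / of_nat n"
proof -
  have sq: "complex_of_real (sqrt (real n)) * complex_of_real (sqrt (real n)) = of_nat n"
    by (simp flip: of_real_mult)
  have in0: "fourier_fun s n a (s + l) = 0" if "a \<notin> {s..<s+n}" "l < n" for a l
    using that by (auto simp: fourier_fun_def)
  have "conj_by N (fourier_fun s n) c (s + i) (s + j)
     = (\<Sum>a<n. \<Sum>d<n. cnj (fourier_fun s n (s + a) (s + i)) * c (s + a) (s + d) * fourier_fun s n (s + d) (s + j))"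
    unfolding conj_by_def using ij by (simp add: sum_block_split[OF sn] in0)
  also have "... = (\<Sum>a<n. \<Sum>d<n. (cnj (zeta n) ^ i) ^ a * (zeta n ^ j) ^ d * c (s + a) (s + d) / of_nat n)"
  proof (intro sum.cong refl)
    fix a d assume "a \<in> {..<n}" "d \<in> {..<n}"
    then have "cnj (fourier_fun s n (s + a) (s + i)) * c (s + a) (s + d) * fourier_fun s n (s + d) (s + j)
      = (cnj (zeta n) ^ i) ^ a * (zeta n ^ j) ^ d * c (s + a) (s + d)
         / (complex_of_real (sqrt (real n)) * complex_of_real (sqrt (real n)))"
      using ij by (simp add: fourier_fun_block)
    then show "cnj (fourier_fun s n (s + a) (s + i)) * c (s + a) (s + d) * fourier_fun s n (s + d) (s + j)
      = (cnj (zeta n) ^ i) ^ a * (zeta n ^ j) ^ d * c (s + a) (s + d) / of_nat n" by (simp only: sq)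
  qed
  finally show ?thesis by (simp add: sum_divide_distrib)
qed

definition cyc :: "nat \<Rightarrow> nat \<Rightarrow> nat" where
  "cyc k i = (if i + 1 = k then 0 else i + 1)"

lemma cyc_less: "i < k \<Longrightarrow> cyc k i < k" by (auto simp: cyc_def)

text \<open>The left side is the trace of the conjugated matrix against the diagonal matrix of \<open>n\<close>-th roots of unity. The Fourier
matrix carries this diagonal matrix to the cyclic shift.\<close>
lemma fourier_diagonal:
  assumes sn: "s + n \<le> N"
  shows "(\<Sum>j<n. cnj (zeta n) ^ j * conj_by N (fourier_fun s n) c (s + j) (s + j))
    = (\<Sum>l<n. c (s + l) (s + cyc n l))"
proof -
  let ?q = "\<lambda>a d. cnj (zeta n) ^ (a + 1) * zeta n ^ d"
  have "(\<Sum>j<n. cnj (zeta n) ^ j * conj_by N (fourier_fun s n) c (s + j) (s + j))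
      = (\<Sum>j<n. \<Sum>a<n. \<Sum>d<n. (?q a d) ^ j * c (s + a) (s + d) / of_nat n)"
  proof (rule sum.cong[OF refl])
    fix j assume "j \<in> {..<n}"
    then have "conj_by N (fourier_fun s n) c (s + j) (s + j)
        = (\<Sum>a<n. \<Sum>d<n. (cnj (zeta n) ^ j) ^ a * (zeta n ^ j) ^ d * c (s + a) (s + d)) / of_nat n"
      using sn by (intro conj_by_fourier_inside) auto
    moreover have "cnj (zeta n) ^ j * ((cnj (zeta n) ^ j) ^ a * (zeta n ^ j) ^ d * x) = (?q a d) ^ j * x"
      for a d x
    proof -
      have "(?q a d) ^ j = (cnj (zeta n) ^ (a + 1)) ^ j * (zeta n ^ d) ^ j" by (rule power_mult_distrib)
      also have "... = cnj (zeta n) ^ (j * (a + 1)) * zeta n ^ (j * d)"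
        by (simp only: power_mult[symmetric] mult.commute[of j])
      also have "... = cnj (zeta n) ^ j * (cnj (zeta n) ^ j) ^ a * (zeta n ^ j) ^ d"
        by (simp only: power_mult power_Suc Suc_eq_plus1[symmetric])
      finally show ?thesis by (simp add: mult.assoc)
    qed
    ultimately show "cnj (zeta n) ^ j * conj_by N (fourier_fun s n) c (s + j) (s + j)
        = (\<Sum>a<n. \<Sum>d<n. (?q a d) ^ j * c (s + a) (s + d) / of_nat n)"
      by (simp only: sum_distrib_left sum_divide_distrib times_divide_eq_right)
  qed
  also have "... = (\<Sum>a<n. \<Sum>d<n. \<Sum>j<n. (?q a d) ^ j * c (s + a) (s + d) / of_nat n)"
    by (subst sum.swap, rule sum.cong[OF refl], rule sum.swap)
  also have "... = (\<Sum>a<n. \<Sum>d<n. (\<Sum>j<n. (?q a d) ^ j) * c (s + a) (s + d) / of_nat n)"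
    by (simp only: sum_distrib_right sum_divide_distrib)
  also have "... = (\<Sum>a<n. \<Sum>d<n. if d = cyc n a then c (s + a) (s + d) else 0)"
  proof (intro sum.cong refl)
    fix a d assume "a \<in> {..<n}" "d \<in> {..<n}"
    then have *: "(\<Sum>j<n. (?q a d) ^ j) = (if d = cyc n a then of_nat n else 0)"
      by (subst sum_cnj_zeta_zeta) (auto simp: cyc_def)
    show "(\<Sum>j<n. (?q a d) ^ j) * c (s + a) (s + d) / of_nat n
        = (if d = cyc n a then c (s + a) (s + d) else 0)"
      unfolding * using \<open>a \<in> {..<n}\<close> by simp
  qed
  also have "... = (\<Sum>l<n. c (s + l) (s + cyc n l))" by (intro sum.cong refl) (simp add: sum.delta cyc_less)
  finally show ?thesis .
qed

section \<open>Walks along one or two cycles\<close>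

text \<open>With this, a monomial in entries can be relabelled along any injection of its indices.\<close>
lemma inj_extends_to_perm:
  fixes f :: "nat \<Rightarrow> nat"
  assumes f: "inj_on f {..<r}" "f ` {..<r} \<subseteq> {..<N}"
  obtains \<sigma> where "bij_betw \<sigma> {..<N} {..<N}" "\<And>i. i < r \<Longrightarrow> \<sigma> i = f i"
proof -
  have rN: "r \<le> N" using card_inj_on_le[OF f] by simp
  have "card ({..<N} - {..<r}) = card ({..<N} - f ` {..<r})"
    using f rN by (subst (1 2) card_Diff_subset) (auto simp: card_image)
  then obtain g where g: "bij_betw g ({..<N} - {..<r}) ({..<N} - f ` {..<r})"
    using finite_same_card_bij[of "{..<N} - {..<r}" "{..<N} - f ` {..<r}"] by auto
  define \<sigma> where "\<sigma> i = (if i < r then f i else g i)" for i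
  have "bij_betw \<sigma> ({..<r} \<union> ({..<N} - {..<r})) (f ` {..<r} \<union> ({..<N} - f ` {..<r}))"
  proof (rule bij_betw_combine)
    show "bij_betw \<sigma> {..<r} (f ` {..<r})"
      using f(1) by (intro bij_betw_cong[THEN iffD1, OF _ inj_on_imp_bij_betw]) (auto simp: \<sigma>_def)
    show "bij_betw \<sigma> ({..<N} - {..<r}) ({..<N} - f ` {..<r})"
      by (rule bij_betw_cong[THEN iffD1, OF _ g]) (auto simp: \<sigma>_def)
  qed auto
  moreover have "{..<r} \<union> ({..<N} - {..<r}) = {..<N}" "f ` {..<r} \<union> ({..<N} - f ` {..<r}) = {..<N}"
    using rN f(2) by auto
  ultimately have "bij_betw \<sigma> {..<N} {..<N}" by simp
  then show ?thesis by (rule that) (simp add: \<sigma>_def)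
qed

text \<open>This serves both to factorise a sum over pairs of closed walks and to count pairs of injective maps.\<close>
lemma sum_PiE_append:
  fixes \<alpha> \<beta> :: "(nat \<Rightarrow> nat) \<Rightarrow> complex"
  assumes fin: "\<And>i. finite (J i)"
    and \<alpha>: "\<And>f g. (\<And>i. i < k \<Longrightarrow> f i = g i) \<Longrightarrow> \<alpha> f = \<alpha> g"
  shows "(\<Sum>f \<in> PiE {..<k + m} J. \<alpha> f * \<beta> (\<lambda>i. f (k + i)))
    = (\<Sum>f \<in> PiE {..<k} J. \<alpha> f) * (\<Sum>f \<in> PiE {..<m} (\<lambda>i. J (k + i)). \<beta> f)"
proof (induction m arbitrary: \<beta>)
  case 0
  have "\<beta> (\<lambda>i. f (k + i)) = \<beta> (\<lambda>_. undefined)" if "f \<in> PiE {..<k} J" for f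
    using that by (intro arg_cong[of _ _ \<beta>]) (auto simp: PiE_def extensional_def)
  then show ?case by (simp add: sum_distrib_right PiE_empty_domain)
next
  case (Suc m)
  have step: "(\<Sum>f \<in> PiE {..<Suc n} K. \<gamma> f) = (\<Sum>x \<in> K n. \<Sum>f \<in> PiE {..<n} K. \<gamma> (f(n := x)))"
    if "\<And>i. finite (K i)" for K :: "nat \<Rightarrow> nat set" and n and \<gamma> :: "(nat \<Rightarrow> nat) \<Rightarrow> complex"
  proof -
    have "(\<Sum>f \<in> PiE {..<Suc n} K. \<gamma> f) = (\<Sum>f \<in> (\<lambda>(y, g). g(n := y)) ` (K n \<times> PiE {..<n} K). \<gamma> f)"
      by (simp add: lessThan_Suc PiE_insert_eq)
    also have "... = (\<Sum>(x, f) \<in> K n \<times> PiE {..<n} K. \<gamma> (f(n := x)))"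
      by (subst sum.reindex) (auto intro!: inj_combinator simp: case_prod_beta)
    finally show ?thesis by (simp add: sum.cartesian_product)
  qed
  have "(\<Sum>f \<in> PiE {..<k + Suc m} J. \<alpha> f * \<beta> (\<lambda>i. f (k + i)))
      = (\<Sum>x \<in> J (k + m). \<Sum>f \<in> PiE {..<k + m} J. \<alpha> (f(k + m := x)) * \<beta> (\<lambda>i. (f(k + m := x)) (k + i)))"
    using step[OF fin, where n = "k + m"] by simp
  also have "... = (\<Sum>x \<in> J (k + m). \<Sum>f \<in> PiE {..<k + m} J. \<alpha> f * \<beta> ((\<lambda>i. f (k + i))(m := x)))"
  proof (intro sum.cong refl)
    fix x f
    have "\<alpha> (f(k + m := x)) = \<alpha> f" by (rule \<alpha>) auto
    moreover have "(\<lambda>i. (f(k + m := x)) (k + i)) = (\<lambda>i. f (k + i))(m := x)" by auto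
    ultimately show "\<alpha> (f(k + m := x)) * \<beta> (\<lambda>i. (f(k + m := x)) (k + i)) = \<alpha> f * \<beta> ((\<lambda>i. f (k + i))(m := x))"
      by simp
  qed
  also have "... = (\<Sum>x \<in> J (k + m). (\<Sum>f \<in> PiE {..<k} J. \<alpha> f) * (\<Sum>f \<in> PiE {..<m} (\<lambda>i. J (k + i)). \<beta> (f(m := x))))"
    by (intro sum.cong refl Suc.IH)
  also have "... = (\<Sum>f \<in> PiE {..<k} J. \<alpha> f) * (\<Sum>f \<in> PiE {..<Suc m} (\<lambda>i. J (k + i)). \<beta> f)"
    using step[of "\<lambda>i. J (k + i)"] fin by (simp add: sum_distrib_left)
  finally show ?case .
qed

text \<open>Every factor is at most the largest one, whose power is one of the summands.\<close>
lemma prod_le_sum_power_card: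
  fixes x :: "'b \<Rightarrow> real"
  assumes "finite I" "I \<noteq> {}" "\<And>i. i \<in> I \<Longrightarrow> x i \<ge> 0"
  shows "(\<Prod>i\<in>I. x i) \<le> (\<Sum>i\<in>I. x i ^ card I)"
proof -
  have "Max (x ` I) \<in> x ` I" using assms by (intro Max_in) auto
  then obtain j where j: "j \<in> I" "x j = Max (x ` I)" by auto
  have "(\<Prod>i\<in>I. x i) \<le> (\<Prod>i\<in>I. x j)"
    using assms j by (intro prod_mono) auto
  also have "... = x j ^ card I" by simp
  also have "... \<le> (\<Sum>i\<in>I. x i ^ card I)"
    using assms j by (intro member_le_sum) auto
  finally show ?thesis .
qed

text \<open>The permutation of \<open>{..<k + m}\<close> with cycles \<open>(0 \<dots> k-1)\<close> and \<open>(k \<dots> k+m-1)\<close>. First and second moments are treated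
together: the value \<open>m = 0\<close> gives a single cycle.\<close>
definition cyc2 :: "nat \<Rightarrow> nat \<Rightarrow> nat \<Rightarrow> nat" where
  "cyc2 k m i = (if i < k then cyc k i else k + cyc m (i - k))"

lemma cyc2_less: "i < k + m \<Longrightarrow> cyc2 k m i < k + m"
  using cyc_less[of i k] cyc_less[of "i - k" m] by (auto simp: cyc2_def)

lemma inj_on_cyc2: "inj_on (cyc2 k m) {..<k + m}"
  by (auto simp: inj_on_def cyc2_def cyc_def split: if_splits)

text \<open>The number of edges \<open>h i \<rightarrow> cyc2 k m (h i)\<close> that leave \<open>cyc2 k m j\<close> is compared with the number that enter it. If the two
agree at every vertex, then the fibre sizes of \<open>h\<close> are constant along each of the two cycles; they add up to the
length of the cycle, so they are all 1 and \<open>h\<close> is injective.\<close>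
lemma unbalanced_vertex:
  assumes h: "h \<in> PiE {..<k + m} (\<lambda>i. if i < k then {..<k} else {k..<k + m})"
    and ninj: "\<not> inj_on h {..<k + m}"
  shows "\<exists>j<k + m. card {i \<in> {..<k + m}. h i = cyc2 k m j} \<noteq> card {i \<in> {..<k + m}. h i = j}"
proof (rule ccontr)
  assume bal: "\<not> ?thesis"
  define c where "c j = card {i \<in> {..<k + m}. h i = j}" for j
  have eq: "c (cyc2 k m j) = c j" if "j < k + m" for j
    using bal that unfolding c_def by blast
  have c0: "j < k \<longrightarrow> c j = c 0" for j
  proof (induction j)
    case (Suc j)
    then show ?case using eq[of j] by (auto simp: cyc2_def cyc_def split: if_splits)
  qed simp
  have c1: "j < m \<longrightarrow> c (k + j) = c k" for j
  proof (induction j)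
    case (Suc j)
    then show ?case using eq[of "k + j"] by (auto simp: cyc2_def cyc_def split: if_splits)
  qed simp
  have fib: "(\<Sum>j\<in>J. c j) = card {i \<in> {..<k + m}. h i \<in> J}" if "finite J" for J
  proof -
    have "{i \<in> {..<k + m}. h i \<in> J} = (\<Union>j\<in>J. {i \<in> {..<k + m}. h i = j})" by auto
    also have "card \<dots> = (\<Sum>j\<in>J. card {i \<in> {..<k + m}. h i = j})"
      using that by (intro card_UN_disjoint) auto
    finally show ?thesis by (simp add: c_def)
  qed
  have hJ: "h i \<in> (if i < k then {..<k} else {k..<k + m})" if "i < k + m" for i
    using h that by (auto simp: PiE_def Pi_def)
  have iff: "h i < k \<longleftrightarrow> i < k" and hr: "h i < k + m" if "i < k + m" for i
    using hJ[OF that] by (auto split: if_splits)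
  have "{i \<in> {..<k + m}. h i \<in> {..<k}} = {..<k}" using iff by auto
  with fib[of "{..<k}"] have "(\<Sum>j<k. c j) = k" by simp
  moreover have "(\<Sum>j<k. c j) = (\<Sum>j<k. c 0)" by (rule sum.cong[OF refl]) (use c0 in blast)
  ultimately have s0: "k * c 0 = k" by simp
  have "{i \<in> {..<k + m}. h i \<in> {k..<k + m}} = {k..<k + m}"
    using iff hr by (auto simp: not_less[symmetric])
  with fib[of "{k..<k + m}"] have "(\<Sum>j\<in>{k..<k + m}. c j) = m" by simp
  moreover have "(\<Sum>j\<in>{k..<k + m}. c j) = (\<Sum>j\<in>{k..<k + m}. c k)"
  proof (rule sum.cong[OF refl])
    fix j assume "j \<in> {k..<k + m}"
    then show "c j = c k" using c1[of "j - k"] by auto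
  qed
  ultimately have s1: "m * c k = m" by simp
  have one: "c j = 1" if "j < k + m" for j
  proof (cases "j < k")
    case True
    then show ?thesis using s0 c0[rule_format, of j] by (cases "k = 0") simp_all
  next
    case False
    then have "j - k < m" "k + (j - k) = j" using that by auto
    then show ?thesis using s1 c1[rule_format, of "j - k"] by (cases "m = 0") simp_all
  qed
  have "inj_on h {..<k + m}"
  proof (rule inj_onI)
    fix x y assume xy: "x \<in> {..<k + m}" "y \<in> {..<k + m}" "h x = h y"
    have "card {i \<in> {..<k + m}. h i = h x} = 1" using one[OF hr[of x]] xy by (simp add: c_def)
    then obtain z where "{i \<in> {..<k + m}. h i = h x} = {z}" by (auto simp: card_1_singleton_iff)
    with xy show "x = y" by (metis (mono_tags, lifting) mem_Collect_eq singletonD)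
  qed
  with ninj show False by simp
qed

lemma block_products_expand:
  fixes c :: "nat \<Rightarrow> nat \<Rightarrow> complex"
  shows "(\<Sum>l<k. c l (cyc k l)) ^ k * (\<Sum>l<m. c (k + l) (k + cyc m l)) ^ m
    = (\<Sum>h \<in> PiE {..<k + m} (\<lambda>i. if i < k then {..<k} else {k..<k + m}).
         \<Prod>i<k + m. c (h i) (cyc2 k m (h i)))"
proof -
  define J where "J = (\<lambda>i::nat. if i < k then {..<k} else {k..<k + m})"
  have s0: "(\<Sum>y\<in>{..<k}. c y (cyc2 k m y)) = (\<Sum>l<k. c l (cyc k l))" by (rule sum.cong) (auto simp: cyc2_def)
  have s1: "(\<Sum>y\<in>{k..<k + m}. c y (cyc2 k m y)) = (\<Sum>l<m. c (k + l) (k + cyc m l))"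
    by (rule sum.reindex_bij_witness[of _ "\<lambda>l. k + l" "\<lambda>y. y - k"]) (auto simp: cyc2_def)
  have "(\<Sum>h \<in> PiE {..<k + m} J. \<Prod>i<k + m. c (h i) (cyc2 k m (h i)))
      = (\<Prod>i<k + m. \<Sum>y\<in>J i. c y (cyc2 k m y))" by (subst prod_sum_PiE) (auto simp: J_def)
  also have "... = (\<Prod>i\<in>{..<k} \<union> {k..<k + m}. \<Sum>y\<in>J i. c y (cyc2 k m y))" by (rule prod.cong) auto
  also have "(\<Prod>i\<in>{..<k} \<union> {k..<k + m}. \<Sum>y\<in>J i. c y (cyc2 k m y))
      = (\<Prod>i\<in>{..<k}. \<Sum>y\<in>J i. c y (cyc2 k m y)) * (\<Prod>i\<in>{k..<k + m}. \<Sum>y\<in>J i. c y (cyc2 k m y))"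
    by (rule prod.union_disjoint) auto
  also have "(\<Prod>i\<in>{..<k}. \<Sum>y\<in>J i. c y (cyc2 k m y)) = (\<Prod>i\<in>{..<k}. \<Sum>l<k. c l (cyc k l))"
    by (rule prod.cong) (auto simp: J_def s0)
  also have "(\<Prod>i\<in>{k..<k + m}. \<Sum>y\<in>J i. c y (cyc2 k m y)) = (\<Prod>i\<in>{k..<k + m}. \<Sum>l<m. c (k + l) (k + cyc m l))"
    by (rule prod.cong) (auto simp: J_def s1)
  finally show ?thesis by (simp add: J_def)
qed

lemma card_inj_self_maps:
  assumes "card B = n" "finite B"
  shows "(\<Sum>f \<in> {..<n} \<rightarrow>\<^sub>E B. of_bool (inj_on f {..<n}) :: complex) = fact n"
proof -
  have "(\<Sum>f \<in> {..<n} \<rightarrow>\<^sub>E B. of_bool (inj_on f {..<n}) :: complex)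
      = of_nat (card {f \<in> {..<n} \<rightarrow>\<^sub>E B. inj_on f {..<n}})"
    using assms by (simp add: finite_PiE sum.If_cases of_bool_def Int_def)
  also have "card {f \<in> {..<n} \<rightarrow>\<^sub>E B. inj_on f {..<n}} = fact n"
    using card_inj_on_subset_funcset[of "{..<n}" B "{..<n}"] assms by (simp add: fact_prod_rev)
  finally show ?thesis by simp
qed

lemma count_inj_block_maps:
  "(\<Sum>h \<in> PiE {..<k + m} (\<lambda>i. if i < k then {..<k} else {k..<k + m}).
      of_bool (inj_on h {..<k + m}) :: complex) = fact k * fact m"
proof -
  define J where "J = (\<lambda>i::nat. if i < k then {..<k} else {k..<k + m})"
  have "of_bool (inj_on h {..<k + m}) = (of_bool (inj_on h {..<k}) * of_bool (inj_on (\<lambda>i. h (k + i)) {..<m}) :: complex)"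
    if h: "h \<in> PiE {..<k + m} J" for h
  proof -
    have hJ: "h i \<in> J i" if "i < k + m" for i using h that by (auto simp: PiE_def Pi_def)
    have "inj_on h {..<k + m} \<longleftrightarrow> inj_on h {..<k} \<and> inj_on (\<lambda>i. h (k + i)) {..<m}"
    proof (intro iffI conjI)
      assume "inj_on h {..<k + m}"
      then show "inj_on h {..<k}" by (rule inj_on_subset) auto
      show "inj_on (\<lambda>i. h (k + i)) {..<m}"
      proof (rule inj_onI)
        fix x y assume "x \<in> {..<m}" "y \<in> {..<m}" "h (k + x) = h (k + y)"
        then have "k + x = k + y" by (intro inj_onD[OF \<open>inj_on h {..<k + m}\<close>, of "k + x" "k + y"]) auto
        then show "x = y" by simp
      qed
    next
      assume *: "inj_on h {..<k} \<and> inj_on (\<lambda>i. h (k + i)) {..<m}"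
      show "inj_on h {..<k + m}"
      proof (rule inj_onI)
        fix x y assume xy: "x \<in> {..<k + m}" "y \<in> {..<k + m}" "h x = h y"
        have "x < k \<longleftrightarrow> y < k" using hJ[of x] hJ[of y] xy by (auto simp: J_def split: if_splits)
        then consider "x < k" "y < k" | "x \<ge> k" "y \<ge> k" by fastforce
        then show "x = y"
        proof cases
          case 1 then show ?thesis using * xy by (auto dest: inj_onD)
        next
          case 2
          then have "x - k = y - k"
            using * xy by (intro inj_onD[of "\<lambda>i. h (k + i)" "{..<m}" "x - k" "y - k"]) auto
          then show ?thesis using 2 by simp
        qed
      qed
    qed
    then show ?thesis by auto
  qed
  then have "(\<Sum>h \<in> PiE {..<k + m} J. of_bool (inj_on h {..<k + m}) :: complex)
      = (\<Sum>h \<in> PiE {..<k + m} J. of_bool (inj_on h {..<k}) * of_bool (inj_on (\<lambda>i. h (k + i)) {..<m}))"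
    by simp
  also have "... = (\<Sum>f \<in> PiE {..<k} J. of_bool (inj_on f {..<k})) * (\<Sum>f \<in> PiE {..<m} (\<lambda>i. J (k + i)). of_bool (inj_on f {..<m}))"
  proof (rule sum_PiE_append)
    fix f g :: "nat \<Rightarrow> nat" assume "\<And>i. i < k \<Longrightarrow> f i = g i"
    then have "inj_on f {..<k} = inj_on g {..<k}" by (intro inj_on_cong) auto
    then show "of_bool (inj_on f {..<k}) = (of_bool (inj_on g {..<k}) :: complex)" by simp
  qed (auto simp: J_def)
  also have "PiE {..<k} J = {..<k} \<rightarrow>\<^sub>E {..<k}" by (rule PiE_cong) (auto simp: J_def)
  also have "PiE {..<m} (\<lambda>i. J (k + i)) = {..<m} \<rightarrow>\<^sub>E {k..<k + m}" by (rule PiE_cong) (auto simp: J_def)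
  finally show ?thesis by (simp add: card_inj_self_maps J_def)
qed

text \<open>The sum over all closed walks of length \<open>k\<close>. It is the trace of the \<open>k\<close>-th power of the matrix for \<open>k \<ge> 1\<close>, but it
is 1 (and not \<open>N\<close>) for \<open>k = 0\<close>, so that \<open>cyc_sum N k * cyc_sum N 0\<close> is a first moment.\<close>
definition cyc_sum :: "nat \<Rightarrow> nat \<Rightarrow> (nat \<Rightarrow> nat \<Rightarrow> complex) \<Rightarrow> complex" where
  "cyc_sum N k c = (\<Sum>f \<in> {..<k} \<rightarrow>\<^sub>E {..<N}. \<Prod>i<k. c (f i) (f (cyc k i)))"

lemma cyc_sum_mult:
  "cyc_sum N k c * cyc_sum N m c
    = (\<Sum>f \<in> {..<k + m} \<rightarrow>\<^sub>E {..<N}. \<Prod>i<k + m. c (f i) (f (cyc2 k m i)))"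
proof -
  have "(\<Prod>i<k + m. c (f i) (f (cyc2 k m i)))
      = (\<Prod>i<k. c (f i) (f (cyc k i))) * (\<Prod>i<m. c (f (k + i)) (f (k + cyc m i)))" for f
  proof -
    have "(\<Prod>i<k + m. c (f i) (f (cyc2 k m i)))
      = (\<Prod>i\<in>{..<k} \<union> {k..<k + m}. c (f i) (f (cyc2 k m i)))" by (rule prod.cong) auto
    also have "... = (\<Prod>i\<in>{..<k}. c (f i) (f (cyc2 k m i))) * (\<Prod>i\<in>{k..<k + m}. c (f i) (f (cyc2 k m i)))"
      by (rule prod.union_disjoint) auto
    finally have "(\<Prod>i<k + m. c (f i) (f (cyc2 k m i)))
      = (\<Prod>i\<in>{..<k}. c (f i) (f (cyc2 k m i))) * (\<Prod>i\<in>{k..<k + m}. c (f i) (f (cyc2 k m i)))" .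
    moreover have "(\<Prod>i\<in>{k..<k + m}. c (f i) (f (cyc2 k m i))) = (\<Prod>i<m. c (f (k + i)) (f (k + cyc m i)))"
      by (rule prod.reindex_bij_witness[of _ "\<lambda>l. k + l" "\<lambda>y. y - k"]) (auto simp: cyc2_def)
    ultimately show ?thesis by (simp add: cyc2_def)
  qed
  then have "(\<Sum>f \<in> {..<k + m} \<rightarrow>\<^sub>E {..<N}. \<Prod>i<k + m. c (f i) (f (cyc2 k m i)))
      = (\<Sum>f \<in> {..<k + m} \<rightarrow>\<^sub>E {..<N}. (\<Prod>i<k. c (f i) (f (cyc k i)))
           * (\<lambda>g. \<Prod>i<m. c (g i) (g (cyc m i))) (\<lambda>i. f (k + i)))" by simp
  also have "... = cyc_sum N k c * cyc_sum N m c"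
    unfolding cyc_sum_def by (rule sum_PiE_append) (auto intro!: prod.cong simp: cyc_less)
  finally show ?thesis by simp
qed

section \<open>Unitarily invariant Hermitian ensembles\<close>

text \<open>Conjugation alters entry functions outside the range of indices as well, so invariance can only be used for
functionals that do not see these values.\<close>
definition depends_on_entries :: "nat \<Rightarrow> ((nat \<Rightarrow> nat \<Rightarrow> complex) \<Rightarrow> 'c) \<Rightarrow> bool" where
  "depends_on_entries N \<Phi> \<longleftrightarrow> (\<forall>c c'. (\<forall>i<N. \<forall>j<N. c i j = c' i j) \<longrightarrow> \<Phi> c = \<Phi> c')"

lemma depends_on_entriesI:
  assumes "\<And>c c'. (\<And>i j. i < N \<Longrightarrow> j < N \<Longrightarrow> c i j = c' i j) \<Longrightarrow> \<Phi> c = \<Phi> c'"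
  shows "depends_on_entries N \<Phi>"
  using assms unfolding depends_on_entries_def by blast

lemma depends_on_entriesD:
  assumes "depends_on_entries N \<Phi>" "\<And>i j. i < N \<Longrightarrow> j < N \<Longrightarrow> c i j = c' i j"
  shows "\<Phi> c = \<Phi> c'"
  using assms unfolding depends_on_entries_def by blast

text \<open>Invariance in law is stated through a measure preserving map \<open>T\<close> that realises the conjugation, rather than through
distributions on a space of matrices: integrability and expectations of functionals are transported along \<open>T\<close>.\<close>
locale invariant_hermitian_entries = prob_space P for P :: "'a measure" +
  fixes N :: nat and b :: "nat \<Rightarrow> nat \<Rightarrow> 'a \<Rightarrow> complex"
  assumes entry_measurable: "i < N \<Longrightarrow> j < N \<Longrightarrow> b i j \<in> borel_measurable P"
    and hermitian: "i < N \<Longrightarrow> j < N \<Longrightarrow> w \<in> space P \<Longrightarrow> b j i w = cnj (b i j w)"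
    and invariant: "unitary_fun N W \<Longrightarrow> \<exists>T \<in> measurable P P. distr P P T = P \<and>
      (\<forall>w \<in> space P. \<forall>i<N. \<forall>j<N. b i j (T w) = conj_by N W (\<lambda>i j. b i j w) i j)"
begin

abbreviation entries :: "'a \<Rightarrow> nat \<Rightarrow> nat \<Rightarrow> complex" where
  "entries w \<equiv> \<lambda>i j. b i j w"

lemma transfer:
  fixes \<Phi> :: "(nat \<Rightarrow> nat \<Rightarrow> complex) \<Rightarrow> 'c::{banach, second_countable_topology}"
  assumes W: "unitary_fun N W"
    and loc: "depends_on_entries N \<Phi>"
    and meas: "(\<lambda>w. \<Phi> (entries w)) \<in> borel_measurable P"
  shows "integrable P (\<lambda>w. \<Phi> (conj_by N W (entries w))) \<longleftrightarrow> integrable P (\<lambda>w. \<Phi> (entries w))"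
    and "expectation (\<lambda>w. \<Phi> (conj_by N W (entries w))) = expectation (\<lambda>w. \<Phi> (entries w))"
proof -
  let ?Y = "\<lambda>w. \<Phi> (conj_by N W (entries w))"
  obtain T where T: "T \<in> measurable P P" "distr P P T = P"
    and bT: "\<And>w i j. w \<in> space P \<Longrightarrow> i < N \<Longrightarrow> j < N \<Longrightarrow> b i j (T w) = conj_by N W (entries w) i j"
    using invariant[OF W] by blast
  define X where "X w = \<Phi> (entries w)" for w
  have X: "X \<in> borel_measurable P" using meas by (simp add: X_def[abs_def])
  have eq: "\<Phi> (conj_by N W (entries w)) = X (T w)" if "w \<in> space P" for w
    unfolding X_def by (rule depends_on_entriesD[OF loc]) (simp add: bT that)
  have "integrable P ?Y \<longleftrightarrow> integrable P (\<lambda>w. X (T w))"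
    by (rule Bochner_Integration.integrable_cong) (auto simp: eq)
  also have "... \<longleftrightarrow> integrable P X"
    using integrable_distr_eq[OF T(1) X] T(2) by simp
  finally show "integrable P ?Y \<longleftrightarrow> integrable P (\<lambda>w. \<Phi> (entries w))" by (simp add: X_def[abs_def])
  have "expectation ?Y = expectation (\<lambda>w. X (T w))"
    by (rule Bochner_Integration.integral_cong) (auto simp: eq)
  also have "... = expectation X"
    using integral_distr[OF T(1) X] T(2) by simp
  finally show "expectation ?Y = expectation (\<lambda>w. \<Phi> (entries w))" by (simp add: X_def[abs_def])
qed

lemma transfer_perm:
  fixes \<Phi> :: "(nat \<Rightarrow> nat \<Rightarrow> complex) \<Rightarrow> 'c::{banach, second_countable_topology}"
  assumes \<sigma>: "bij_betw \<sigma> {..<N} {..<N}"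
    and loc: "depends_on_entries N \<Phi>"
    and meas: "(\<lambda>w. \<Phi> (entries w)) \<in> borel_measurable P"
  shows "integrable P (\<lambda>w. \<Phi> (\<lambda>i j. b (\<sigma> i) (\<sigma> j) w)) \<longleftrightarrow> integrable P (\<lambda>w. \<Phi> (entries w))"
    and "expectation (\<lambda>w. \<Phi> (\<lambda>i j. b (\<sigma> i) (\<sigma> j) w)) = expectation (\<lambda>w. \<Phi> (entries w))"
proof -
  have eq: "\<Phi> (conj_by N (perm_fun \<sigma>) (entries w)) = \<Phi> (\<lambda>i j. b (\<sigma> i) (\<sigma> j) w)" for w
    by (rule depends_on_entriesD[OF loc]) (simp add: conj_by_perm[OF \<sigma>])
  show "integrable P (\<lambda>w. \<Phi> (\<lambda>i j. b (\<sigma> i) (\<sigma> j) w)) \<longleftrightarrow> integrable P (\<lambda>w. \<Phi> (entries w))"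
    "expectation (\<lambda>w. \<Phi> (\<lambda>i j. b (\<sigma> i) (\<sigma> j) w)) = expectation (\<lambda>w. \<Phi> (entries w))"
    using transfer[OF unitary_perm[OF \<sigma>] loc meas] by (simp_all add: eq)
qed

abbreviation diag_moment :: "nat \<Rightarrow> real" where
  "diag_moment n \<equiv> expectation (\<lambda>w. norm (b 0 0 w) ^ n)"

lemma diag_moment_nonneg: "diag_moment n \<ge> 0" by (intro integral_nonneg_AE) auto

lemma diag_entry_moment:
  assumes i: "i < N" and int: "integrable P (\<lambda>w. norm (b 0 0 w) ^ n)"
  shows "integrable P (\<lambda>w. norm (b i i w) ^ n)" "expectation (\<lambda>w. norm (b i i w) ^ n) = diag_moment n"
proof -
  have "inj_on (\<lambda>_::nat. i) {..<1}" "(\<lambda>_::nat. i) ` {..<1} \<subseteq> {..<N}"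
    using i by (auto simp: inj_on_def)
  then obtain \<sigma> where \<sigma>: "bij_betw \<sigma> {..<N} {..<N}" and "\<And>l. l < 1 \<Longrightarrow> \<sigma> l = i"
    using inj_extends_to_perm by blast
  then have \<sigma>0: "\<sigma> 0 = i" by simp
  have N: "0 < N" using i by simp
  note [measurable] = entry_measurable[OF N N]
  have *: "depends_on_entries N (\<lambda>c. norm (c 0 0) ^ n)"
      using N by (intro depends_on_entriesI) simp
  note tr = transfer_perm[where \<Phi> = "\<lambda>c. norm (c 0 0) ^ n", OF \<sigma> *]
  show "integrable P (\<lambda>w. norm (b i i w) ^ n)" using tr(1) int by (simp add: \<sigma>0)
  show "expectation (\<lambda>w. norm (b i i w) ^ n) = diag_moment n" using tr(2) by (simp add: \<sigma>0)
qed

text \<open>Conjugation by the two-dimensional Fourier matrix makes \<open>Re b\<^sub>0\<^sub>1\<close> half the difference of two diagonal entries, each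
of which has the law of \<open>b\<^sub>0\<^sub>0\<close>.\<close>
lemma real_part_moment:
  assumes N: "1 < N" and int: "integrable P (\<lambda>w. norm (b 0 0 w) ^ n)"
  shows "integrable P (\<lambda>w. \<bar>Re (b 0 1 w)\<bar> ^ n)"
    "expectation (\<lambda>w. \<bar>Re (b 0 1 w)\<bar> ^ n) \<le> 2 * diag_moment n"
proof -
  note One_nat_def [simp del]
  have N0: "0 < N" using N by simp
  note [measurable] = entry_measurable[OF N0 N0] entry_measurable[OF N0 N] entry_measurable[OF N N]
  have U: "unitary_fun N (fourier_fun 0 2)" using N by (intro unitary_fourier) auto
  define d where "d i w = conj_by N (fourier_fun 0 2) (entries w) i i" for i w
  let ?d = "\<lambda>w. norm (d 0 w) ^ n + norm (d 1 w) ^ n"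
  have z2: "zeta 2 = -1" by (simp add: zeta_def)
  have diff: "\<bar>Re (b 0 1 w)\<bar> \<le> max (norm (d 0 w)) (norm (d 1 w))" if w: "w \<in> space P" for w
  proof -
    have d01: "d 0 w = (b 0 0 w + b 0 1 w + b 1 0 w + b 1 1 w) / 2"
      "d 1 w = (b 0 0 w - b 0 1 w - b 1 0 w + b 1 1 w) / 2"
      unfolding d_def using conj_by_fourier_inside[of 0 2 N 0 0 "\<lambda>i j. b i j w"]
        conj_by_fourier_inside[of 0 2 N 1 1 "\<lambda>i j. b i j w"] N
      by (simp_all add: z2[unfolded numeral_2_eq_2] numeral_2_eq_2 One_nat_def)
    have "d 0 w - d 1 w = b 0 1 w + b 1 0 w"
      unfolding d01 by (simp add: field_simps)
    also have "b 1 0 w = cnj (b 0 1 w)" using hermitian[OF N0 N w] .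
    finally have "Re (d 0 w - d 1 w) = 2 * Re (b 0 1 w)" by simp
    moreover have "\<bar>Re (d 0 w - d 1 w)\<bar> \<le> norm (d 0 w) + norm (d 1 w)"
      by (meson abs_Re_le_cmod norm_triangle_ineq4 order_trans)
    ultimately show ?thesis by linarith
  qed
  have pw: "\<bar>Re (b 0 1 w)\<bar> ^ n \<le> ?d w" if w: "w \<in> space P" for w
  proof -
    have "\<bar>Re (b 0 1 w)\<bar> ^ n \<le> max (norm (d 0 w)) (norm (d 1 w)) ^ n" by (intro power_mono diff[OF w]) auto
    also have "... \<le> ?d w" by (simp add: max_def)
    finally show ?thesis .
  qed
  have d_int: "integrable P (\<lambda>w. norm (d i w) ^ n)" and d_E: "expectation (\<lambda>w. norm (d i w) ^ n) = diag_moment n"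
    if i: "i < N" for i
  proof -
    note [measurable] = entry_measurable[OF i i]
    have *: "depends_on_entries N (\<lambda>c. norm (c i i) ^ n)"
      using i by (intro depends_on_entriesI) simp
    note tr = transfer[where \<Phi> = "\<lambda>c. norm (c i i) ^ n", OF U *, folded d_def]
    show "integrable P (\<lambda>w. norm (d i w) ^ n)" using tr(1) diag_entry_moment[OF i int] by simp
    show "expectation (\<lambda>w. norm (d i w) ^ n) = diag_moment n"
      using tr(2) diag_entry_moment[OF i int] by simp
  qed
  have sum_int: "integrable P (\<lambda>w. ?d w)" by (intro Bochner_Integration.integrable_add d_int N N0)
  show int': "integrable P (\<lambda>w. \<bar>Re (b 0 1 w)\<bar> ^ n)"
    by (rule Bochner_Integration.integrable_bound[OF sum_int]) (auto intro!: AE_I2 simp: pw abs_of_nonneg)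
  have "expectation (\<lambda>w. \<bar>Re (b 0 1 w)\<bar> ^ n) \<le> expectation (\<lambda>w. ?d w)"
    by (intro integral_mono int' sum_int pw)
  also have "... = 2 * diag_moment n"
    using Bochner_Integration.integral_add[OF d_int[OF N0] d_int[OF N]] d_E[OF N0] d_E[OF N] by simp
  finally show "expectation (\<lambda>w. \<bar>Re (b 0 1 w)\<bar> ^ n) \<le> 2 * diag_moment n" .
qed

text \<open>The phase \<open>\<i>\<close> at coordinate 1 exchanges the real part of \<open>b\<^sub>0\<^sub>1\<close> with its imaginary part, up to sign.\<close>
lemma imaginary_part_moment:
  assumes N: "1 < N" and int: "integrable P (\<lambda>w. norm (b 0 0 w) ^ n)"
  shows "integrable P (\<lambda>w. \<bar>Im (b 0 1 w)\<bar> ^ n)"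
    "expectation (\<lambda>w. \<bar>Im (b 0 1 w)\<bar> ^ n) \<le> 2 * diag_moment n"
proof -
  note One_nat_def [simp del]
  have N0: "0 < N" using N by simp
  note [measurable] = entry_measurable[OF N0 N]
  define d where "d l = (if l = 1 then \<i> else 1)" for l :: nat
  have U: "unitary_fun N (phase_fun d)" by (rule unitary_phase) (simp add: d_def)
  have *: "depends_on_entries N (\<lambda>c. \<bar>Re (c 0 1)\<bar> ^ n)"
      using N N0 by (intro depends_on_entriesI) simp
  note tr = transfer[where \<Phi> = "\<lambda>c. \<bar>Re (c 0 1)\<bar> ^ n", OF U *]
  have eq: "\<bar>Re (conj_by N (phase_fun d) (entries w) 0 1)\<bar> = \<bar>Im (b 0 1 w)\<bar>" for w
    using N N0 by (simp add: conj_by_phase d_def)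
  show "integrable P (\<lambda>w. \<bar>Im (b 0 1 w)\<bar> ^ n)"
    using tr(1) real_part_moment(1)[OF assms] by (simp only: eq) simp
  show "expectation (\<lambda>w. \<bar>Im (b 0 1 w)\<bar> ^ n) \<le> 2 * diag_moment n"
    using tr(2) real_part_moment(2)[OF assms] by (simp only: eq) simp
qed

lemma entry_moment:
  assumes ij: "i < N" "j < N" and int: "integrable P (\<lambda>w. norm (b 0 0 w) ^ n)"
  shows "integrable P (\<lambda>w. norm (b i j w) ^ n)"
    "expectation (\<lambda>w. norm (b i j w) ^ n) \<le> 2 ^ (n + 2) * diag_moment n"
proof -
  note One_nat_def [simp del]
  have "integrable P (\<lambda>w. norm (b i j w) ^ n)
      \<and> expectation (\<lambda>w. norm (b i j w) ^ n) \<le> 2 ^ (n + 2) * diag_moment n"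
  proof (cases "i = j")
    case True
    have "1 * diag_moment n \<le> 2 ^ (n + 2) * diag_moment n"
      by (intro mult_right_mono diag_moment_nonneg one_le_power) simp
    then show ?thesis using diag_entry_moment[OF ij(1) int] True by simp
  next
    case False
    then have N: "1 < N" and N0: "0 < N" using ij by auto
    note [measurable] = entry_measurable[OF N0 N]
    note int_Re = real_part_moment(1)[OF N int] and int_Im = imaginary_part_moment(1)[OF N int]
    have int_bd: "integrable P (\<lambda>w. 2 ^ n * (\<bar>Re (b 0 1 w)\<bar> ^ n + \<bar>Im (b 0 1 w)\<bar> ^ n))"
      by (intro integrable_mult_right Bochner_Integration.integrable_add int_Re int_Im)
    have pw: "norm (b 0 1 w) ^ n \<le> 2 ^ n * (\<bar>Re (b 0 1 w)\<bar> ^ n + \<bar>Im (b 0 1 w)\<bar> ^ n)" for w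
    proof -
      have "norm (b 0 1 w) ^ n \<le> (2 * max \<bar>Re (b 0 1 w)\<bar> \<bar>Im (b 0 1 w)\<bar>) ^ n"
        using cmod_le[of "b 0 1 w"] by (intro power_mono) auto
      also have "... \<le> 2 ^ n * (\<bar>Re (b 0 1 w)\<bar> ^ n + \<bar>Im (b 0 1 w)\<bar> ^ n)"
        by (simp add: power_mult_distrib max_def)
      finally show ?thesis .
    qed
    have i01: "integrable P (\<lambda>w. norm (b 0 1 w) ^ n)"
      by (rule Bochner_Integration.integrable_bound[OF int_bd]) (use pw in \<open>auto intro!: AE_I2 simp: abs_of_nonneg\<close>)
    have "expectation (\<lambda>w. norm (b 0 1 w) ^ n) \<le> expectation (\<lambda>w. 2 ^ n * (\<bar>Re (b 0 1 w)\<bar> ^ n + \<bar>Im (b 0 1 w)\<bar> ^ n))"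
      by (intro integral_mono i01 int_bd pw)
    also have "... = 2 ^ n * (expectation (\<lambda>w. \<bar>Re (b 0 1 w)\<bar> ^ n) + expectation (\<lambda>w. \<bar>Im (b 0 1 w)\<bar> ^ n))"
      by (simp add: Bochner_Integration.integral_add[OF int_Re int_Im])
    also have "... \<le> 2 ^ n * (2 * diag_moment n + 2 * diag_moment n)"
      by (intro mult_left_mono add_mono real_part_moment(2) imaginary_part_moment(2) N int) auto
    also have "... = 2 ^ (n + 2) * diag_moment n" by simp
    finally have e01: "expectation (\<lambda>w. norm (b 0 1 w) ^ n) \<le> 2 ^ (n + 2) * diag_moment n" .
    have "inj_on (\<lambda>l::nat. if l = 0 then i else j) {..<2}"
      using False by (auto simp: inj_on_def split: if_splits)
    moreover have "(\<lambda>l::nat. if l = 0 then i else j) ` {..<2} \<subseteq> {..<N}" using ij by auto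
    ultimately obtain \<sigma> where \<sigma>: "bij_betw \<sigma> {..<N} {..<N}"
      and \<sigma>': "\<And>l. l < 2 \<Longrightarrow> \<sigma> l = (if l = 0 then i else j)"
      using inj_extends_to_perm by blast
    have \<sigma>01: "\<sigma> 0 = i" "\<sigma> 1 = j" using \<sigma>'[of 0] \<sigma>'[of 1] by auto
    have *: "depends_on_entries N (\<lambda>c. norm (c 0 1) ^ n)"
      using N N0 by (intro depends_on_entriesI) simp
    note tr = transfer_perm[where \<Phi> = "\<lambda>c. norm (c 0 1) ^ n", OF \<sigma> *]
    show ?thesis using tr i01 e01 by (simp only: \<sigma>01) simp
  qed
  then show "integrable P (\<lambda>w. norm (b i j w) ^ n)"
    "expectation (\<lambda>w. norm (b i j w) ^ n) \<le> 2 ^ (n + 2) * diag_moment n" by auto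
qed

text \<open>A product of \<open>n\<close> numbers is at most the sum of the \<open>n\<close>-th powers of their moduli, and every entry is controlled by
\<open>b\<^sub>0\<^sub>0\<close>. Since the bound does not grow with \<open>N\<close>, walks with repeated vertices are negligible.\<close>
lemma monomial_moment:
  assumes I: "finite I" "I \<noteq> {}" and pq: "\<And>i. i \<in> I \<Longrightarrow> p i < N" "\<And>i. i \<in> I \<Longrightarrow> q i < N"
    and int: "integrable P (\<lambda>w. norm (b 0 0 w) ^ card I)"
  shows "integrable P (\<lambda>w. \<Prod>i\<in>I. b (p i) (q i) w)"
    "norm (expectation (\<lambda>w. \<Prod>i\<in>I. b (p i) (q i) w)) \<le> real (card I) * 2 ^ (card I + 2) * diag_moment (card I)"
proof -
  let ?s = "\<lambda>w. \<Sum>i\<in>I. norm (b (p i) (q i) w) ^ card I"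
  let ?p = "\<lambda>w. \<Prod>i\<in>I. b (p i) (q i) w"
  have m: "(\<lambda>w. ?p w) \<in> borel_measurable P" by (intro borel_measurable_prod entry_measurable pq)
  note e = entry_moment[OF pq(1) pq(2) int]
  have s: "integrable P (\<lambda>w. ?s w)" by (intro Bochner_Integration.integrable_sum e(1))
  have le: "norm (?p w) \<le> (?s w)" for w
    using prod_le_sum_power_card[OF I, of "\<lambda>i. norm (b (p i) (q i) w)"] by (simp add: prod_norm)
  show i: "integrable P (\<lambda>w. ?p w)"
  proof (rule Bochner_Integration.integrable_bound[OF s m], rule AE_I2)
    fix w
    show "norm (?p w) \<le> norm (?s w)"
      using le[of w] by (simp add: sum_nonneg)
  qed
  have "norm (expectation (\<lambda>w. ?p w)) \<le> expectation (\<lambda>w. norm (?p w))" by (rule integral_norm_bound)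
  also have "... \<le> expectation (\<lambda>w. ?s w)" by (intro integral_mono integrable_norm i s le)
  also have "... = (\<Sum>i\<in>I. expectation (\<lambda>w. norm (b (p i) (q i) w) ^ card I))"
    by (intro Bochner_Integration.integral_sum e(1))
  also have "... \<le> (\<Sum>i\<in>I. 2 ^ (card I + 2) * diag_moment (card I))" by (intro sum_mono e(2))
  finally show "norm (expectation (\<lambda>w. ?p w)) \<le> real (card I) * 2 ^ (card I + 2) * diag_moment (card I)"
    by simp
qed

lemma monomial_perm:
  assumes \<sigma>: "bij_betw \<sigma> {..<N} {..<N}" and pq: "\<And>i. i \<in> I \<Longrightarrow> p i < N" "\<And>i. i \<in> I \<Longrightarrow> q i < N"
  shows "expectation (\<lambda>w. \<Prod>i\<in>I. b (\<sigma> (p i)) (\<sigma> (q i)) w) = expectation (\<lambda>w. \<Prod>i\<in>I. b (p i) (q i) w)"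
  by (rule transfer_perm(2)[where \<Phi> = "\<lambda>c. \<Prod>i\<in>I. c (p i) (q i)", OF \<sigma>])
    (auto intro!: depends_on_entriesI prod.cong borel_measurable_prod entry_measurable pq)

lemma monomial_phase:
  assumes d: "\<And>i. i < N \<Longrightarrow> norm (d i) = 1" and pq: "\<And>i. i \<in> I \<Longrightarrow> p i < N" "\<And>i. i \<in> I \<Longrightarrow> q i < N"
  shows "(\<Prod>i\<in>I. cnj (d (p i)) * d (q i)) * expectation (\<lambda>w. \<Prod>i\<in>I. b (p i) (q i) w)
    = expectation (\<lambda>w. \<Prod>i\<in>I. b (p i) (q i) w)"
proof -
  have "expectation (\<lambda>w. \<Prod>i\<in>I. conj_by N (phase_fun d) (entries w) (p i) (q i))
      = expectation (\<lambda>w. \<Prod>i\<in>I. b (p i) (q i) w)"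
    by (rule transfer(2)[where \<Phi> = "\<lambda>c. \<Prod>i\<in>I. c (p i) (q i)", OF unitary_phase[OF d]])
      (auto intro!: depends_on_entriesI prod.cong borel_measurable_prod entry_measurable pq)
  moreover have "(\<Prod>i\<in>I. conj_by N (phase_fun d) (entries w) (p i) (q i))
      = (\<Prod>i\<in>I. cnj (d (p i)) * d (q i)) * (\<Prod>i\<in>I. b (p i) (q i) w)" for w
  proof -
    have "(\<Prod>i\<in>I. conj_by N (phase_fun d) (entries w) (p i) (q i))
      = (\<Prod>i\<in>I. (cnj (d (p i)) * d (q i)) * b (p i) (q i) w)"
      by (rule prod.cong) (auto simp: conj_by_phase pq)
    then show ?thesis by (simp only: prod.distrib)
  qed
  ultimately show ?thesis by simp
qed

text \<open>At an unbalanced vertex the monomial picks up a nontrivial power of a phase under conjugation by a diagonal unitary,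
although its expectation must not change.\<close>
lemma noninjective_monomial_vanishes:
  assumes kmN: "k + m \<le> N"
    and h: "h \<in> PiE {..<k + m} (\<lambda>i. if i < k then {..<k} else {k..<k + m})"
    and ninj: "\<not> inj_on h {..<k + m}"
  shows "expectation (\<lambda>w. \<Prod>i<k + m. b (h i) (cyc2 k m (h i)) w) = 0"
proof -
  let ?E = "expectation (\<lambda>w. \<Prod>i<k + m. b (h i) (cyc2 k m (h i)) w)"
  obtain j where j: "j < k + m"
    and unb: "card {i \<in> {..<k + m}. h i = cyc2 k m j} \<noteq> card {i \<in> {..<k + m}. h i = j}"
    using unbalanced_vertex[OF h ninj] by blast
  define J where "J = cyc2 k m j"
  define r s where "r = card {i \<in> {..<k + m}. h i = J}" and "s = card {i \<in> {..<k + m}. h i = j}"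
  \<comment> \<open>the phase for which the monomial is multiplied by \<open>-1\<close>\<close>
  define \<alpha> where "\<alpha> = pi / (real s - real r)"
  define d where "d l = (if l = J then cis \<alpha> else 1)" for l :: nat
  have hr: "h i < k + m" if "i < k + m" for i
    using h that by (fastforce simp: PiE_def Pi_def split: if_splits)
  have prod_if: "(\<Prod>i<k + m. if Q i then z else 1) = z ^ card {i \<in> {..<k + m}. Q i}" for Q and z :: complex
    by (subst prod.If_cases) (auto simp: Int_def)
  have tauJ: "cyc2 k m (h i) = J \<longleftrightarrow> h i = j" if "i < k + m" for i
    unfolding J_def using hr[OF that] j by (intro inj_on_eq_iff[OF inj_on_cyc2]) auto
  have "(\<Prod>i<k + m. cnj (d (h i)) * d (cyc2 k m (h i)))
      = (\<Prod>i<k + m. if h i = J then cis (- \<alpha>) else 1) * (\<Prod>i<k + m. if h i = j then cis \<alpha> else 1)"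
    unfolding prod.distrib[symmetric] by (intro prod.cong refl) (auto simp: d_def tauJ cis_cnj)
  also have "... = cis (- \<alpha>) ^ r * cis \<alpha> ^ s" by (simp only: prod_if r_def s_def)
  also have "... = cis ((real s - real r) * \<alpha>)"
    unfolding Complex.DeMoivre cis_mult by (simp add: algebra_simps)
  also have "(real s - real r) * \<alpha> = pi"
    using unb by (simp add: \<alpha>_def r_def s_def J_def)
  finally have "(\<Prod>i<k + m. cnj (d (h i)) * d (cyc2 k m (h i))) = -1" by simp
  moreover have "(\<Prod>i<k + m. cnj (d (h i)) * d (cyc2 k m (h i))) * ?E
      = ?E"
    using hr cyc2_less kmN by (intro monomial_phase) (fastforce simp: d_def)+
  ultimately have "?E
      = - ?E" by simp
  then show ?thesis by simp
qed

abbreviation cycle_moment :: "nat \<Rightarrow> nat \<Rightarrow> complex" where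
  "cycle_moment k m \<equiv> expectation (\<lambda>w. \<Prod>i<k + m. b i (cyc2 k m i) w)"

lemma injective_monomial:
  assumes h: "h \<in> PiE {..<k + m} (\<lambda>i. if i < k then {..<k} else {k..<k + m})"
    and inj: "inj_on h {..<k + m}"
  shows "(\<Prod>i<k + m. c (h i) (cyc2 k m (h i))) = (\<Prod>i<k + m. c i (cyc2 k m i) :: complex)"
proof -
  have "h ` {..<k + m} \<subseteq> {..<k + m}"
    using h by (fastforce simp: PiE_def Pi_def split: if_splits)
  then have "h ` {..<k + m} = {..<k + m}" by (intro endo_inj_surj inj) auto
  then have "bij_betw h {..<k + m} {..<k + m}" using inj by (simp add: bij_betw_def)
  then show ?thesis by (rule prod.reindex_bij_betw[of h _ _ "\<lambda>i. c i (cyc2 k m i)"])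
qed

text \<open>The monomials that survive use every edge of the two cycles exactly once, and \<open>k! m!\<close> orderings of the factors give
the same monomial.\<close>
lemma block_power_moment:
  assumes kmN: "k + m \<le> N" and pos: "k + m > 0"
    and int: "integrable P (\<lambda>w. norm (b 0 0 w) ^ (k + m))"
  shows "expectation (\<lambda>w. (\<Sum>l<k. b l (cyc k l) w) ^ k * (\<Sum>l<m. b (k + l) (k + cyc m l) w) ^ m)
    = fact k * fact m * cycle_moment k m"
proof -
  let ?p = "\<lambda>h w. \<Prod>i<k + m. b (h i) (cyc2 k m (h i)) w"
  let ?H = "PiE {..<k + m} (\<lambda>i. if i < k then {..<k} else {k..<k + m})"
  have hr: "h i < N" "cyc2 k m (h i) < N" if "h \<in> ?H" "i \<in> {..<k + m}" for h i
  proof -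
    have "h i < k + m" using that by (fastforce simp: PiE_def Pi_def split: if_splits)
    then show "h i < N" "cyc2 k m (h i) < N" using cyc2_less[of "h i" k m] kmN by auto
  qed
  have int_mono: "integrable P (\<lambda>w. ?p h w)" if "h \<in> ?H" for h
    using monomial_moment(1)[of "{..<k + m}" h "\<lambda>i. cyc2 k m (h i)"] pos int hr[OF that] by auto
  have "expectation (\<lambda>w. (\<Sum>l<k. b l (cyc k l) w) ^ k * (\<Sum>l<m. b (k + l) (k + cyc m l) w) ^ m)
      = expectation (\<lambda>w. \<Sum>h\<in>?H. ?p h w)"
    by (simp only: block_products_expand[where c = "\<lambda>i j. b i j w" for w])
  also have "... = (\<Sum>h\<in>?H. expectation (\<lambda>w. ?p h w))"
    by (rule Bochner_Integration.integral_sum[OF int_mono])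
  also have "... = (\<Sum>h\<in>?H. of_bool (inj_on h {..<k + m}) * cycle_moment k m)"
  proof (rule sum.cong[OF refl])
    fix h assume h: "h \<in> ?H"
    show "expectation (\<lambda>w. ?p h w) = of_bool (inj_on h {..<k + m}) * cycle_moment k m"
    proof (cases "inj_on h {..<k + m}")
      case True
      then show ?thesis using injective_monomial[OF h True, of "\<lambda>i j. b i j w" for w] by simp
    next
      case False
      then show ?thesis using noninjective_monomial_vanishes[OF kmN h False] by simp
    qed
  qed
  also have "... = fact k * fact m * cycle_moment k m"
    by (simp only: sum_distrib_right[symmetric] count_inj_block_maps)
  finally show ?thesis .
qed

text \<open>By \<open>fourier_diagonal\<close>, conjugation with a Fourier block turns each statistic of diagonal entries into a sum along a
cycle. The two blocks are applied one after the other, and neither changes the entries that the other one uses.\<close>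
lemma diagonal_root_moment:
  assumes kmN: "k + m \<le> N"
  shows "expectation (\<lambda>w. (\<Sum>j<k. cnj (zeta k) ^ j * b j j w) ^ k * (\<Sum>j<m. cnj (zeta m) ^ j * b (k + j) (k + j) w) ^ m)
    = expectation (\<lambda>w. (\<Sum>l<k. b l (cyc k l) w) ^ k * (\<Sum>l<m. b (k + l) (k + cyc m l) w) ^ m)"
proof -
  define \<Phi>1 :: "(nat \<Rightarrow> nat \<Rightarrow> complex) \<Rightarrow> complex" where
    "\<Phi>1 c = (\<Sum>j<k. cnj (zeta k) ^ j * c j j) ^ k * (\<Sum>j<m. cnj (zeta m) ^ j * c (k + j) (k + j)) ^ m" for c
  define \<Phi>2 :: "(nat \<Rightarrow> nat \<Rightarrow> complex) \<Rightarrow> complex" where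
    "\<Phi>2 c = (\<Sum>l<k. c l (cyc k l)) ^ k * (\<Sum>j<m. cnj (zeta m) ^ j * c (k + j) (k + j)) ^ m" for c
  have cN: "l < N" "cyc k l < N" if "l < k" for l using that kmN cyc_less[OF that] by auto
  have cN2: "k + l < N" "k + cyc m l < N" if "l < m" for l using that kmN cyc_less[OF that] by auto
  have step1: "\<Phi>1 (conj_by N (fourier_fun 0 k) c) = \<Phi>2 c" for c
  proof -
    have "conj_by N (fourier_fun 0 k) c (k + j) (k + j) = c (k + j) (k + j)" if "j < m" for j
      using that kmN by (intro conj_by_fourier_outside) auto
    then show ?thesis
      using fourier_diagonal[of 0 k N c] kmN by (simp add: \<Phi>1_def \<Phi>2_def)
  qed
  have step2: "\<Phi>2 (conj_by N (fourier_fun k m) c)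
      = (\<Sum>l<k. c l (cyc k l)) ^ k * (\<Sum>l<m. c (k + l) (k + cyc m l)) ^ m" for c
  proof -
    have "conj_by N (fourier_fun k m) c l (cyc k l) = c l (cyc k l)" if "l < k" for l
      using that cN[OF that] cyc_less[OF that] by (intro conj_by_fourier_outside) auto
    then show ?thesis
      using fourier_diagonal[of k m N c] kmN by (simp add: \<Phi>2_def)
  qed
  have dep: "depends_on_entries N \<Phi>1" "depends_on_entries N \<Phi>2"
    by (intro depends_on_entriesI; simp add: \<Phi>1_def \<Phi>2_def cN cN2)+
  have meas: "(\<lambda>w. \<Phi>1 (entries w)) \<in> borel_measurable P" "(\<lambda>w. \<Phi>2 (entries w)) \<in> borel_measurable P"
    unfolding \<Phi>1_def \<Phi>2_def
    by (auto intro!: borel_measurable_times borel_measurable_power borel_measurable_sum entry_measurable cN cN2)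
  have "expectation (\<lambda>w. \<Phi>1 (entries w)) = expectation (\<lambda>w. \<Phi>2 (entries w))"
    using transfer(2)[OF unitary_fourier dep(1) meas(1), of 0 k] kmN by (simp add: step1)
  also have "... = expectation (\<lambda>w. (\<Sum>l<k. b l (cyc k l) w) ^ k * (\<Sum>l<m. b (k + l) (k + cyc m l) w) ^ m)"
    using transfer(2)[OF unitary_fourier dep(2) meas(2), of k m] kmN by (simp add: step2)
  finally show ?thesis by (simp add: \<Phi>1_def)
qed

text \<open>Walks with distinct vertices are relabelled to the standard cycles by a permutation matrix, and \<open>D\<close> is their number.
The other walks are estimated by their number times the uniform bound for monomials.\<close>
lemma cyc_sum_moment:
  assumes kmN: "k + m \<le> N" and pos: "k + m > 0"
    and int: "integrable P (\<lambda>w. norm (b 0 0 w) ^ (k + m))"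
  defines "D \<equiv> real (\<Prod>i<k + m. N - i)"
  shows "integrable P (\<lambda>w. cyc_sum N k (entries w) * cyc_sum N m (entries w))"
    and "norm (expectation (\<lambda>w. cyc_sum N k (entries w) * cyc_sum N m (entries w)) - D * cycle_moment k m)
      \<le> (real N ^ (k + m) - D) * (real (k + m) * 2 ^ (k + m + 2) * diag_moment (k + m))"
proof -
  let ?E = "expectation (\<lambda>w. cyc_sum N k (entries w) * cyc_sum N m (entries w))"
  let ?r = "k + m"
  let ?F = "{..<?r} \<rightarrow>\<^sub>E {..<N}"
  let ?G = "{f \<in> ?F. inj_on f {..<?r}}"
  let ?X = "\<lambda>f. expectation (\<lambda>w. \<Prod>i<?r. b (f i) (f (cyc2 k m i)) w)"
  let ?C = "real ?r * 2 ^ (?r + 2) * diag_moment ?r"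
  have fin: "finite ?F" by (intro finite_PiE) auto
  have fr: "f i < N" "f (cyc2 k m i) < N" if "f \<in> ?F" "i \<in> {..<?r}" for f i
    using that cyc2_less[of i k m] by (auto simp: PiE_def Pi_def)
  have mono: "integrable P (\<lambda>w. \<Prod>i<?r. b (f i) (f (cyc2 k m i)) w)" "norm (?X f) \<le> ?C" if "f \<in> ?F" for f
    using monomial_moment[of "{..<?r}" f "\<lambda>i. f (cyc2 k m i)"] pos int fr[OF that] by auto
  have eq: "cyc_sum N k (entries w) * cyc_sum N m (entries w)
      = (\<Sum>f\<in>?F. \<Prod>i<?r. b (f i) (f (cyc2 k m i)) w)" for w by (rule cyc_sum_mult)
  show "integrable P (\<lambda>w. cyc_sum N k (entries w) * cyc_sum N m (entries w))"
    unfolding eq by (intro Bochner_Integration.integrable_sum mono)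
  have inj_eq: "?X f = cycle_moment k m" if f: "f \<in> ?G" for f
  proof -
    have "f ` {..<?r} \<subseteq> {..<N}" using f by (auto simp: PiE_def Pi_def)
    then obtain \<sigma> where \<sigma>: "bij_betw \<sigma> {..<N} {..<N}" and \<sigma>f: "\<And>i. i < ?r \<Longrightarrow> \<sigma> i = f i"
      using f inj_extends_to_perm[of f ?r N] by blast
    have "?X f = expectation (\<lambda>w. \<Prod>i<?r. b (\<sigma> i) (\<sigma> (cyc2 k m i)) w)"
      using cyc2_less by (intro Bochner_Integration.integral_cong prod.cong refl) (simp add: \<sigma>f)
    also have "... = cycle_moment k m"
      using kmN cyc2_less by (intro monomial_perm \<sigma>) (fastforce)+
    finally show ?thesis .
  qed
  have cardG: "real (card ?G) = D"
    using card_inj_on_subset_funcset[of "{..<?r}" "{..<N}" "{..<?r}"] by (simp add: D_def atLeast0LessThan)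
  have cardF: "real (card ?F) = real N ^ ?r" by (simp add: card_funcsetE)
  have "?E = (\<Sum>f\<in>?F. ?X f)"
    unfolding eq by (rule Bochner_Integration.integral_sum[OF mono(1)])
  also have "... = (\<Sum>f\<in>?F - ?G. ?X f) + (\<Sum>f\<in>?G. ?X f)"
    using fin by (intro sum.subset_diff) auto
  also have "(\<Sum>f\<in>?G. ?X f) = D * cycle_moment k m"
    using inj_eq by (simp add: cardG[symmetric])
  finally have diff: "?E - D * cycle_moment k m
      = (\<Sum>f\<in>?F - ?G. ?X f)" by simp
  have "norm (\<Sum>f\<in>?F - ?G. ?X f) \<le> (\<Sum>f\<in>?F - ?G. ?C)" by (intro sum_norm_le mono(2)) auto
  moreover have "(\<Sum>f\<in>?F - ?G. ?C) = real (card (?F - ?G)) * ?C" by (rule sum_constant)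
  moreover have "real (card (?F - ?G)) = real N ^ ?r - D"
  proof -
    have "card (?F - ?G) = card ?F - card ?G" using fin by (intro card_Diff_subset) (auto intro: finite_subset)
    moreover have "card ?G \<le> card ?F" using fin by (intro card_mono) auto
    ultimately show ?thesis by (simp only: of_nat_diff cardG cardF)
  qed
  ultimately have bound: "norm (\<Sum>f\<in>?F - ?G. ?X f) \<le> (real N ^ ?r - D) * ?C" by (simp only:)
  show "norm (?E - D * cycle_moment k m)
      \<le> (real N ^ (k + m) - D) * (real (k + m) * 2 ^ (k + m + 2) * diag_moment (k + m))"
    by (rule ord_eq_le_trans[OF arg_cong[OF diff, of norm] bound])
qed

lemma diagonal_real:
  assumes "i < N" "w \<in> space P"
  shows "b i i w = of_real (Re (b i i w))"
  using hermitian[OF assms(1) assms(1) assms(2)] by (simp add: complex_eq_iff)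

text \<open>Diagonal entries are real, so \<open>exp(S |b\<^sub>i\<^sub>i|) \<le> exp(S b\<^sub>i\<^sub>i) + exp(-S b\<^sub>i\<^sub>i)\<close>. Multiplying out the product over \<open>i\<close> leaves a
finite sum of exponentials at points of the polydisc, one for each choice of signs.\<close>
lemma integrable_exp_norm_diagonal:
  assumes rN: "r \<le> N" and S: "0 < S" "S < R"
    and int: "\<And>x. x \<in> polydisc r R \<Longrightarrow> integrable P (\<lambda>w. exp (\<Sum>i<r. x i * b i i w))"
  shows "integrable P (\<lambda>w. exp (S * (\<Sum>i<r. norm (b i i w))))"
proof -
  let ?X = "\<lambda>w. exp (S * (\<Sum>i<r. norm (b i i w)))"
  let ?E = "{..<r} \<rightarrow>\<^sub>E {1, -1::real}"
  define x where "x e i = (if i < r then complex_of_real (e i * S) else 0)" for e :: "nat \<Rightarrow> real" and i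
  let ?n = "\<lambda>e w. norm (exp (\<Sum>i<r. x e i * b i i w))"
  have x: "x e \<in> polydisc r R" if "e \<in> ?E" for e
  proof -
    have "\<bar>e i\<bar> = 1" if "i < r" for i using \<open>e \<in> ?E\<close> that by (force simp: PiE_def Pi_def)
    then show ?thesis using S by (auto simp: polydisc_def x_def norm_mult abs_mult)
  qed
  have sum_int: "integrable P (\<lambda>w. \<Sum>e\<in>?E. ?n e w)"
    by (intro Bochner_Integration.integrable_sum integrable_norm int x)
  have eq: "?X w \<le> (\<Sum>e\<in>?E. ?n e w)"
    if w: "w \<in> space P" for w
  proof -
    define y where "y i = S * Re (b i i w)" for i
    have bi: "b i i w = of_real (Re (b i i w))" if "i < r" for i
      using that rN w by (intro diagonal_real) auto
    have "?X w = (\<Prod>i<r. exp (S * norm (b i i w)))" by (simp add: sum_distrib_left exp_sum)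
    also have "... \<le> (\<Prod>i<r. \<Sum>e\<in>{1,-1}. exp (e * y i))"
    proof (intro prod_mono conjI)
      fix i assume "i \<in> {..<r}"
      then have "norm (b i i w) = \<bar>Re (b i i w)\<bar>" using bi[of i] by (metis lessThan_iff norm_of_real)
      then have "S * norm (b i i w) = \<bar>y i\<bar>" using S by (simp add: y_def abs_mult)
      moreover have "exp \<bar>y i\<bar> \<le> exp (y i) + exp (- y i)" by (simp add: abs_if)
      ultimately show "exp (S * norm (b i i w)) \<le> (\<Sum>e\<in>{1,-1}. exp (e * y i))" by simp
    qed auto
    also have "... = (\<Sum>e\<in>?E. \<Prod>i<r. exp (e i * y i))" by (rule prod_sum_PiE) auto
    also have "... = (\<Sum>e\<in>?E. ?n e w)"
    proof (rule sum.cong[OF refl])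
      fix e assume "e \<in> ?E"
      have "Re (\<Sum>i<r. x e i * b i i w) = (\<Sum>i<r. e i * y i)"
        unfolding Re_sum by (rule sum.cong) (auto simp: x_def y_def)
      then show "(\<Prod>i<r. exp (e i * y i)) = ?n e w"
        by (simp only: norm_exp_eq_Re exp_sum[OF finite_lessThan, symmetric])
    qed
    finally show ?thesis .
  qed
  show ?thesis
  proof (rule Bochner_Integration.integrable_bound[OF sum_int])
    have "(\<lambda>w. \<Sum>i<r. norm (b i i w)) \<in> borel_measurable P"
      using rN by (intro borel_measurable_sum measurable_compose[OF _ borel_measurable_norm] entry_measurable) auto
    then show "(\<lambda>w. ?X w) \<in> borel_measurable P" by measurable
    show "AE w in P. norm (?X w) \<le> norm (\<Sum>e\<in>?E. ?n e w)"
      using eq by (intro AE_I2) (simp add: sum_nonneg)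
  qed
qed

end

section \<open>Limits of moments\<close>

text \<open>Linear statistics of two disjoint groups of diagonal entries become independent in the limit: their joint transform at
\<open>(s, t)\<close> is the transform of the entries at the point with coordinates \<open>s u\<^sub>j\<close> and \<open>t u\<^sub>j\<close>, and the limit of the latter
is a product. The bound on \<open>u\<close> keeps this point in the polydisc.\<close>
lemma diagonal_power_limit:
  fixes P :: "nat \<Rightarrow> 'a measure" and b :: "nat \<Rightarrow> nat \<Rightarrow> nat \<Rightarrow> 'a \<Rightarrow> complex"
  assumes ens: "\<And>N. N \<ge> 1 \<Longrightarrow> invariant_hermitian_entries (P N) N (b N)"
    and V: "open V" "0 \<in> V" and \<Psi>: "\<Psi> holomorphic_on V" and R: "R > 0"
    and int: "\<forall>\<^sub>F N in sequentially. \<forall>x\<in>polydisc (k + m) R. integrable (P N) (\<lambda>w. exp (\<Sum>i<k + m. x i * b N i i w))"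
    and lim: "uniform_limit (polydisc (k + m) R) (\<lambda>N x. \<integral>w. exp (\<Sum>i<k + m. x i * b N i i w) \<partial>P N)
      (\<lambda>x. exp (\<Sum>i<k + m. \<Psi> (x i))) sequentially"
    and u: "\<And>j. norm (u j) \<le> 1"
  shows "(\<lambda>N. \<integral>w. (\<Sum>j<k. u j * b N j j w) ^ p * (\<Sum>j<m. u (k + j) * b N (k + j) (k + j) w) ^ q \<partial>P N)
    \<longlonglongrightarrow> (deriv ^^ p) (\<lambda>s. exp (\<Sum>j<k. \<Psi> (s * u j))) 0 * (deriv ^^ q) (\<lambda>t. exp (\<Sum>j<m. \<Psi> (t * u (k + j)))) 0"
    (is "?L \<longlonglongrightarrow> ?c")
proof -
  let ?s = "\<lambda>N w. \<Sum>i<k + m. norm (b N i i w)"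
  obtain R0 where R0: "R0 > 0" "ball 0 R0 \<subseteq> V" using V openE by blast
  define S where "S = min R R0 / 2"
  have S: "S > 0" "S < R" "S < R0" using R R0 by (auto simp: S_def min_def)
  define T where "T = S / 2"
  have T: "0 < T" "T < S" using S by (auto simp: T_def)
  define x where "x s t i = (if i < k then s * u i else if i < k + m then t * u i else 0)" for s t :: complex and i
  have small: "norm (s * u j) < S" if "norm s < S" for s j
  proof -
    have "norm (s * u j) \<le> norm s * 1" unfolding norm_mult using u by (intro mult_left_mono) auto
    then show ?thesis using that by simp
  qed
  have x: "x s t \<in> polydisc (k + m) R" if "norm s < S" "norm t < S" for s t
  proof -
    have "norm (s * u j) < R" "norm (t * u j) < R" for j
      using small[OF that(1), of j] small[OF that(2), of j] S by auto
    then show ?thesis using R by (simp add: polydisc_def x_def)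
  qed
  have split: "(\<Sum>i<k + m. f i) = (\<Sum>i<k. f i) + (\<Sum>j<m. f (k + j))" for f :: "nat \<Rightarrow> 'z::comm_monoid_add"
    using sum_block_split[of 0 k "k + m" f] sum.reindex_bij_witness[of "{..<k+m} - {0..<0+k}" "\<lambda>j. k + j" "\<lambda>j. j - k" "{..<m}" "\<lambda>j. f (k + j)" f]
    by fastforce
  define g h where "g s = exp (\<Sum>j<k. \<Psi> (s * u j))" and "h t = exp (\<Sum>j<m. \<Psi> (t * u (k + j)))" for s t
  have \<Psi>S: "(\<lambda>s. \<Psi> (s * u j)) holomorphic_on ball 0 S" for j
  proof -
    have "(\<lambda>s. s * u j) ` ball 0 S \<subseteq> V"
    proof (rule image_subsetI)
      fix s :: complex assume "s \<in> ball 0 S"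
      then have "s * u j \<in> ball 0 R0" using small[of s j] S by simp
      then show "s * u j \<in> V" using R0(2) by blast
    qed
    then show ?thesis by (intro holomorphic_on_compose_gen[OF _ \<Psi>, unfolded o_def] holomorphic_intros) auto
  qed
  have gh: "g holomorphic_on ball 0 S" "h holomorphic_on ball 0 S"
    unfolding g_def h_def by (intro holomorphic_intros \<Psi>S)+
  define C where "C = fact p * fact q / T ^ (p + q)"
  have C: "C > 0" using T by (simp add: C_def)
  have "\<forall>\<^sub>F N in sequentially. norm (?L N - ?c) < e" if e: "e > 0" for e
  proof -
    define d where "d = e / (2 * C)"
    have d: "d > 0" "C * d < e" using e C by (auto simp: d_def field_simps)
    from uniform_limitD[OF lim d(1)] int eventually_ge_at_top[of "k + m + 1"]
    show ?thesis
    proof eventually_elim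
      case (elim N)
      interpret invariant_hermitian_entries "P N" N "b N" using elim by (intro ens) auto
      define Z1 Z2 where "Z1 w = (\<Sum>j<k. u j * b N j j w)"
        and "Z2 w = (\<Sum>j<m. u (k + j) * b N (k + j) (k + j) w)" for w
      have meas: "Z1 \<in> borel_measurable (P N)" "Z2 \<in> borel_measurable (P N)"
        unfolding Z1_def Z2_def using elim
        by (auto intro!: borel_measurable_sum borel_measurable_times entry_measurable)
      have le: "norm (Z1 w) + norm (Z2 w) \<le> (?s N w)" for w
      proof -
        have "norm (u j * z) \<le> norm z" for j and z :: complex
          unfolding norm_mult using u by (intro mult_left_le_one_le) auto
        then have "norm (Z1 w) \<le> (\<Sum>j<k. norm (b N j j w))" "norm (Z2 w) \<le> (\<Sum>j<m. norm (b N (k + j) (k + j) w))"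
          unfolding Z1_def Z2_def by (auto intro!: sum_norm_le)
        then show ?thesis by (simp add: split)
      qed
      have bound: "integrable (P N) (\<lambda>w. exp (S * (?s N w)))"
        using elim S by (intro integrable_exp_norm_diagonal[where R = R]) auto
      have i: "integrable (P N) (\<lambda>w. exp (S * norm (Z1 w) + S * norm (Z2 w)))"
      proof (rule Bochner_Integration.integrable_bound[OF bound])
        show "(\<lambda>w. exp (S * norm (Z1 w) + S * norm (Z2 w))) \<in> borel_measurable (P N)"
          using meas by measurable
        have "S * norm (Z1 w) + S * norm (Z2 w) \<le> S * (?s N w)" for w
          using mult_left_mono[OF le[of w], of S] S by (simp add: distrib_left)
        then show "AE w in P N. norm (exp (S * norm (Z1 w) + S * norm (Z2 w))) \<le> norm (exp (S * (?s N w)))"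
          by (intro AE_I2) simp
      qed
      have "norm ((\<integral>w. Z1 w ^ p * Z2 w ^ q \<partial>P N) - (deriv ^^ p) g 0 * (deriv ^^ q) h 0) \<le> fact p * fact q * d / T ^ (p + q)"
      proof (rule joint_moment_error[OF meas i gh _ T])
        fix s t :: complex assume st: "norm s < S" "norm t < S"
        have "exp (s * Z1 w + t * Z2 w) = exp (\<Sum>i<k + m. x s t i * b N i i w)" for w
          unfolding split Z1_def Z2_def sum_distrib_left by (simp add: x_def mult.assoc)
        moreover have "exp (\<Sum>i<k + m. \<Psi> (x s t i)) = g s * h t"
          unfolding split by (simp add: x_def g_def h_def exp_add)
        ultimately show "norm ((\<integral>w. exp (s * Z1 w + t * Z2 w) \<partial>P N) - g s * h t) \<le> d"
          using elim(1) x[OF st] by (auto simp: dist_norm intro: less_imp_le)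
      qed
      also have "fact p * fact q * d / T ^ (p + q) = C * d" by (simp add: C_def)
      also have "C * d < e" by (rule d)
      finally show ?case by (simp add: Z1_def Z2_def g_def[abs_def] h_def[abs_def])
    qed
  qed
  then show ?thesis by (intro tendstoI) (simp add: dist_norm)
qed

lemma falling_factorial_ratio:
  "(\<lambda>N. real (\<Prod>i<r. N - i) / real N ^ r) \<longlonglongrightarrow> 1"
proof -
  have "(\<lambda>N. \<Prod>i<r. (real N - real i) / real N) \<longlonglongrightarrow> (\<Prod>i<r. 1)"
  proof (rule tendsto_prod)
    fix i
    show "(\<lambda>N. (real N - real i) / real N) \<longlonglongrightarrow> 1" by real_asymp
  qed
  moreover have "\<forall>\<^sub>F N in sequentially. (\<Prod>i<r. (real N - real i) / real N) = real (\<Prod>i<r. N - i) / real N ^ r"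
    using eventually_ge_at_top[of r]
  proof eventually_elim
    case (elim N)
    then have "(\<Prod>i<r. real N - real i) = real (\<Prod>i<r. N - i)"
      unfolding of_nat_prod by (intro prod.cong) (auto simp: of_nat_diff)
    then show ?case by (simp add: prod_dividef)
  qed
  ultimately show ?thesis by (simp add: Lim_transform_eventually)
qed

text \<open>The value 1 at \<open>k = 0\<close> matches the convention for closed walks of length 0.\<close>
definition limit_moment :: "(complex \<Rightarrow> complex) \<Rightarrow> nat \<Rightarrow> complex" where
  "limit_moment \<Psi> k = (if k = 0 then 1 else (deriv ^^ k) \<Psi> 0 / fact (k - 1))"

lemma root_exponential_deriv:
  assumes V: "open V" "0 \<in> V" and \<Psi>: "\<Psi> holomorphic_on V" and \<Psi>0: "\<Psi> 0 = 0"
  shows "(deriv ^^ k) (\<lambda>s. exp (\<Sum>j<k. \<Psi> (s * cnj (zeta k) ^ j))) 0 = fact k * limit_moment \<Psi> k"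
proof (cases "k = 0")
  case False
  then have k: "k > 0" by simp
  obtain R where R: "R > 0" "ball 0 R \<subseteq> V" using V openE by blast
  have hol: "\<Psi> holomorphic_on ball 0 R" using \<Psi> R(2) holomorphic_on_subset by blast
  let ?h = "\<lambda>s. \<Sum>j<k. \<Psi> (s * cnj (zeta k) ^ j)"
  have hh: "?h holomorphic_on ball 0 R"
  proof (intro holomorphic_intros)
    fix j
    show "(\<lambda>s. \<Psi> (s * cnj (zeta k) ^ j)) holomorphic_on ball 0 R"
      by (intro holomorphic_on_compose_gen[OF _ hol, unfolded o_def] holomorphic_intros)
        (auto simp: norm_mult norm_power)
  qed
  have "(deriv ^^ k) (\<lambda>s. exp (?h s)) 0 = (deriv ^^ k) ?h 0 * exp (?h 0)"
  proof (rule higher_deriv_exp_first_order[OF hh _ _ _ k])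
    fix n assume "0 < n" "n < k"
    then have "\<not> k dvd n" by (auto dest: dvd_imp_le)
    then show "(deriv ^^ n) ?h 0 = 0" using higher_deriv_root_sum[OF hol R(1) k, of n] by simp
  qed (use R in auto)
  also have "(deriv ^^ k) ?h 0 = of_nat k * (deriv ^^ k) \<Psi> 0"
    using higher_deriv_root_sum[OF hol R(1) k, of k] by simp
  also have "exp (?h 0) = 1" by (simp add: \<Psi>0)
  finally show ?thesis
    using k by (simp add: limit_moment_def fact_reduce[of k])
qed (simp add: limit_moment_def)

text \<open>The pair \<open>(k, 0)\<close> gives the mean of the \<open>k\<close>-th power sum and \<open>(k, k)\<close> its second moment.\<close>
lemma cyc_sum_limit:
  fixes P :: "nat \<Rightarrow> 'a measure" and b :: "nat \<Rightarrow> nat \<Rightarrow> nat \<Rightarrow> 'a \<Rightarrow> complex"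
  assumes ens: "\<And>N. N \<ge> 1 \<Longrightarrow> invariant_hermitian_entries (P N) N (b N)"
    and V: "open V" "0 \<in> V" and \<Psi>: "\<Psi> holomorphic_on V" and \<Psi>0: "\<Psi> 0 = 0"
    and mgf: "\<And>r. r \<ge> 1 \<Longrightarrow> \<exists>R>0.
       (\<forall>\<^sub>F N in sequentially. \<forall>x\<in>polydisc r R. integrable (P N) (\<lambda>w. exp (\<Sum>i<r. x i * b N i i w))) \<and>
       uniform_limit (polydisc r R) (\<lambda>N x. \<integral>w. exp (\<Sum>i<r. x i * b N i i w) \<partial>P N)
         (\<lambda>x. exp (\<Sum>i<r. \<Psi> (x i))) sequentially"
    and pos: "k + m \<ge> 1"
  defines "T \<equiv> (\<lambda>N k w. cyc_sum N k (\<lambda>i j. b N i j w))"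
  shows "\<forall>\<^sub>F N in sequentially. integrable (P N) (\<lambda>w. T N k w * T N m w)"
    and "(\<lambda>N. (\<integral>w. T N k w * T N m w \<partial>P N) / of_nat N ^ (k + m)) \<longlonglongrightarrow> limit_moment \<Psi> k * limit_moment \<Psi> m"
proof -
  let ?Z = "\<lambda>u N w. (\<Sum>j<k. u j * b N j j w) ^ k * (\<Sum>j<m. u (k + j) * b N (k + j) (k + j) w) ^ m"
  define r where "r = k + m"
  have r: "r \<ge> 1" using pos by (simp add: r_def)
  obtain R1 where R1: "R1 > 0"
    and int1: "\<forall>\<^sub>F N in sequentially. \<forall>x\<in>polydisc (1 + 0) R1. integrable (P N) (\<lambda>w. exp (\<Sum>i<1 + 0. x i * b N i i w))"
    and lim1: "uniform_limit (polydisc (1 + 0) R1) (\<lambda>N x. \<integral>w. exp (\<Sum>i<1 + 0. x i * b N i i w) \<partial>P N)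
         (\<lambda>x. exp (\<Sum>i<1 + 0. \<Psi> (x i))) sequentially"
    using mgf[of 1] by auto
  obtain R where R: "R > 0"
    and int: "\<forall>\<^sub>F N in sequentially. \<forall>x\<in>polydisc (k + m) R. integrable (P N) (\<lambda>w. exp (\<Sum>i<k + m. x i * b N i i w))"
    and lim: "uniform_limit (polydisc (k + m) R) (\<lambda>N x. \<integral>w. exp (\<Sum>i<k + m. x i * b N i i w) \<partial>P N)
         (\<lambda>x. exp (\<Sum>i<k + m. \<Psi> (x i))) sequentially"
    using mgf[OF pos] by auto
  \<comment> \<open>The error bound for walks needs absolute moments of \<open>b\<^sub>0\<^sub>0\<close> that are bounded in \<open>N\<close>. The even ones
    converge, as \<open>b\<^sub>0\<^sub>0\<close> is real, and \<open>|x|\<^sup>r \<le> 1 + |x|\<^sup>2\<^sup>r\<close>.\<close>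
  have corner_int: "\<forall>\<^sub>F N in sequentially. \<forall>n. integrable (P N) (\<lambda>w. norm (b N 0 0 w) ^ n)"
    using int1 eventually_ge_at_top[of 1]
  proof eventually_elim
    case (elim N)
    interpret invariant_hermitian_entries "P N" N "b N" using elim by (intro ens) auto
    have [measurable]: "b N 0 0 \<in> borel_measurable (P N)" using elim by (intro entry_measurable) auto
    have "integrable (P N) (\<lambda>w. exp (R1 / 2 * (\<Sum>i<1. norm (b N i i w))))"
      using elim R1 by (intro integrable_exp_norm_diagonal[where R = R1]) auto
    then have "integrable (P N) (\<lambda>w. norm (1::complex) * exp (R1 / 2 * norm (b N 0 0 w)))" by simp
    then have "integrable (P N) (\<lambda>w. 1 * b N 0 0 w ^ n)" for n
      using R1 by (intro weighted_mgf(1)[where R = "R1 / 2" and W = "\<lambda>_. 1"]) auto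
    then show ?case using integrable_norm by (fastforce simp: norm_power)
  qed
  have corner: "(\<lambda>N. \<integral>w. b N 0 0 w ^ (2 * r) \<partial>P N) \<longlonglongrightarrow> (deriv ^^ (2 * r)) (\<lambda>s. exp (\<Psi> s)) 0"
    using diagonal_power_limit[OF ens V \<Psi> R1 int1 lim1, where u = "\<lambda>_. 1" and p = "2 * r" and q = 0] by simp
  then have "Bseq (\<lambda>N. \<integral>w. b N 0 0 w ^ (2 * r) \<partial>P N)" by (intro convergent_imp_Bseq convergentI)
  then obtain B where B: "\<And>N. norm (\<integral>w. b N 0 0 w ^ (2 * r) \<partial>P N) \<le> B" by (auto simp: Bseq_def)
  have corner_bound: "\<forall>\<^sub>F N in sequentially. (\<integral>w. norm (b N 0 0 w) ^ r \<partial>P N) \<le> 1 + B"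
    using corner_int eventually_ge_at_top[of 1]
  proof eventually_elim
    case (elim N)
    interpret invariant_hermitian_entries "P N" N "b N" using elim by (intro ens) auto
    have real: "b N 0 0 w ^ (2 * r) = of_real (norm (b N 0 0 w) ^ (2 * r))" if "w \<in> space (P N)" for w
    proof -
      have "b N 0 0 w = of_real (Re (b N 0 0 w))" using elim that by (intro diagonal_real) auto
      then obtain y :: real where "b N 0 0 w = of_real y" by blast
      then show ?thesis by (simp add: power_mult)
    qed
    have "(\<integral>w. norm (b N 0 0 w) ^ r \<partial>P N) \<le> (\<integral>w. 1 + norm (b N 0 0 w) ^ (2 * r) \<partial>P N)"
    proof (intro integral_mono)
      show "norm (b N 0 0 w) ^ r \<le> 1 + norm (b N 0 0 w) ^ (2 * r)" for w
      proof (cases "norm (b N 0 0 w) \<le> 1")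
        case True
        then have "norm (b N 0 0 w) ^ r \<le> 1" by (intro power_le_one) auto
        then show ?thesis by (simp add: add_increasing2)
      next
        case False
        then have "norm (b N 0 0 w) ^ r \<le> norm (b N 0 0 w) ^ (2 * r)" by (intro power_increasing) auto
        then show ?thesis by simp
      qed
    qed (use elim in auto)
    also have "... = 1 + (\<integral>w. norm (b N 0 0 w) ^ (2 * r) \<partial>P N)"
      using elim by (subst Bochner_Integration.integral_add) (auto simp: prob_space)
    also have "(\<integral>w. norm (b N 0 0 w) ^ (2 * r) \<partial>P N) = Re (\<integral>w. b N 0 0 w ^ (2 * r) \<partial>P N)"
    proof -
      have "(\<integral>w. b N 0 0 w ^ (2 * r) \<partial>P N) = (\<integral>w. complex_of_real (norm (b N 0 0 w) ^ (2 * r)) \<partial>P N)"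
        by (rule Bochner_Integration.integral_cong[OF refl]) (rule real)
      then show ?thesis by (simp only: integral_complex_of_real Re_complex_of_real)
    qed
    also have "... \<le> B" using B[of N] complex_Re_le_cmod order_trans by blast
    finally show ?case by simp
  qed
  \<comment> \<open>the weights for which the diagonal statistics compute the cycle moment \<open>e N\<close>\<close>
  define e where "e N = (\<integral>w. (\<Prod>i<k + m. b N i (cyc2 k m i) w) \<partial>P N)" for N
  define u where "u j = (if j < k then cnj (zeta k) ^ j else cnj (zeta m) ^ (j - k))" for j
  have "(\<lambda>N. \<integral>w. ?Z u N w \<partial>P N)
    \<longlonglongrightarrow> (deriv ^^ k) (\<lambda>s. exp (\<Sum>j<k. \<Psi> (s * u j))) 0 * (deriv ^^ m) (\<lambda>t. exp (\<Sum>j<m. \<Psi> (t * u (k + j)))) 0"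
    by (rule diagonal_power_limit[OF ens V \<Psi> R int lim]) (auto simp: u_def norm_power)
  also have "(\<lambda>s. exp (\<Sum>j<k. \<Psi> (s * u j))) = (\<lambda>s. exp (\<Sum>j<k. \<Psi> (s * cnj (zeta k) ^ j)))"
    by (simp add: u_def)
  also have "(\<lambda>t. exp (\<Sum>j<m. \<Psi> (t * u (k + j)))) = (\<lambda>s. exp (\<Sum>j<m. \<Psi> (s * cnj (zeta m) ^ j)))"
    by (simp add: u_def)
  finally have "(\<lambda>N. \<integral>w. ?Z u N w \<partial>P N)
    \<longlonglongrightarrow> (fact k * limit_moment \<Psi> k) * (fact m * limit_moment \<Psi> m)"
    by (simp only: root_exponential_deriv[OF V \<Psi> \<Psi>0])
  moreover have "\<forall>\<^sub>F N in sequentially.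
      (\<integral>w. ?Z u N w \<partial>P N) = fact k * fact m * e N"
    using corner_int eventually_ge_at_top[of r]
  proof eventually_elim
    case (elim N)
    interpret invariant_hermitian_entries "P N" N "b N" using elim r by (intro ens) auto
    have "0 < k + m" using pos by linarith
    then show ?case
      using diagonal_root_moment[of k m] block_power_moment[of k m] elim by (simp add: u_def e_def r_def)
  qed
  ultimately have "(\<lambda>N. fact k * fact m * e N) \<longlonglongrightarrow> (fact k * limit_moment \<Psi> k) * (fact m * limit_moment \<Psi> m)"
    by (rule Lim_transform_eventually)
  from tendsto_divide[OF this tendsto_const[of "fact k * fact m"]]
  have e_lim: "e \<longlonglongrightarrow> limit_moment \<Psi> k * limit_moment \<Psi> m" by simp
  have kN: "\<forall>\<^sub>F N in sequentially. r \<le> N" by (rule eventually_ge_at_top)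
  show "\<forall>\<^sub>F N in sequentially. integrable (P N) (\<lambda>w. T N k w * T N m w)"
    using corner_int kN
  proof eventually_elim
    case (elim N)
    interpret invariant_hermitian_entries "P N" N "b N" using elim r by (intro ens) auto
    show ?case unfolding T_def using elim r by (intro cyc_sum_moment(1)) (use pos in \<open>auto simp: r_def\<close>)
  qed
  define D where "D N = real (\<Prod>i<r. N - i)" for N
  define E where "E N = (\<integral>w. T N k w * T N m w \<partial>P N)" for N
  define C where "C = real r * 2 ^ (r + 2) * (1 + B)"
  have D_lim: "(\<lambda>N. D N / real N ^ r) \<longlonglongrightarrow> 1"
    unfolding D_def by (rule falling_factorial_ratio)
  have "\<forall>\<^sub>F N in sequentially. norm (E N / of_nat N ^ r - of_real (D N / real N ^ r) * e N) \<le> (1 - D N / real N ^ r) * C"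
    using corner_int corner_bound kN
  proof eventually_elim
    case (elim N)
    interpret invariant_hermitian_entries "P N" N "b N" using elim r by (intro ens) auto
    have N: "real N ^ r > 0" using elim r by simp
    have DN: "D N \<le> real N ^ r"
    proof -
      have "(\<Prod>i<r. N - i) \<le> (\<Prod>i<r. N)" by (rule prod_mono) auto
      then show ?thesis unfolding D_def by (metis card_lessThan of_nat_le_iff of_nat_power prod_constant)
    qed
    have "norm (E N - D N * e N) \<le> (real N ^ r - D N) * (real r * 2 ^ (r + 2) * diag_moment r)"
      unfolding E_def T_def e_def D_def r_def using elim r by (intro cyc_sum_moment(2)) (use pos in \<open>auto simp: r_def\<close>)
    also have "... \<le> (real N ^ r - D N) * C"
      unfolding C_def using DN elim by (intro mult_left_mono) auto
    finally have "norm (E N - D N * e N) / real N ^ r \<le> (real N ^ r - D N) * C / real N ^ r"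
      using N by (intro divide_right_mono) auto
    moreover have "norm (E N - D N * e N) / real N ^ r = norm (E N / of_nat N ^ r - of_real (D N / real N ^ r) * e N)"
    proof -
      have "E N / of_nat N ^ r - of_real (D N / real N ^ r) * e N = (E N - D N * e N) / of_nat N ^ r"
        by (simp add: diff_divide_distrib)
      then show ?thesis by (simp add: norm_divide norm_power)
    qed
    moreover have "(real N ^ r - D N) * C / real N ^ r = (1 - D N / real N ^ r) * C"
      using N by (simp add: field_simps)
    ultimately show ?case by simp
  qed
  moreover have "(\<lambda>N. (1 - D N / real N ^ r) * C) \<longlonglongrightarrow> 0"
    using tendsto_mult[OF tendsto_diff[OF tendsto_const[of 1] D_lim] tendsto_const[of C]] by simp
  ultimately have "(\<lambda>N. E N / of_nat N ^ r - of_real (D N / real N ^ r) * e N) \<longlonglongrightarrow> 0"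
    by (rule Lim_null_comparison)
  moreover have "(\<lambda>N. of_real (D N / real N ^ r) * e N) \<longlonglongrightarrow> of_real 1 * (limit_moment \<Psi> k * limit_moment \<Psi> m)"
    by (intro tendsto_mult tendsto_of_real D_lim e_lim)
  ultimately have "(\<lambda>N. (E N / of_nat N ^ r - of_real (D N / real N ^ r) * e N) + of_real (D N / real N ^ r) * e N)
      \<longlonglongrightarrow> 0 + of_real 1 * (limit_moment \<Psi> k * limit_moment \<Psi> m)" by (rule tendsto_add)
  then show "(\<lambda>N. (\<integral>w. T N k w * T N m w \<partial>P N) / of_nat N ^ (k + m)) \<longlonglongrightarrow> limit_moment \<Psi> k * limit_moment \<Psi> m"
    by (simp add: E_def r_def)
qed

section \<open>The spectral theorem for Hermitian matrices\<close>

lemma mat_adjoint_dim [simp]: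
  "dim_row (mat_adjoint A) = dim_col A" "dim_col (mat_adjoint A) = dim_row A"
  by (simp_all add: mat_adjoint_def)

lemma mat_adjoint_carrier [simp]: "A \<in> carrier_mat n m \<Longrightarrow> mat_adjoint A \<in> carrier_mat m n"
  by (metis carrier_matD carrier_matI mat_adjoint_dim)

lemma mat_adjoint_index [simp]:
  fixes A :: "complex mat"
  assumes "i < dim_col A" "j < dim_row A"
  shows "mat_adjoint A $$ (i, j) = cnj (A $$ (j, i))"
  using assms by (simp add: mat_adjoint_def mat_of_rows_def)

lemma mat_mult_index:
  assumes "A \<in> carrier_mat n m" "B \<in> carrier_mat m l" "i < n" "j < l"
  shows "(A * B) $$ (i, j) = (\<Sum>a<m. A $$ (i, a) * B $$ (a, j))"
  using assms by (auto simp: scalar_prod_def atLeast0LessThan intro!: sum.cong)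

lemma mat_adjoint_adjoint [simp]: "mat_adjoint (mat_adjoint A) = (A :: complex mat)" by (rule eq_matI) auto

lemma mat_adjoint_mult:
  fixes A B :: "complex mat"
  assumes "A \<in> carrier_mat n m" "B \<in> carrier_mat m l"
  shows "mat_adjoint (A * B) = mat_adjoint B * mat_adjoint A"
proof (rule eq_matI)
  fix i j assume "i < dim_row (mat_adjoint B * mat_adjoint A)" "j < dim_col (mat_adjoint B * mat_adjoint A)"
  then have ij: "i < l" "j < n" using assms by auto
  have "mat_adjoint (A * B) $$ (i, j) = cnj ((A * B) $$ (j, i))" using assms ij by simp
  also have "... = (\<Sum>a<m. mat_adjoint B $$ (i, a) * mat_adjoint A $$ (a, j))"
    using assms ij by (simp add: mat_mult_index[OF assms] del: index_mult_mat)
      (auto intro!: sum.cong simp: mult.commute)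
  also have "... = (mat_adjoint B * mat_adjoint A) $$ (i, j)"
    using assms ij by (subst mat_mult_index[of _ l m _ n]) auto
  finally show "mat_adjoint (A * B) $$ (i, j) = (mat_adjoint B * mat_adjoint A) $$ (i, j)" .
qed (use assms in auto)

lemma unitary_matsI:
  assumes "U \<in> carrier_mat n n" "mat_adjoint U * U = 1\<^sub>m n"
  shows "U \<in> unitary_mats n"
  using assms mat_mult_left_right_inverse[of "mat_adjoint U" n U] by (simp add: unitary_mats_def)

lemma unitary_matsD:
  assumes "U \<in> unitary_mats n"
  shows "U \<in> carrier_mat n n" "mat_adjoint U * U = 1\<^sub>m n" "U * mat_adjoint U = 1\<^sub>m n"
    "mat_adjoint U \<in> carrier_mat n n"
  using assms by (auto simp: unitary_mats_def)

lemma adjoint_unitary: "U \<in> unitary_mats n \<Longrightarrow> mat_adjoint U \<in> unitary_mats n"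
  by (auto simp: unitary_mats_def)

lemma unitary_cancel:
  assumes "U \<in> unitary_mats n" "B \<in> carrier_mat n k"
  shows "mat_adjoint U * (U * B) = B" "U * (mat_adjoint U * B) = B"
  using assoc_mult_mat[of "mat_adjoint U" n n U n B k] assoc_mult_mat[of U n n "mat_adjoint U" n B k]
    unitary_matsD[OF assms(1)] assms(2) by simp_all

lemma unitary_mats_mult:
  assumes "U \<in> unitary_mats n" "W \<in> unitary_mats n"
  shows "U * W \<in> unitary_mats n"
proof (rule unitary_matsI)
  note U = unitary_matsD[OF assms(1)] and W = unitary_matsD[OF assms(2)]
  show "U * W \<in> carrier_mat n n" using U W by auto
  have "mat_adjoint (U * W) * (U * W) = (mat_adjoint W * mat_adjoint U) * (U * W)"
    using mat_adjoint_mult[OF U(1) W(1)] by simp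
  also have "... = mat_adjoint W * (mat_adjoint U * (U * W))"
    using U W by (intro assoc_mult_mat[of _ n n _ n _ n]) auto
  also have "... = mat_adjoint W * W"
    using unitary_cancel(1)[OF assms(1) W(1)] by simp
  finally show "mat_adjoint (U * W) * (U * W) = 1\<^sub>m n" using U W by simp
qed

lemma unitary_columns:
  assumes U: "U \<in> unitary_mats n" and ij: "i < n" "j < n"
  shows "(\<Sum>a<n. cnj (U $$ (a, i)) * U $$ (a, j)) = (if i = j then 1 else 0)"
proof -
  note U' = unitary_matsD[OF U]
  have "(mat_adjoint U * U) $$ (i, j) = (\<Sum>a<n. cnj (U $$ (a, i)) * U $$ (a, j))"
    using U' ij by (subst mat_mult_index[of _ n n _ n]) auto
  then show ?thesis using U'(2) ij by simp
qed

lemma unitary_rows: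
  assumes U: "U \<in> unitary_mats n" and ij: "i < n" "j < n"
  shows "(\<Sum>a<n. U $$ (i, a) * cnj (U $$ (j, a))) = (if i = j then 1 else 0)"
proof -
  note U' = unitary_matsD[OF U]
  have "(U * mat_adjoint U) $$ (i, j) = (\<Sum>a<n. U $$ (i, a) * cnj (U $$ (j, a)))"
    using U' ij by (subst mat_mult_index[of _ n n _ n]) auto
  then show ?thesis using U'(3) ij by simp
qed

text \<open>The Gram-Schmidt process turns a basis that starts with \<open>v\<close> into orthogonal vectors that start with \<open>v\<close>; they only have
to be normalised.\<close>
lemma unitary_with_first_column:
  fixes v :: "complex vec"
  assumes v: "v \<in> carrier_vec n" "v \<noteq> 0\<^sub>v n" and n: "n > 0"
  obtains U c where "U \<in> unitary_mats n" "\<And>a. a < n \<Longrightarrow> U $$ (a, 0) = c * v $ a"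
proof -
  interpret cof_vec_space n "TYPE(complex)" .
  define bs where "bs = basis_completion v"
  note bc = basis_completion[OF v, folded bs_def]
  then obtain vs where bv: "bs = v # vs" using n by (cases bs) auto
  define ws where "ws = gram_schmidt n bs"
  have ws: "set ws \<subseteq> carrier_vec n" "corthogonal ws" "length ws = n"
    using gram_schmidt_result[OF bc(2,4,5) refl, folded ws_def] bc(6) by auto
  have hd: "ws ! 0 = v"
    using gram_schmidt_hd[OF v(1), of vs, folded bv, folded ws_def] ws(3) n by (cases ws) auto
  have wc: "ws ! i \<in> carrier_vec n" if "i < n" for i using ws that by auto
  have ip: "ws ! i \<bullet>c ws ! j = (\<Sum>a<n. ws ! i $ a * cnj (ws ! j $ a))" if "i < n" "j < n" for i j
    using wc[OF that(1)] wc[OF that(2)] by (auto simp: scalar_prod_def atLeast0LessThan intro!: sum.cong)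
  define s where "s i = (\<Sum>a<n. (norm (ws ! i $ a))\<^sup>2)" for i
  let ?q = "\<lambda>i. complex_of_real (sqrt (s i))"
  have ss: "ws ! i \<bullet>c ws ! i = of_real (s i)" if "i < n" for i
    unfolding ip[OF that that] s_def by (simp add: complex_norm_square del: of_real_power)
  have spos: "s i > 0" if "i < n" for i
  proof -
    have "s i \<noteq> 0" using ss[OF that] corthogonalD[OF ws(2), of i i] ws(3) that by auto
    moreover have "s i \<ge> 0" by (simp add: s_def sum_nonneg)
    ultimately show ?thesis by simp
  qed
  define U where "U = Matrix.mat n n (\<lambda>(a, i). ws ! i $ a / ?q i)"
  have U: "U \<in> carrier_mat n n" by (simp add: U_def)
  have "mat_adjoint U * U = 1\<^sub>m n"
  proof (rule eq_matI)
    fix i j assume "i < dim_row (1\<^sub>m n :: complex mat)" "j < dim_col (1\<^sub>m n :: complex mat)"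
    then have ij: "i < n" "j < n" by auto
    have "(mat_adjoint U * U) $$ (i, j) = (\<Sum>a<n. cnj (ws ! i $ a) * ws ! j $ a / (?q i * ?q j))"
      using U ij by (subst mat_mult_index[of _ n n _ n]) (auto simp: U_def intro!: sum.cong)
    also have "... = (ws ! j \<bullet>c ws ! i) / (?q i * ?q j)"
      by (simp add: ip ij sum_divide_distrib mult.commute)
    also have "... = (1\<^sub>m n :: complex mat) $$ (i, j)"
    proof (cases "i = j")
      case True
      have "?q i * ?q i = of_real (s i)"
        using spos[OF ij(1)] by (simp flip: of_real_mult)
      then show ?thesis using True ij ss[OF ij(1)] spos[OF ij(1)] by simp
    next
      case False
      then show ?thesis using corthogonalD[OF ws(2), of j i] ws(3) ij by simp
    qed
    finally show "(mat_adjoint U * U) $$ (i, j) = (1\<^sub>m n :: complex mat) $$ (i, j)" .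
  qed (use U in auto)
  then have "U \<in> unitary_mats n" by (rule unitary_matsI[OF U])
  moreover have "U $$ (a, 0) = (1 / complex_of_real (sqrt (s 0))) * v $ a" if "a < n" for a
    using that n by (simp add: U_def hd)
  ultimately show thesis by (rule that)
qed

lemma mat_adjoint_block_diag:
  fixes B :: "complex mat"
  assumes "B \<in> carrier_mat m m"
  shows "mat_adjoint (four_block_mat (1\<^sub>m 1) (0\<^sub>m 1 m) (0\<^sub>m m 1) B)
    = four_block_mat (1\<^sub>m 1) (0\<^sub>m 1 m) (0\<^sub>m m 1) (mat_adjoint B)"
  using assms by (intro eq_matI) auto

lemma block_diag_mult:
  fixes A B C D :: "complex mat"
  assumes "A \<in> carrier_mat 1 1" "C \<in> carrier_mat 1 1" "B \<in> carrier_mat m m" "D \<in> carrier_mat m m"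
  shows "four_block_mat A (0\<^sub>m 1 m) (0\<^sub>m m 1) B * four_block_mat C (0\<^sub>m 1 m) (0\<^sub>m m 1) D
    = four_block_mat (A * C) (0\<^sub>m 1 m) (0\<^sub>m m 1) (B * D)"
  using assms by (subst mult_four_block_mat[of _ 1 1 _ m _ m _ _ 1 _ m]) auto

text \<open>Induction on the dimension. In an orthonormal basis that starts with an eigenvector the first column of \<open>A\<close> is a multiple
of the first unit vector; since \<open>A\<close> is Hermitian so is the first row, and \<open>A\<close> splits off a one-dimensional block. The
statement holds for every ordering \<open>es\<close> of the roots, so that the eigenvalues can be taken in increasing order.\<close>
lemma spectral_theorem_roots:
  fixes A :: "complex mat"
  assumes "A \<in> carrier_mat n n" "mat_adjoint A = A" "char_poly A = (\<Prod>e\<leftarrow>es. [:- e, 1:])" "length es = n"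
  shows "\<exists>U \<in> unitary_mats n. A = U * mat_diag n ((!) es) * mat_adjoint U"
  using assms
proof (induction es arbitrary: n A)
  case Nil
  then have "A = 1\<^sub>m n * mat_diag n ((!) []) * mat_adjoint (1\<^sub>m n)" by (intro eq_matI) auto
  moreover have "1\<^sub>m n \<in> unitary_mats n" using Nil by (intro unitary_matsI) auto
  ultimately show ?case by blast
next
  case (Cons e es n A)
  define m where "m = length es"
  have n: "n = Suc m" using Cons.prems by (simp add: m_def)
  note A = Cons.prems(1)
  have "eigenvalue A e"
    unfolding eigenvalue_root_char_poly[OF A] Cons.prems(3) by simp
  from find_eigenvector[OF A this] obtain v where v: "v \<in> carrier_vec n" "v \<noteq> 0\<^sub>v n" and Av: "A *\<^sub>v v = e \<cdot>\<^sub>v v"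
    using A unfolding eigenvector_def by auto
  obtain U c where U: "U \<in> unitary_mats n" and Uc: "\<And>a. a < n \<Longrightarrow> U $$ (a, 0) = c * v $ a"
    using unitary_with_first_column[OF v] n by blast
  note U' = unitary_matsD[OF U]
  define A' where "A' = mat_adjoint U * (A * U)"
  have A': "A' \<in> carrier_mat n n" using A U' by (auto simp: A'_def)
  have A_eq: "A = U * A' * mat_adjoint U"
  proof -
    have "U * A' = A * U"
      unfolding A'_def using A U'(1) by (intro unitary_cancel[OF U]) auto
    then have "U * A' * mat_adjoint U = A * (U * mat_adjoint U)"
      using assoc_mult_mat[OF A U'(1,4)] by simp
    then show ?thesis using A U'(3) by simp
  qed
  have A'h: "mat_adjoint A' = A'"
  proof -
    have "mat_adjoint A' = mat_adjoint (A * U) * mat_adjoint (mat_adjoint U)"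
      unfolding A'_def using A U' by (intro mat_adjoint_mult) auto
    also have "mat_adjoint (A * U) = mat_adjoint U * A"
      using mat_adjoint_mult[OF A U'(1)] Cons.prems(2) by simp
    finally show ?thesis using assoc_mult_mat[OF U'(4) A U'(1)] by (simp add: A'_def)
  qed
  have col: "A' $$ (i, 0) = (if i = 0 then e else 0)" if i: "i < n" for i
  proof -
    have AU: "(A * U) $$ (a, 0) = e * U $$ (a, 0)" if a: "a < n" for a
    proof -
      have "(A * U) $$ (a, 0) = (\<Sum>l<n. A $$ (a, l) * U $$ (l, 0))"
        using A U' a n by (intro mat_mult_index) auto
      also have "... = c * (\<Sum>l<n. A $$ (a, l) * v $ l)" by (simp add: Uc sum_distrib_left mult_ac)
      also have "(\<Sum>l<n. A $$ (a, l) * v $ l) = (A *\<^sub>v v) $ a"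
        using A v a by (auto simp: scalar_prod_def atLeast0LessThan intro!: sum.cong)
      also have "... = e * v $ a" using Av v a by simp
      finally show ?thesis using Uc[OF a] by simp
    qed
    have "A' $$ (i, 0) = (\<Sum>a<n. mat_adjoint U $$ (i, a) * (A * U) $$ (a, 0))"
      unfolding A'_def using A U' i n by (intro mat_mult_index) auto
    also have "... = e * (\<Sum>a<n. cnj (U $$ (a, i)) * U $$ (a, 0))"
      unfolding sum_distrib_left using U' i AU by (intro sum.cong) auto
    also have "... = (if i = 0 then e else 0)"
      using unitary_columns[OF U i, of 0] n by simp
    finally show ?thesis .
  qed
  have row: "A' $$ (0, j) = 0" if "j < n" "j \<noteq> 0" for j
  proof -
    have "A' $$ (0, j) = mat_adjoint A' $$ (0, j)" by (simp add: A'h)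
    also have "... = cnj (A' $$ (j, 0))" using A' that n by simp
    finally show ?thesis using col[of j] that by simp
  qed
  define A1 :: "complex mat" where "A1 = Matrix.mat 1 1 (\<lambda>_. e)"
  let ?De = "mat_diag n ((!) (e # es))"
  let ?I = "four_block_mat (1\<^sub>m 1) (0\<^sub>m 1 m) (0\<^sub>m m 1)"
  let ?Z = "four_block_mat A1 (0\<^sub>m 1 m) (0\<^sub>m m 1)"
  define A3 where "A3 = Matrix.mat m m (\<lambda>(i, j). A' $$ (Suc i, Suc j))"
  have A3: "A3 \<in> carrier_mat m m" and A1: "A1 \<in> carrier_mat 1 1" by (auto simp: A3_def A1_def)
  have block: "A' = ?Z A3"
    using A' n col row by (intro eq_matI) (auto simp: A1_def A3_def)
  have A3h: "mat_adjoint A3 = A3"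
  proof (rule eq_matI)
    fix i j assume ij: "i < dim_row A3" "j < dim_col A3"
    have "A' $$ (Suc i, Suc j) = mat_adjoint A' $$ (Suc i, Suc j)" by (simp add: A'h)
    then show "mat_adjoint A3 $$ (i, j) = A3 $$ (i, j)"
      using ij A' n by (simp add: A3_def)
  qed (use A3 in auto)
  have "similar_mat A A'"
    using A A' U' A_eq by (intro similar_matI[of _ _ U "mat_adjoint U" n]) auto
  then have "char_poly A = char_poly A'" by (rule char_poly_similar)
  also have "... = char_poly A1 * char_poly A3"
    unfolding block by (rule char_poly_four_block_zeros_col[OF A1 _ A3]) simp
  also have "char_poly A1 = [:- e, 1:]" by (simp add: A1_def char_poly_defs det_def sign_def)
  finally have "[:- e, 1:] * char_poly A3 = [:- e, 1:] * (\<Prod>e\<leftarrow>es. [:- e, 1:])"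
    using Cons.prems(3) by simp
  then have "char_poly A3 = (\<Prod>e\<leftarrow>es. [:- e, 1:])" by (metis mult_cancel_left pCons_eq_0_iff zero_neq_one)
  from Cons.IH[OF A3 A3h this] obtain U3 where U3: "U3 \<in> unitary_mats m"
    and A3_eq: "A3 = U3 * mat_diag m ((!) es) * mat_adjoint U3" by (auto simp: m_def)
  note U3' = unitary_matsD[OF U3]
  define Q where "Q = ?I U3"
  have Q: "Q \<in> carrier_mat n n" unfolding Q_def n using U3'(1) by (metis One_nat_def four_block_carrier_mat one_carrier_mat plus_1_eq_Suc)
  have Qadj: "mat_adjoint Q = ?I (mat_adjoint U3)"
    unfolding Q_def by (rule mat_adjoint_block_diag[OF U3'(1)])
  have QU: "Q \<in> unitary_mats n"
  proof (rule unitary_matsI[OF Q])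
    have "mat_adjoint Q * Q = ?I (1\<^sub>m m)"
      unfolding Qadj unfolding Q_def using U3' by (subst block_diag_mult) auto
    also have "... = 1\<^sub>m n" by (intro eq_matI) (auto simp: n)
    finally show "mat_adjoint Q * Q = 1\<^sub>m n" .
  qed
  have "?De = ?Z (mat_diag m ((!) es))"
    by (intro eq_matI) (auto simp: n A1_def mat_diag_def nth_Cons split: nat.splits)
  moreover have "Q * ?Z (mat_diag m ((!) es))
      = four_block_mat (1\<^sub>m 1 * A1) (0\<^sub>m 1 m) (0\<^sub>m m 1) (U3 * mat_diag m ((!) es))"
    unfolding Q_def using U3' A1 by (intro block_diag_mult) auto
  moreover have "four_block_mat (1\<^sub>m 1 * A1) (0\<^sub>m 1 m) (0\<^sub>m m 1) (U3 * mat_diag m ((!) es)) * mat_adjoint Q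
      = four_block_mat (1\<^sub>m 1 * A1 * 1\<^sub>m 1) (0\<^sub>m 1 m) (0\<^sub>m m 1) (U3 * mat_diag m ((!) es) * mat_adjoint U3)"
    unfolding Qadj using U3' A1 by (intro block_diag_mult) auto
  moreover have "1\<^sub>m 1 * A1 * 1\<^sub>m 1 = A1"
    using left_mult_one_mat[OF A1] right_mult_one_mat[OF A1] by simp
  ultimately have "Q * ?De * mat_adjoint Q = A'" by (simp only: block A3_eq)
  then have "A = U * (Q * ?De * mat_adjoint Q) * mat_adjoint U"
    using A_eq by simp
  also have "... = (U * Q) * ?De * (mat_adjoint Q * mat_adjoint U)"
  proof -
    let ?D = "?De"
    have D: "?D \<in> carrier_mat n n" and Q': "mat_adjoint Q \<in> carrier_mat n n"
      using Q by auto
    note QD = mult_carrier_mat[OF Q D] and UQD = mult_carrier_mat[OF mult_carrier_mat[OF U'(1) Q] D]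
    have "U * (Q * ?D * mat_adjoint Q) = U * Q * ?D * mat_adjoint Q"
      using assoc_mult_mat[OF U'(1) QD Q'] assoc_mult_mat[OF U'(1) Q D] by simp
    then show ?thesis using assoc_mult_mat[OF UQD Q' U'(4)] by simp
  qed
  also have "mat_adjoint Q * mat_adjoint U = mat_adjoint (U * Q)"
    using mat_adjoint_mult[OF U'(1) Q] by simp
  finally show ?case using unitary_mats_mult[OF U QU] by blast
qed

text \<open>The spectral theorem is used twice: for an arbitrary ordering of the roots, to see that they are real, and then for the
sorted list.\<close>
lemma hermitian_diagonalization:
  assumes A: "A \<in> hermitian_mats n"
  obtains U where "U \<in> unitary_mats n"
    "A = U * mat_diag n (\<lambda>i. complex_of_real (eigval A i)) * mat_adjoint U"
proof -
  have Ac: "A \<in> carrier_mat n n" and Ah: "mat_adjoint A = A" using A by (auto simp: hermitian_mats_def)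
  obtain es where es: "char_poly A = (\<Prod>e\<leftarrow>es. [:- e, 1:])" "length es = n"
    using char_poly_factorized[OF Ac] by blast
  let ?D = "mat_diag n ((!) es)"
  obtain U where U: "U \<in> unitary_mats n" and AU: "A = U * ?D * mat_adjoint U"
    using spectral_theorem_roots[OF Ac Ah es] by blast
  note U' = unitary_matsD[OF U]
  have D: "?D = mat_adjoint U * A * U"
  proof -
    have UD: "U * ?D \<in> carrier_mat n n" using U'(1) by auto
    have "mat_adjoint U * A = mat_adjoint U * (U * ?D) * mat_adjoint U"
      unfolding AU using assoc_mult_mat[OF U'(4) UD U'(4)] by simp
    also have "... = ?D * mat_adjoint U"
      using unitary_cancel(1)[OF U mat_diag_dim] by simp
    finally have "mat_adjoint U * A * U = ?D * mat_adjoint U * U" by simp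
    also have "... = ?D * (mat_adjoint U * U)"
      using U'(1,4) by (intro assoc_mult_mat[of _ n n _ n _ n]) auto
    also have "... = ?D" using U'(2) right_mult_one_mat[OF mat_diag_dim] by simp
    finally show ?thesis by simp
  qed
  have Dh: "mat_adjoint (?D) = ?D"
  proof -
    have "mat_adjoint (mat_adjoint U * A * U) = mat_adjoint U * mat_adjoint (mat_adjoint U * A)"
      using Ac U' by (intro mat_adjoint_mult) auto
    also have "mat_adjoint (mat_adjoint U * A) = A * U"
      using mat_adjoint_mult[OF U'(4) Ac] Ah by simp
    also have "mat_adjoint U * (A * U) = mat_adjoint U * A * U"
      using assoc_mult_mat[OF U'(4) Ac U'(1)] by simp
    finally show ?thesis unfolding D .
  qed
  have real: "es ! i = complex_of_real (Re (es ! i))" if "i < n" for i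
  proof -
    have "mat_adjoint (?D) $$ (i, i) = cnj (es ! i)"
      using that by (simp add: mat_diag_def)
    then have "cnj (es ! i) = es ! i" using that unfolding Dh by (simp add: mat_diag_def)
    then show ?thesis by (simp add: complex_eq_iff)
  qed
  define xs where "xs = sort (map Re es)"
  have es_map: "map (\<lambda>e. complex_of_real (Re e)) es = es"
    using real es(2) by (intro nth_equalityI) auto
  have mset: "mset (map complex_of_real xs) = mset es"
  proof -
    have "mset (map complex_of_real xs) = image_mset complex_of_real (image_mset Re (mset es))"
      by (simp add: xs_def)
    also have "... = mset (map (\<lambda>e. complex_of_real (Re e)) es)"
      by (simp add: image_mset.compositionality o_def)
    finally show ?thesis by (simp add: es_map)
  qed
  have "proots (char_poly A) = mset es"
  proof -
    have "proots (\<Prod>e\<leftarrow>es. [:- e, 1:]) = mset es" for es :: "complex list"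
    proof (induction es)
      case (Cons a es)
      have "(\<Prod>e\<leftarrow>es. [:- e, 1:]) \<noteq> 0" by (auto simp: prod_list_zero_iff)
      then have "proots ([:- a, 1:] * (\<Prod>e\<leftarrow>es. [:- e, 1:])) = proots [:- a, 1:] + proots (\<Prod>e\<leftarrow>es. [:- e, 1:])"
        by (intro proots_mult) auto
      then show ?case using Cons by (simp del: mult_pCons_left)
    qed simp
    then show ?thesis using es(1) by simp
  qed
  then have "eigval A i = xs ! i" for i by (simp add: eigval_def xs_def flip: mset_map)
  moreover have "char_poly A = (\<Prod>e\<leftarrow>map complex_of_real xs. [:- e, 1:])"
  proof -
    have "(\<Prod>e\<leftarrow>as. [:- e, 1:]) = prod_mset (image_mset (\<lambda>e. [:- e, 1:]) (mset as))" for as :: "complex list"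
      by (simp flip: prod_mset_prod_list)
    then show ?thesis unfolding es(1) by (simp only: mset)
  qed
  moreover have len: "length (map complex_of_real xs) = n"
    using es(2) by (simp add: xs_def)
  ultimately obtain W where W: "W \<in> unitary_mats n"
    and AW: "A = W * mat_diag n ((!) (map complex_of_real xs)) * mat_adjoint W"
    using spectral_theorem_roots[OF Ac Ah] by blast
  have "mat_diag n ((!) (map complex_of_real xs)) = mat_diag n (\<lambda>i. complex_of_real (eigval A i))"
    using len \<open>\<And>i. eigval A i = xs ! i\<close> by (intro eq_matI) (auto simp: mat_diag_def)
  with W AW show thesis using that by simp
qed

section \<open>The Haar measure and the Harish-Chandra integral\<close>

lemma conj_by_mat:
  assumes "A \<in> carrier_mat N N" "U \<in> carrier_mat N N" "i < N" "j < N"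
  shows "conj_by N (\<lambda>a i. U $$ (a, i)) (\<lambda>a d. A $$ (a, d)) i j = (mat_adjoint U * (A * U)) $$ (i, j)"
proof -
  have "(mat_adjoint U * (A * U)) $$ (i, j) = (\<Sum>a<N. mat_adjoint U $$ (i, a) * (A * U) $$ (a, j))"
    using assms by (intro mat_mult_index) auto
  also have "... = (\<Sum>a<N. cnj (U $$ (a, i)) * (\<Sum>d<N. A $$ (a, d) * U $$ (d, j)))"
  proof (rule sum.cong[OF refl])
    fix a assume "a \<in> {..<N}"
    then show "mat_adjoint U $$ (i, a) * (A * U) $$ (a, j) = cnj (U $$ (a, i)) * (\<Sum>d<N. A $$ (a, d) * U $$ (d, j))"
      using assms mat_mult_index[OF assms(1,2), of a j] by auto
  qed
  finally show ?thesis by (simp add: conj_by_def sum_distrib_left mult.assoc)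
qed

lemma conj_by_spectral:
  assumes Q: "Q \<in> unitary_mats N" and A: "A = Q * mat_diag N l * mat_adjoint Q"
    and U: "U \<in> carrier_mat N N" and ij: "i < N" "j < N"
  shows "conj_by N (\<lambda>a i. U $$ (a, i)) (\<lambda>a d. A $$ (a, d)) i j
    = (\<Sum>a<N. cnj ((mat_adjoint Q * U) $$ (a, i)) * l a * (mat_adjoint Q * U) $$ (a, j))"
proof -
  note Q' = unitary_matsD[OF Q]
  define R where "R = mat_adjoint Q * U"
  have R: "R \<in> carrier_mat N N" using Q' U by (auto simp: R_def)
  have QD: "Q * mat_diag N l \<in> carrier_mat N N" using mult_carrier_mat[OF Q'(1) mat_diag_dim] .
  have Ac: "A \<in> carrier_mat N N" unfolding A using mult_carrier_mat[OF QD Q'(4)] .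
  have DR: "mat_diag N l * R \<in> carrier_mat N N" using mult_carrier_mat[OF mat_diag_dim R] .
  have "A * U = Q * (mat_diag N l * R)"
    unfolding A R_def using assoc_mult_mat[OF QD Q'(4) U] assoc_mult_mat[OF Q'(1) mat_diag_dim R[unfolded R_def]] by simp
  moreover have "mat_adjoint R = mat_adjoint U * Q"
    unfolding R_def using mat_adjoint_mult[OF Q'(4) U] by simp
  ultimately have "mat_adjoint U * (A * U) = mat_adjoint R * (mat_diag N l * R)"
    using assoc_mult_mat[of "mat_adjoint U" N N Q N "mat_diag N l * R" N] U Q'(1) DR by simp
  then have "conj_by N (\<lambda>a i. U $$ (a, i)) (\<lambda>a d. A $$ (a, d)) i j = (mat_adjoint R * (mat_diag N l * R)) $$ (i, j)"
    using conj_by_mat[OF Ac U ij] by simp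
  also have "... = (\<Sum>a<N. mat_adjoint R $$ (i, a) * (mat_diag N l * R) $$ (a, j))"
    using R DR ij by (intro mat_mult_index) auto
  also have "... = (\<Sum>a<N. cnj (R $$ (a, i)) * l a * R $$ (a, j))"
    using R ij by (intro sum.cong) (auto simp: mat_diag_mult_left[OF R])
  finally show ?thesis by (simp add: R_def)
qed

lemma cnj_measurable: "cnj \<in> borel_measurable borel"
  by (intro borel_measurable_continuous_onI continuous_intros)

lemma mat_entry_measurable:
  assumes "i < N" "j < N"
  shows "(\<lambda>A. A $$ (i, j)) \<in> borel_measurable (mat_borel N)"
proof -
  have "(\<lambda>A. \<lambda>ij\<in>{..<N} \<times> {..<N}. A $$ ij) \<in> measurable (mat_borel N) (Pi\<^sub>M ({..<N} \<times> {..<N}) (\<lambda>_. borel))"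
    unfolding mat_borel_def by (rule measurable_vimage_algebra1) (auto simp: space_PiM)
  from measurable_compose[OF this measurable_component_singleton[of "(i, j)"]]
  show ?thesis using assms by simp
qed

lemma measurable_mat_borelI:
  assumes "f \<in> space M \<rightarrow> carrier_mat N N"
    and "\<And>i j. i < N \<Longrightarrow> j < N \<Longrightarrow> (\<lambda>x. f x $$ (i, j)) \<in> borel_measurable M"
  shows "f \<in> measurable M (mat_borel N)"
  unfolding mat_borel_def using assms by (intro measurable_vimage_algebra2 measurable_restrict) auto

locale haar_unitary =
  fixes N :: nat and m :: "complex mat measure"
  assumes haar: "haar_prob N m"
begin

sublocale prob_space m
  using haar by (simp add: haar_prob_def)

lemma space_haar: "space m = unitary_mats N"
  and sets_haar: "sets m = sets (restrict_space (mat_borel N) (unitary_mats N))"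
  and left_invariant: "V \<in> unitary_mats N \<Longrightarrow> distr m m (\<lambda>U. V * U) = m"
  using haar by (auto simp: haar_prob_def)

lemma haar_entry_measurable:
  assumes "i < N" "j < N"
  shows "(\<lambda>U. U $$ (i, j)) \<in> borel_measurable m"
  using measurable_restrict_space1[OF mat_entry_measurable[OF assms]]
  by (simp add: measurable_cong_sets[OF sets_haar refl])

lemma measurable_haarI:
  assumes f: "f \<in> space M \<rightarrow> unitary_mats N"
    and ent: "\<And>i j. i < N \<Longrightarrow> j < N \<Longrightarrow> (\<lambda>x. f x $$ (i, j)) \<in> borel_measurable M"
  shows "f \<in> measurable M m"
proof -
  have "f \<in> measurable M (mat_borel N)"
    using f by (intro measurable_mat_borelI ent) (auto simp: unitary_mats_def)
  then have "f \<in> measurable M (restrict_space (mat_borel N) (unitary_mats N))"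
    using f by (intro measurable_restrict_space2) auto
  then show ?thesis by (simp add: measurable_cong_sets[OF refl sets_haar])
qed

lemma haar_carrier: "U \<in> space m \<Longrightarrow> U \<in> carrier_mat N N" by (simp add: space_haar unitary_mats_def)

lemma mult_measurable:
  assumes X: "X \<in> measurable M m" and Y: "Y \<in> measurable M m"
  shows "(\<lambda>x. X x * Y x) \<in> measurable M m"
proof (rule measurable_haarI)
  show "(\<lambda>x. X x * Y x) \<in> space M \<rightarrow> unitary_mats N"
    using measurable_space[OF X] measurable_space[OF Y] by (auto simp: space_haar intro: unitary_mats_mult)
  fix i j assume ij: "i < N" "j < N"
  have "(\<lambda>x. \<Sum>a<N. X x $$ (i, a) * Y x $$ (a, j)) \<in> borel_measurable M"
    using ij by (intro borel_measurable_sum borel_measurable_times measurable_compose[OF X] measurable_compose[OF Y] haar_entry_measurable) auto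
  also have "?this \<longleftrightarrow> (\<lambda>x. (X x * Y x) $$ (i, j)) \<in> borel_measurable M"
    using measurable_space[OF X] measurable_space[OF Y] ij
    by (intro measurable_cong, subst mat_mult_index[of _ N N _ N]) (auto simp: haar_carrier)
  finally show "(\<lambda>x. (X x * Y x) $$ (i, j)) \<in> borel_measurable M" .
qed

lemma adjoint_measurable:
  assumes X: "X \<in> measurable M m"
  shows "(\<lambda>x. mat_adjoint (X x)) \<in> measurable M m"
proof (rule measurable_haarI)
  show "(\<lambda>x. mat_adjoint (X x)) \<in> space M \<rightarrow> unitary_mats N"
    using measurable_space[OF X] by (auto simp: space_haar intro: adjoint_unitary)
  fix i j assume ij: "i < N" "j < N"
  have "(\<lambda>x. cnj (X x $$ (j, i))) \<in> borel_measurable M"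
    using measurable_compose[OF measurable_compose[OF X haar_entry_measurable[OF ij(2,1)]] cnj_measurable] .
  also have "?this \<longleftrightarrow> (\<lambda>x. mat_adjoint (X x) $$ (i, j)) \<in> borel_measurable M"
    using measurable_space[OF X, THEN haar_carrier] ij
    by (intro measurable_cong, subst mat_adjoint_index) auto
  finally show "(\<lambda>x. mat_adjoint (X x) $$ (i, j)) \<in> borel_measurable M" .
qed

lemma const_measurable: "V \<in> unitary_mats N \<Longrightarrow> (\<lambda>_. V) \<in> measurable M m"
  by (intro measurable_const) (simp add: space_haar)

lemma left_mult_nn_integral:
  assumes V: "V \<in> unitary_mats N" and h: "h \<in> borel_measurable m"
  shows "(\<integral>\<^sup>+U. h (V * U) \<partial>m) = (\<integral>\<^sup>+U. h U \<partial>m)"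
proof -
  have "(\<integral>\<^sup>+U. h U \<partial>distr m m (\<lambda>U. V * U)) = (\<integral>\<^sup>+U. h (V * U) \<partial>m)"
    using h mult_measurable[OF const_measurable[OF V] measurable_ident_sets[OF refl]]
    by (intro nn_integral_distr) auto
  then show ?thesis using left_invariant[OF V] by simp
qed

text \<open>Both sides equal the double integral of \<open>h(X\<^sup>* U)\<close>: for fixed \<open>X\<close>, left invariance in \<open>U\<close> removes \<open>X\<^sup>*\<close>; for fixed \<open>U\<close>,
left invariance in \<open>X\<close> allows \<open>X\<close> to be replaced by \<open>U X\<close>, which removes \<open>U\<close>.\<close>
lemma adjoint_nn_integral:
  fixes h :: "complex mat \<Rightarrow> ennreal"
  assumes h: "h \<in> borel_measurable m"
  shows "(\<integral>\<^sup>+U. h (mat_adjoint U) \<partial>m) = (\<integral>\<^sup>+U. h U \<partial>m)"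
proof -
  interpret pair_sigma_finite m m ..
  have m1: "(\<lambda>(X, U). h (mat_adjoint X * U)) \<in> borel_measurable (m \<Otimes>\<^sub>M m)"
    using measurable_compose[OF mult_measurable[OF adjoint_measurable[OF measurable_fst] measurable_snd] h]
    by (simp add: case_prod_beta)
  have adj: "(\<lambda>X. h (mat_adjoint X)) \<in> borel_measurable m"
    by (rule measurable_compose[OF adjoint_measurable[OF measurable_ident_sets[OF refl]] h, simplified])
  have "(\<integral>\<^sup>+U. h U \<partial>m) = (\<integral>\<^sup>+X. (\<integral>\<^sup>+U. h U \<partial>m) \<partial>m)" by (simp add: emeasure_space_1)
  also have "... = (\<integral>\<^sup>+X. (\<integral>\<^sup>+U. h (mat_adjoint X * U) \<partial>m) \<partial>m)"
    by (intro nn_integral_cong left_mult_nn_integral[symmetric] h) (simp add: space_haar adjoint_unitary)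
  also have "... = (\<integral>\<^sup>+U. (\<integral>\<^sup>+X. h (mat_adjoint X * U) \<partial>m) \<partial>m)" by (rule Fubini'[OF m1, symmetric])
  also have "... = (\<integral>\<^sup>+U. (\<integral>\<^sup>+X. h (mat_adjoint X) \<partial>m) \<partial>m)"
  proof (rule nn_integral_cong)
    fix U assume "U \<in> space m"
    then have U: "U \<in> unitary_mats N" by (simp add: space_haar)
    have "(\<integral>\<^sup>+X. h (mat_adjoint X * U) \<partial>m) = (\<integral>\<^sup>+X. h (mat_adjoint (U * X) * U) \<partial>m)"
      by (rule left_mult_nn_integral[OF U, symmetric, where h = "\<lambda>X. h (mat_adjoint X * U)"])
        (rule measurable_compose[OF mult_measurable[OF adjoint_measurable[OF measurable_ident_sets[OF refl]] const_measurable[OF U]] h, simplified])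
    also have "... = (\<integral>\<^sup>+X. h (mat_adjoint X) \<partial>m)"
    proof (rule nn_integral_cong)
      fix X assume "X \<in> space m"
      then have X: "X \<in> carrier_mat N N" by (rule haar_carrier)
      note U' = unitary_matsD[OF U]
      have "mat_adjoint (U * X) * U = mat_adjoint X * mat_adjoint U * U"
        using mat_adjoint_mult[OF U'(1) X] by simp
      also have "... = mat_adjoint X * (mat_adjoint U * U)"
        using U' X by (intro assoc_mult_mat[of _ N N _ N _ N]) auto
      also have "... = mat_adjoint X" using U'(2) X by (simp add: right_mult_one_mat[of _ N])
      finally show "h (mat_adjoint (U * X) * U) = h (mat_adjoint X)" by simp
    qed
    finally show "(\<integral>\<^sup>+X. h (mat_adjoint X * U) \<partial>m) = (\<integral>\<^sup>+X. h (mat_adjoint X) \<partial>m)" .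
  qed
  also have "... = (\<integral>\<^sup>+X. h (mat_adjoint X) \<partial>m)" by (simp add: emeasure_space_1)
  finally show ?thesis by simp
qed

text \<open>Taking adjoints exchanges left and right multiplication.\<close>
lemma right_mult_nn_integral:
  fixes h :: "complex mat \<Rightarrow> ennreal"
  assumes V: "V \<in> unitary_mats N" and h: "h \<in> borel_measurable m"
  shows "(\<integral>\<^sup>+U. h (U * V) \<partial>m) = (\<integral>\<^sup>+U. h U \<partial>m)"
proof -
  note V' = unitary_matsD[OF V]
  have "(\<lambda>U. h (U * V)) \<in> borel_measurable m"
    by (rule measurable_compose[OF mult_measurable[OF measurable_ident_sets[OF refl] const_measurable[OF V]] h, simplified])
  then have "(\<integral>\<^sup>+U. h (U * V) \<partial>m) = (\<integral>\<^sup>+U. h (mat_adjoint U * V) \<partial>m)"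
    by (rule adjoint_nn_integral[symmetric])
  also have "... = (\<integral>\<^sup>+U. h (mat_adjoint (mat_adjoint V * U)) \<partial>m)"
  proof (rule nn_integral_cong)
    fix U assume "U \<in> space m"
    then have "mat_adjoint (mat_adjoint V * U) = mat_adjoint U * V"
      using mat_adjoint_mult[OF V'(4), of U N] haar_carrier by simp
    then show "h (mat_adjoint U * V) = h (mat_adjoint (mat_adjoint V * U))" by simp
  qed
  also have "... = (\<integral>\<^sup>+U. h (mat_adjoint U) \<partial>m)"
    by (rule left_mult_nn_integral[OF adjoint_unitary[OF V], where h = "\<lambda>U. h (mat_adjoint U)"])
      (rule measurable_compose[OF adjoint_measurable[OF measurable_ident_sets[OF refl]] h, simplified])
  also have "... = (\<integral>\<^sup>+U. h U \<partial>m)" by (rule adjoint_nn_integral[OF h])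
  finally show ?thesis .
qed

lemma right_mult_measurable:
  "V \<in> unitary_mats N \<Longrightarrow> (\<lambda>U. U * V) \<in> measurable m m"
  using mult_measurable[OF measurable_ident_sets[OF refl] const_measurable, of V] by simp

lemma right_invariant:
  assumes V: "V \<in> unitary_mats N"
  shows "distr m m (\<lambda>U. U * V) = m"
proof (rule measure_eqI)
  fix B assume "B \<in> sets (distr m m (\<lambda>U. U * V))"
  then have B: "B \<in> sets m" by simp
  have "emeasure (distr m m (\<lambda>U. U * V)) B = (\<integral>\<^sup>+U. indicator B U \<partial>distr m m (\<lambda>U. U * V))"
    using B by simp
  also have "... = (\<integral>\<^sup>+U. indicator B (U * V) \<partial>m)"
    using B by (intro nn_integral_distr right_mult_measurable V) auto
  also have "... = (\<integral>\<^sup>+U. indicator B U \<partial>m)"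
    using B by (intro right_mult_nn_integral[OF V, where h = "indicator B"]) auto
  finally show "emeasure (distr m m (\<lambda>U. U * V)) B = emeasure m B" using B by simp
qed simp

text \<open>Diagonalising \<open>A = Q D Q\<^sup>*\<close>, the integrand on the right is that of the Harish-Chandra integral evaluated at \<open>Q\<^sup>* U\<close>, and
left invariance removes \<open>Q\<^sup>*\<close>. This makes the integrand a function of the entries of \<open>A\<close> and \<open>U\<close>, hence jointly
measurable.\<close>
lemma HC_eq_integral_conj_by:
  assumes A: "A \<in> hermitian_mats N"
  shows "HC m N x (eigval A)
    = (\<integral>U. exp (\<Sum>j<N. x j * conj_by N (\<lambda>a i. U $$ (a, i)) (\<lambda>a d. A $$ (a, d)) j j) \<partial>m)"
proof -
  let ?c = "\<lambda>U j. conj_by N (\<lambda>a i. U $$ (a, i)) (\<lambda>a d. A $$ (a, d)) j j"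
  obtain Q where Q: "Q \<in> unitary_mats N"
    and AQ: "A = Q * mat_diag N (\<lambda>i. complex_of_real (eigval A i)) * mat_adjoint Q"
    using hermitian_diagonalization[OF A] by blast
  note Q' = unitary_matsD[OF Q]
  let ?l = "\<lambda>i. complex_of_real (eigval A i)"
  define h where "h U = exp (\<Sum>j<N. x j * (\<Sum>i<N. cnj (U $$ (i, j)) * ?l i * U $$ (i, j)))" for U
  have tr: "exp (mat_trace (mat_diag N ?l * U * mat_diag N x * mat_adjoint U)) = h U" if U: "U \<in> carrier_mat N N" for U
  proof -
    have L: "mat_diag N ?l * U \<in> carrier_mat N N" using mult_carrier_mat[OF mat_diag_dim U] .
    have LX: "mat_diag N ?l * U * mat_diag N x \<in> carrier_mat N N" using mult_carrier_mat[OF L mat_diag_dim] .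
    have "mat_trace (mat_diag N ?l * U * mat_diag N x * mat_adjoint U)
        = (\<Sum>i<N. \<Sum>j<N. (mat_diag N ?l * U * mat_diag N x) $$ (i, j) * mat_adjoint U $$ (j, i))"
      unfolding mat_trace_def using U LX
      by (intro sum.cong) (auto simp: mat_mult_index[of _ N N _ N] simp del: index_mult_mat(1))
    also have "... = (\<Sum>i<N. \<Sum>j<N. ?l i * U $$ (i, j) * x j * cnj (U $$ (i, j)))"
    proof (intro sum.cong refl)
      fix i j assume ij: "i \<in> {..<N}" "j \<in> {..<N}"
      then have "(mat_diag N ?l * U * mat_diag N x) $$ (i, j) = (mat_diag N ?l * U) $$ (i, j) * x j"
        unfolding mat_diag_mult_right[OF L] by simp
      also have "(mat_diag N ?l * U) $$ (i, j) = ?l i * U $$ (i, j)"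
        unfolding mat_diag_mult_left[OF U] using ij by simp
      finally show "(mat_diag N ?l * U * mat_diag N x) $$ (i, j) * mat_adjoint U $$ (j, i)
          = ?l i * U $$ (i, j) * x j * cnj (U $$ (i, j))"
        using U ij by auto
    qed
    also have "... = (\<Sum>j<N. \<Sum>i<N. ?l i * U $$ (i, j) * x j * cnj (U $$ (i, j)))" by (rule sum.swap)
    also have "... = (\<Sum>j<N. x j * (\<Sum>i<N. cnj (U $$ (i, j)) * ?l i * U $$ (i, j)))"
      by (simp add: sum_distrib_left mult_ac)
    finally show ?thesis by (simp add: h_def)
  qed
  have h_meas: "h \<in> borel_measurable m"
  proof -
    have "(\<lambda>U. \<Sum>j<N. x j * (\<Sum>i<N. cnj (U $$ (i, j)) * ?l i * U $$ (i, j))) \<in> borel_measurable m"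
      by (intro borel_measurable_sum borel_measurable_times borel_measurable_const measurable_compose[OF _ cnj_measurable] haar_entry_measurable) auto
    then show ?thesis unfolding h_def[abs_def] by measurable
  qed
  have hQ: "h (mat_adjoint Q * U) = exp (\<Sum>j<N. x j * ?c U j)"
    if U: "U \<in> carrier_mat N N" for U
  proof -
    have "(\<Sum>i<N. cnj ((mat_adjoint Q * U) $$ (i, j)) * ?l i * (mat_adjoint Q * U) $$ (i, j))
        = ?c U j" if j: "j < N" for j by (rule conj_by_spectral[OF Q AQ U j j, symmetric])
    then show ?thesis by (simp add: h_def)
  qed
  have "HC m N x (eigval A) = (\<integral>U. h U \<partial>m)"
    unfolding HC_def by (intro Bochner_Integration.integral_cong refl tr haar_carrier)
  also have "... = (\<integral>U. h (mat_adjoint Q * U) \<partial>m)"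
    using integral_distr[OF mult_measurable[OF const_measurable[OF adjoint_unitary[OF Q]] measurable_ident_sets[OF refl]] h_meas]
      left_invariant[OF adjoint_unitary[OF Q]] by simp
  also have "... = (\<integral>U. exp (\<Sum>j<N. x j * ?c U j) \<partial>m)"
    by (intro Bochner_Integration.integral_cong refl hQ haar_carrier)
  finally show ?thesis .
qed

end

section \<open>The randomly rotated matrix\<close>

text \<open>This is the invariance of the trace of a power. Expanding each entry gives a second walk \<open>g\<close> through the eigenvalues; summing
over \<open>f\<close> first, orthogonality of the rows of \<open>R\<close> forces \<open>g\<close> to be constant.\<close>
lemma cyc_sum_spectral:
  assumes k: "k \<ge> 1"
    and c: "\<And>i j. i < N \<Longrightarrow> j < N \<Longrightarrow> c i j = (\<Sum>a<N. cnj (R a i) * l a * R a j)"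
    and R: "\<And>a e. a < N \<Longrightarrow> e < N \<Longrightarrow> (\<Sum>i<N. R a i * cnj (R e i)) = (if a = e then 1 else 0)"
  shows "cyc_sum N k c = (\<Sum>a<N. l a ^ k)"
proof -
  let ?K = "(\<lambda>a. \<lambda>i\<in>{..<k}. a) ` {..<N}"
  let ?w = "\<lambda>g f. \<Prod>i<k. cnj (R (g i) (f i)) * l (g i) * R (g i) (f (cyc k i))"
  let ?F = "{..<k} \<rightarrow>\<^sub>E {..<N}"
  define pre where "pre j = (if j = 0 then k - 1 else j - 1)" for j :: nat
  let ?d = "\<lambda>g. \<Prod>j<k. if g (pre j) = g j then 1 else (0 :: complex)"
  have pre: "pre j < k" "cyc k (pre j) = j" if "j < k" for j using that by (auto simp: pre_def cyc_def)
  have cyc: "pre (cyc k i) = i" if "i < k" for i using that by (auto simp: pre_def cyc_def)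
  have fr: "f i < N" if "f \<in> ?F" "i < k" for f i using that by (auto simp: PiE_def Pi_def)
  have finF: "finite ?F" by (intro finite_PiE) auto
  have "cyc_sum N k c = (\<Sum>f\<in>?F. \<Prod>i<k. \<Sum>a<N. cnj (R a (f i)) * l a * R a (f (cyc k i)))"
    unfolding cyc_sum_def
  proof (rule sum.cong[OF refl], rule prod.cong[OF refl])
    fix f i assume f: "f \<in> ?F" and i: "i \<in> {..<k}"
    show "c (f i) (f (cyc k i)) = (\<Sum>a<N. cnj (R a (f i)) * l a * R a (f (cyc k i)))"
      using i by (intro c fr[OF f]) (auto simp: cyc_less)
  qed
  also have "... = (\<Sum>f\<in>?F. \<Sum>g\<in>?F. ?w g f)" by (intro sum.cong refl prod_sum_PiE) auto
  also have "... = (\<Sum>g\<in>?F. \<Sum>f\<in>?F. ?w g f)" by (rule sum.swap)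
  also have "... = (\<Sum>g\<in>?F. (\<Prod>i<k. l (g i)) * ?d g)"
  proof (rule sum.cong[OF refl])
    fix g assume g: "g \<in> ?F"
    have "(\<Prod>i<k. R (g i) (f (cyc k i))) = (\<Prod>j<k. R (g (pre j)) (f j))" for f :: "nat \<Rightarrow> nat"
      by (rule prod.reindex_bij_witness[of _ pre "cyc k"]) (auto simp: pre cyc cyc_less)
    then have "?w g f
        = (\<Prod>i<k. l (g i)) * (\<Prod>j<k. R (g (pre j)) (f j) * cnj (R (g j) (f j)))" for f :: "nat \<Rightarrow> nat"
      by (simp only: prod.distrib mult_ac)
    then have "(\<Sum>f\<in>?F. ?w g f)
        = (\<Prod>i<k. l (g i)) * (\<Sum>f\<in>?F. \<Prod>j<k. R (g (pre j)) (f j) * cnj (R (g j) (f j)))"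
      by (simp only: sum_distrib_left)
    also have "(\<Sum>f\<in>?F. \<Prod>j<k. R (g (pre j)) (f j) * cnj (R (g j) (f j)))
        = (\<Prod>j<k. \<Sum>y<N. R (g (pre j)) y * cnj (R (g j) y))" by (rule prod_sum_PiE[symmetric]) auto
    also have "... = ?d g" by (intro prod.cong refl R fr[OF g]) (auto simp: pre)
    finally show "(\<Sum>f\<in>?F. ?w g f)
        = (\<Prod>i<k. l (g i)) * ?d g" .
  qed
  also have "... = (\<Sum>g\<in>?K. (\<Prod>i<k. l (g i)))"
  proof (rule sum.mono_neutral_cong_right[OF finF])
    show "?K \<subseteq> ?F" by (auto split: if_splits)
    show "\<forall>g \<in> ?F - ?K. (\<Prod>i<k. l (g i)) * ?d g = 0"
    proof
      fix g assume g: "g \<in> ?F - ?K"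
      have "\<exists>j<k. g (pre j) \<noteq> g j"
      proof (rule ccontr)
        assume "\<not> ?thesis"
        then have eq: "g (pre j) = g j" if "j < k" for j using that by blast
        have const: "i < k \<longrightarrow> g i = g 0" for i
        proof (induction i)
          case (Suc i)
          then show ?case using eq[of "Suc i"] by (auto simp: pre_def)
        qed simp
        have "g = (\<lambda>i\<in>{..<k}. g 0)"
        proof (rule ext)
          fix i
          have "g \<in> extensional {..<k}" using g by (simp add: PiE_def)
          then show "g i = (\<lambda>i\<in>{..<k}. g 0) i"
            using const[of i] by (cases "i < k") (simp_all add: extensional_def)
        qed
        moreover have "g 0 < N" using g k fr[of g 0] by auto
        ultimately show False using g by auto
      qed
      then have "?d g = (0 :: complex)" by (auto simp: prod_zero_iff)
      then show "(\<Prod>i<k. l (g i)) * ?d g = 0" by simp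
    qed
  next
    fix g assume "g \<in> ?K"
    then show "(\<Prod>i<k. l (g i)) * ?d g = (\<Prod>i<k. l (g i))"
      using pre by (auto simp: restrict_def)
  qed
  also have "... = (\<Sum>a<N. l a ^ k)"
  proof (subst sum.reindex)
    show "inj_on (\<lambda>a. \<lambda>i\<in>{..<k}. a) {..<N}"
    proof (rule inj_onI)
      fix a e :: nat assume "(\<lambda>i\<in>{..<k}. a) = (\<lambda>i\<in>{..<k}. e)"
      from fun_cong[OF this, of 0] show "a = e" using k by simp
    qed
  qed (auto intro!: sum.cong)
  finally show ?thesis .
qed

text \<open>The probability space is enlarged by an independent Haar unitary \<open>U\<close>; the function \<open>b\<close> below gives the entries of
\<open>U\<^sup>* A U\<close>.\<close>
locale rotated_hermitian = haar_unitary N m + M: prob_space M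
  for N :: nat and m :: "complex mat measure" and M :: "'a measure" +
  fixes A :: "'a \<Rightarrow> complex mat"
  assumes N_pos: "N \<ge> 1" and random: "random_hermitian M N A"
begin

definition b :: "nat \<Rightarrow> nat \<Rightarrow> 'a \<times> complex mat \<Rightarrow> complex" where
  "b i j p = conj_by N (\<lambda>a i. snd p $$ (a, i)) (\<lambda>a d. A (fst p) $$ (a, d)) i j"

sublocale pair_prob_space M m ..

abbreviation MU :: "('a \<times> complex mat) measure" where "MU \<equiv> M \<Otimes>\<^sub>M m"

lemma A_hermitian: "w \<in> space M \<Longrightarrow> A w \<in> hermitian_mats N"
  using random by (simp add: random_hermitian_def)

lemma A_carrier: "w \<in> space M \<Longrightarrow> A w \<in> carrier_mat N N"
  using A_hermitian by (auto simp: hermitian_mats_def)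

lemma A_entry_measurable: "i < N \<Longrightarrow> j < N \<Longrightarrow> (\<lambda>w. A w $$ (i, j)) \<in> borel_measurable M"
  using random measurable_compose[OF _ mat_entry_measurable] by (auto simp: random_hermitian_def)

lemma b_measurable:
  assumes ij: "i < N" "j < N"
  shows "b i j \<in> borel_measurable MU"
proof -
  have U: "(\<lambda>p. snd p $$ (a, i)) \<in> borel_measurable MU" if "a < N" "i < N" for a i
    by (rule measurable_compose[OF measurable_snd haar_entry_measurable[OF that]])
  have A: "(\<lambda>p. A (fst p) $$ (a, d)) \<in> borel_measurable MU" if "a < N" "d < N" for a d
    by (rule measurable_compose[OF measurable_fst A_entry_measurable[OF that]])
  show ?thesis
    unfolding b_def[abs_def] conj_by_def using ij
    by (intro borel_measurable_sum borel_measurable_times measurable_compose[OF _ cnj_measurable] U A) auto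
qed

lemma b_hermitian:
  assumes "i < N" "j < N" "p \<in> space MU"
  shows "b j i p = cnj (b i j p)"
proof -
  have "A (fst p) \<in> hermitian_mats N" using assms by (intro A_hermitian) (auto simp: space_pair_measure)
  then have Ac: "A (fst p) \<in> carrier_mat N N" and Ah: "mat_adjoint (A (fst p)) = A (fst p)"
    by (auto simp: hermitian_mats_def)
  have entry: "A (fst p) $$ (a, d) = cnj (A (fst p) $$ (d, a))" if "a < N" "d < N" for a d
    using mat_adjoint_index[of a "A (fst p)" d] Ac Ah that by simp
  have "b j i p = (\<Sum>a<N. \<Sum>d<N. cnj (snd p $$ (a, j)) * cnj (A (fst p) $$ (d, a)) * snd p $$ (d, i))"
    unfolding b_def conj_by_def
  proof (intro sum.cong refl)
    fix a d assume "a \<in> {..<N}" "d \<in> {..<N}"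
    then show "cnj (snd p $$ (a, j)) * A (fst p) $$ (a, d) * snd p $$ (d, i)
        = cnj (snd p $$ (a, j)) * cnj (A (fst p) $$ (d, a)) * snd p $$ (d, i)"
      using entry[of a d] by simp
  qed
  also have "... = (\<Sum>d<N. \<Sum>a<N. cnj (snd p $$ (a, j)) * cnj (A (fst p) $$ (d, a)) * snd p $$ (d, i))"
    by (rule sum.swap)
  also have "... = cnj (b i j p)" by (simp add: b_def conj_by_def mult_ac)
  finally show ?thesis .
qed

lemma b_eq_mat:
  assumes "w \<in> space M" "U \<in> space m" "i < N" "j < N"
  shows "b i j (w, U) = (mat_adjoint U * (A w * U)) $$ (i, j)"
  using assms by (simp add: b_def conj_by_mat A_carrier haar_carrier)

lemma unitary_fun_mat:
  assumes W: "unitary_fun N W"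
  defines "V \<equiv> Matrix.mat N N (\<lambda>(i, j). W i j)"
  shows "V \<in> unitary_mats N"
proof (rule unitary_matsI)
  show V: "V \<in> carrier_mat N N" by (simp add: V_def)
  show "mat_adjoint V * V = 1\<^sub>m N"
  proof (rule eq_matI)
    fix i j assume "i < dim_row (1\<^sub>m N :: complex mat)" "j < dim_col (1\<^sub>m N :: complex mat)"
    then have ij: "i < N" "j < N" by auto
    have "(mat_adjoint V * V) $$ (i, j) = (\<Sum>a<N. cnj (W a i) * W a j)"
      using V ij by (subst mat_mult_index[of _ N N _ N]) (auto simp: V_def)
    then show "(mat_adjoint V * V) $$ (i, j) = (1\<^sub>m N :: complex mat) $$ (i, j)"
      using W ij by (simp add: unitary_fun_def)
  qed (use V in auto)
qed

lemma b_right_mult: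
  assumes V: "V \<in> unitary_mats N" and p: "w \<in> space M" "U \<in> space m" and ij: "i < N" "j < N"
  shows "b i j (w, U * V) = conj_by N (\<lambda>a i. V $$ (a, i)) (\<lambda>i j. b i j (w, U)) i j"
proof -
  note U = haar_carrier[OF p(2)] and A = A_carrier[OF p(1)] and V' = unitary_matsD[OF V]
  have UV: "U * V \<in> space m" using p(2) V by (simp add: space_haar unitary_mats_mult)
  define B where "B = mat_adjoint U * (A w * U)"
  have AU: "A w * U \<in> carrier_mat N N" and Ua: "mat_adjoint U \<in> carrier_mat N N" using A U by auto
  have B: "B \<in> carrier_mat N N" unfolding B_def using mult_carrier_mat[OF Ua AU] .
  have AUV: "A w * U * V \<in> carrier_mat N N" using mult_carrier_mat[OF AU V'(1)] .
  have "b i j (w, U * V) = (mat_adjoint (U * V) * (A w * (U * V))) $$ (i, j)"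
    by (rule b_eq_mat[OF p(1) UV ij])
  also have "mat_adjoint (U * V) * (A w * (U * V)) = mat_adjoint V * (B * V)"
    using mat_adjoint_mult[OF U V'(1)] assoc_mult_mat[OF A U V'(1)] assoc_mult_mat[OF V'(4) Ua AUV]
      assoc_mult_mat[OF Ua AU V'(1)] by (simp add: B_def)
  also have "... $$ (i, j) = conj_by N (\<lambda>a i. V $$ (a, i)) (\<lambda>a d. B $$ (a, d)) i j"
    by (rule conj_by_mat[OF B V'(1) ij, symmetric])
  also have "... = conj_by N (\<lambda>a i. V $$ (a, i)) (\<lambda>i j. b i j (w, U)) i j"
    unfolding conj_by_def B_def using p by (intro sum.cong refl) (auto simp: b_eq_mat simp del: index_mult_mat)
  finally show ?thesis .
qed

sublocale invariant_hermitian_entries "M \<Otimes>\<^sub>M m" N b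
proof
  show "b i j \<in> borel_measurable MU" if "i < N" "j < N" for i j
    using that by (rule b_measurable)
  show "b j i p = cnj (b i j p)" if "i < N" "j < N" "p \<in> space MU" for i j p
    using that by (rule b_hermitian)
  fix W assume W: "unitary_fun N W"
  define V where "V = Matrix.mat N N (\<lambda>(i, j). W i j)"
  have V: "V \<in> unitary_mats N" unfolding V_def by (rule unitary_fun_mat[OF W])
  define T where "T = (\<lambda>(w :: 'a, U). (w, U * V))"
  have T_eq: "T = (\<lambda>(w, U). ((\<lambda>w. w) w, (\<lambda>U. U * V) U))" by (simp add: T_def)
  have "T \<in> measurable MU MU"
    unfolding T_eq using right_mult_measurable[OF V] by measurable
  moreover have "distr MU MU T = M \<Otimes>\<^sub>M m"
  proof -
    have sigma: "sigma_finite_measure m"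
      using haar by (intro prob_space_imp_sigma_finite) (simp add: haar_prob_def)
    have "distr M M (\<lambda>w. w) \<Otimes>\<^sub>M distr m m (\<lambda>U. U * V) = distr MU MU T"
      unfolding T_eq
      by (rule pair_measure_distr) (simp_all add: right_mult_measurable[OF V] right_invariant[OF V] sigma)
    then show ?thesis by (simp add: right_invariant[OF V] distr_id)
  qed
  moreover have "b i j (T p) = conj_by N W (\<lambda>i j. b i j p) i j"
    if p: "p \<in> space MU" and ij: "i < N" "j < N" for p i j
  proof -
    obtain w U where pU: "p = (w, U)" "w \<in> space M" "U \<in> space m" using p by (auto simp: space_pair_measure)
    have "b i j (T p) = conj_by N (\<lambda>a i. V $$ (a, i)) (\<lambda>i j. b i j p) i j"
      using b_right_mult[OF V pU(2,3) ij] by (simp add: T_def pU(1))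
    also have "... = conj_by N W (\<lambda>i j. b i j p) i j"
      unfolding conj_by_def using ij by (intro sum.cong refl) (auto simp: V_def)
    finally show ?thesis .
  qed
  ultimately show "\<exists>T\<in>measurable MU MU. distr MU MU T = M \<Otimes>\<^sub>M m \<and>
      (\<forall>p\<in>space MU. \<forall>i<N. \<forall>j<N. b i j (T p) = conj_by N W (\<lambda>i j. b i j p) i j)" by blast
qed

lemma cyc_sum_eq_power_sum:
  assumes k: "k \<ge> 1" and p: "w \<in> space M" "U \<in> space m"
  shows "cyc_sum N k (entries (w, U)) = (\<Sum>a<N. complex_of_real (eigval (A w) a) ^ k)"
proof -
  obtain Q where Q: "Q \<in> unitary_mats N"
    and AQ: "A w = Q * mat_diag N (\<lambda>i. complex_of_real (eigval (A w) i)) * mat_adjoint Q"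
    using hermitian_diagonalization[OF A_hermitian[OF p(1)]] by blast
  have U: "U \<in> unitary_mats N" using p(2) by (simp add: space_haar)
  show ?thesis
  proof (rule cyc_sum_spectral[OF k, where R = "\<lambda>a i. (mat_adjoint Q * U) $$ (a, i)"])
    show "b i j (w, U) = (\<Sum>a<N. cnj ((mat_adjoint Q * U) $$ (a, i)) * complex_of_real (eigval (A w) a) * (mat_adjoint Q * U) $$ (a, j))"
      if "i < N" "j < N" for i j
      using conj_by_spectral[OF Q AQ haar_carrier[OF p(2)] that] by (simp add: b_def del: index_mult_mat)
    show "(\<Sum>i<N. (mat_adjoint Q * U) $$ (a, i) * cnj ((mat_adjoint Q * U) $$ (e, i))) = (if a = e then 1 else 0)"
      if "a < N" "e < N" for a e
      by (rule unitary_rows[OF unitary_mats_mult[OF adjoint_unitary[OF Q] U] that])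
  qed
qed

lemma HC_eq_inner_integral:
  assumes w: "w \<in> space M" and rN: "r \<le> N" and x: "x \<in> polydisc r \<rho>"
  shows "HC m N x (eigval (A w)) = (\<integral>U. exp (\<Sum>j<r. x j * b j j (w, U)) \<partial>m)"
proof -
  have "(\<Sum>j<N. x j * b j j (w, U)) = (\<Sum>j<r. x j * b j j (w, U))" for U
    using rN x by (intro sum.mono_neutral_right) (auto simp: polydisc_def)
  then show ?thesis by (simp add: HC_eq_integral_conj_by[OF A_hermitian[OF w]] b_def)
qed

lemma exp_diagonal_measurable:
  assumes "r \<le> N"
  shows "(\<lambda>p. exp (\<Sum>j<r. x j * b j j p)) \<in> borel_measurable MU"
proof -
  have "(\<lambda>p. \<Sum>j<r. x j * b j j p) \<in> borel_measurable MU"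
    using assms by (intro borel_measurable_sum borel_measurable_times borel_measurable_const b_measurable) auto
  then show ?thesis by measurable
qed

lemma exp_diagonal_bounded:
  assumes w: "w \<in> space M" and rN: "r \<le> N"
  shows "integrable m (\<lambda>U. exp (\<Sum>j<r. x j * b j j (w, U)))"
proof (rule finite_measure.integrable_const_bound)
  let ?e = "\<lambda>U. \<Sum>j<r. x j * b j j (w, U)"
  show "finite_measure m"
    using haar by (intro prob_space.finite_measure) (simp add: haar_prob_def)
  define B where "B = (\<Sum>a<N. \<Sum>d<N. norm (A w $$ (a, d)))"
  have bB: "norm (b j j (w, U)) \<le> B" if U: "U \<in> space m" and j: "j < N" for U j
  proof -
    have le1: "norm (U $$ (a, j)) \<le> 1" if a: "a < N" for a
    proof -
      have "U \<in> unitary_mats N" using U by (simp add: space_haar)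
      from unitary_columns[OF this j j] have "complex_of_real (\<Sum>a<N. (norm (U $$ (a, j)))\<^sup>2) = 1"
        by (simp add: complex_norm_square mult.commute del: of_real_power)
      then have "(\<Sum>a<N. (norm (U $$ (a, j)))\<^sup>2) = 1" using of_real_eq_1_iff by blast
      moreover have "(norm (U $$ (a, j)))\<^sup>2 \<le> (\<Sum>a<N. (norm (U $$ (a, j)))\<^sup>2)"
        using a by (intro member_le_sum) auto
      ultimately show ?thesis by (simp add: power_le_one_iff)
    qed
    show ?thesis
      unfolding b_def conj_by_def B_def fst_conv snd_conv
    proof (intro sum_norm_le)
      fix a d assume ad: "a \<in> {..<N}" "d \<in> {..<N}"
      have "norm (U $$ (a, j)) * norm (A w $$ (a, d)) * norm (U $$ (d, j)) \<le> 1 * norm (A w $$ (a, d)) * 1"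
        using le1 ad by (intro mult_mono) auto
      then show "norm (cnj (U $$ (a, j)) * A w $$ (a, d) * U $$ (d, j)) \<le> norm (A w $$ (a, d))"
        by (simp add: norm_mult)
    qed
  qed
  show "AE U in m. norm (exp (?e U)) \<le> exp (\<Sum>j<r. norm (x j) * B)"
  proof (rule AE_I2)
    fix U assume U: "U \<in> space m"
    have "norm (exp (?e U)) \<le> exp (norm (?e U))" by (rule norm_exp)
    also have "norm (?e U) \<le> (\<Sum>j<r. norm (x j) * B)"
      using rN by (intro sum_norm_le) (auto simp: norm_mult intro!: mult_left_mono bB U)
    finally show "norm (exp (?e U)) \<le> exp (\<Sum>j<r. norm (x j) * B)" by simp
  qed
  show "(\<lambda>U. exp (?e U)) \<in> borel_measurable m"
    using measurable_compose[OF measurable_Pair1'[OF w] exp_diagonal_measurable[OF rN, of x]] by simp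
qed

text \<open>The modulus of the exponential at \<open>x\<close> is the exponential at the real parts of \<open>x\<close>, which is again a point of the polydisc. For
real points the Harish-Chandra integral is an integral of a positive function, so that its integrability is that of the
exponential on the product space.\<close>
lemma exp_diagonal_integrable:
  assumes rN: "r \<le> N" and x: "x \<in> polydisc r \<rho>"
    and int: "\<And>x. x \<in> polydisc r \<rho> \<Longrightarrow> integrable M (\<lambda>w. HC m N x (eigval (A w)))"
  shows "integrable MU (\<lambda>p. exp (\<Sum>j<r. x j * b j j p))"
    and "(\<integral>p. exp (\<Sum>j<r. x j * b j j p) \<partial>MU) = (\<integral>w. HC m N x (eigval (A w)) \<partial>M)"
proof -
  let ?e = "\<lambda>p. \<Sum>j<r. x j * b j j p"
  define y where "y j = complex_of_real (Re (x j))" for j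
  have y: "y \<in> polydisc r \<rho>"
    using x abs_Re_le_cmod by (fastforce simp: polydisc_def y_def intro: le_less_trans)
  have norm_eq: "complex_of_real (norm (exp (?e p))) = exp (\<Sum>j<r. y j * b j j p)"
    if p: "p \<in> space MU" for p
  proof -
    have re: "b j j p = of_real (Re (b j j p))" if "j < r" for j
      using that rN p by (intro diagonal_real) auto
    have "(\<Sum>j<r. y j * b j j p) = (\<Sum>j<r. of_real (Re (x j) * Re (b j j p)))"
    proof (rule sum.cong[OF refl])
      fix j assume "j \<in> {..<r}"
      then have "y j * b j j p = y j * of_real (Re (b j j p))" using re[of j] by (metis lessThan_iff)
      then show "y j * b j j p = of_real (Re (x j) * Re (b j j p))" by (simp only: y_def of_real_mult)
    qed
    also have "... = of_real (\<Sum>j<r. Re (x j) * Re (b j j p))" by simp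
    finally have "exp (\<Sum>j<r. y j * b j j p) = of_real (exp (\<Sum>j<r. Re (x j) * Re (b j j p)))"
      by (simp only: exp_of_real)
    moreover have "Re (?e p) = (\<Sum>j<r. Re (x j) * Re (b j j p))"
      unfolding Re_sum
    proof (rule sum.cong[OF refl])
      fix j assume "j \<in> {..<r}"
      then have "Im (b j j p) = 0" using re[of j] by (metis Im_complex_of_real lessThan_iff)
      then show "Re (x j * b j j p) = Re (x j) * Re (b j j p)" by simp
    qed
    ultimately show ?thesis by (simp only: norm_exp_eq_Re)
  qed
  show i: "integrable MU (\<lambda>p. exp (?e p))"
  proof (rule Fubini_integrable[OF exp_diagonal_measurable[OF rN]])
    have "integrable M (\<lambda>w. Re (HC m N y (eigval (A w))))" by (intro integrable_Re int y)
    also have "?this \<longleftrightarrow> integrable M (\<lambda>w. \<integral>U. norm (exp (?e (w, U))) \<partial>m)"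
    proof (rule Bochner_Integration.integrable_cong[OF refl])
      fix w assume w: "w \<in> space M"
      have "HC m N y (eigval (A w)) = (\<integral>U. complex_of_real (norm (exp (?e (w, U)))) \<partial>m)"
        unfolding HC_eq_inner_integral[OF w rN y]
        using w by (intro Bochner_Integration.integral_cong refl norm_eq[symmetric]) (simp add: space_pair_measure)
      then show "Re (HC m N y (eigval (A w))) = (\<integral>U. norm (exp (?e (w, U))) \<partial>m)"
        by (simp only: integral_complex_of_real Re_complex_of_real)
    qed
    finally show "integrable M (\<lambda>w. \<integral>U. norm (exp (?e (w, U))) \<partial>m)" .
    show "AE w in M. integrable m (\<lambda>U. exp (?e (w, U)))"
      using exp_diagonal_bounded[OF _ rN] by (intro AE_I2)
  qed
  have "(\<integral>p. exp (?e p) \<partial>MU) = (\<integral>w. (\<integral>U. exp (?e (w, U)) \<partial>m) \<partial>M)" by (rule integral_fst'[OF i, symmetric])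
  also have "... = (\<integral>w. HC m N x (eigval (A w)) \<partial>M)"
    by (intro Bochner_Integration.integral_cong refl HC_eq_inner_integral[OF _ rN x, symmetric])
  finally show "(\<integral>p. exp (?e p) \<partial>MU) = (\<integral>w. HC m N x (eigval (A w)) \<partial>M)" .
qed

definition scaled_power_sum :: "nat \<Rightarrow> 'a \<Rightarrow> real" where
  "scaled_power_sum k w = (\<Sum>i<N. (eigval (A w) i / real N) ^ k)"

lemma cyc_sum_eq_scaled_power_sum:
  assumes k: "k \<ge> 1" and p: "p \<in> space MU"
  shows "cyc_sum N k (entries p) = of_real (real N ^ k * scaled_power_sum k (fst p))"
proof -
  obtain w U where p': "p = (w, U)" "w \<in> space M" "U \<in> space m" using p by (auto simp: space_pair_measure)
  have "real N ^ k * scaled_power_sum k w = (\<Sum>i<N. eigval (A w) i ^ k)"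
    using N_pos by (simp add: scaled_power_sum_def sum_distrib_left power_divide)
  then show ?thesis using cyc_sum_eq_power_sum[OF k p'(2,3)] by (simp add: p'(1) del: of_real_mult)
qed

text \<open>The power sum is a polynomial in the entries of \<open>A\<close>, as the value \<open>U = 1\<close> shows.\<close>
lemma scaled_power_sum_measurable:
  assumes k: "k \<ge> 1"
  shows "scaled_power_sum k \<in> borel_measurable M"
proof -
  let ?T = "\<lambda>p. cyc_sum N k (entries p)"
  have T: "?T \<in> borel_measurable MU"
    unfolding cyc_sum_def
  proof (intro borel_measurable_sum borel_measurable_prod b_measurable)
    fix f i assume f: "f \<in> {..<k} \<rightarrow>\<^sub>E {..<N}" and i: "i \<in> {..<k}"
    show "f i < N" "f (cyc k i) < N" using f i cyc_less[of i k] by (auto simp: PiE_def Pi_def)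
  qed
  have "mat_adjoint (1\<^sub>m N :: complex mat) = 1\<^sub>m N" by (rule eq_matI) auto
  then have one: "1\<^sub>m N \<in> space m" by (simp add: space_haar unitary_mats_def)
  have "(\<lambda>w. (w, 1\<^sub>m N)) \<in> measurable M MU" using one by measurable
  from measurable_compose[OF this T]
  have "(\<lambda>w. Re (?T (w, 1\<^sub>m N)) / real N ^ k) \<in> borel_measurable M" by measurable
  also have "?this \<longleftrightarrow> scaled_power_sum k \<in> borel_measurable M"
    using one N_pos k by (intro measurable_cong) (simp add: cyc_sum_eq_scaled_power_sum space_pair_measure)
  finally show ?thesis .
qed

lemma integral_fst_marginal:
  fixes f :: "'a \<Rightarrow> complex"
  assumes "f \<in> borel_measurable M"
  shows "integrable MU (\<lambda>p. f (fst p)) \<longleftrightarrow> integrable M f"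
    and "(\<integral>p. f (fst p) \<partial>MU) = (\<integral>w. f w \<partial>M)"
proof -
  have m: "prob_space m" using haar by (simp add: haar_prob_def)
  show "integrable MU (\<lambda>p. f (fst p)) \<longleftrightarrow> integrable M f"
    using integrable_distr_eq[OF measurable_fst, of f M m] assms prob_space.distr_pair_fst[OF m, of M] by simp
  show "(\<integral>p. f (fst p) \<partial>MU) = (\<integral>w. f w \<partial>M)"
    using integral_distr[OF measurable_fst, of f M m] assms prob_space.distr_pair_fst[OF m, of M] by simp
qed

lemma cyc_sum_integral:
  fixes f :: "'a \<Rightarrow> real"
  assumes f: "f \<in> borel_measurable M" and c: "c \<noteq> 0"
    and eq: "\<And>p. p \<in> space MU \<Longrightarrow> F p = complex_of_real (c * f (fst p))"
    and int: "integrable MU F"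
  shows "integrable M f" "(\<integral>p. F p \<partial>MU) = complex_of_real (c * (\<integral>w. f w \<partial>M))"
proof -
  have meas: "(\<lambda>w. complex_of_real (c * f w)) \<in> borel_measurable M" using f by measurable
  have "integrable MU (\<lambda>p. complex_of_real (c * f (fst p)))"
    using int by (rule Bochner_Integration.integrable_cong[THEN iffD1, rotated 2]) (auto simp: eq)
  then have "integrable M (\<lambda>w. complex_of_real (c * f w))"
    using integral_fst_marginal(1)[OF meas] by simp
  from integrable_Re[OF this] have "integrable M (\<lambda>w. c * f w)" by (simp only: Re_complex_of_real)
  then show "integrable M f" using c by simp
  have "(\<integral>p. F p \<partial>MU) = (\<integral>p. complex_of_real (c * f (fst p)) \<partial>MU)"
    by (rule Bochner_Integration.integral_cong) (auto simp: eq)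
  also have "... = (\<integral>w. complex_of_real (c * f w) \<partial>M)" by (rule integral_fst_marginal(2)[OF meas])
  finally show "(\<integral>p. F p \<partial>MU) = complex_of_real (c * (\<integral>w. f w \<partial>M))"
    by (simp add: integral_complex_of_real del: of_real_mult)
qed

end

section \<open>Convergence in probability\<close>

lemma converges_in_prob_second_moment:
  fixes S :: "nat \<Rightarrow> 'a \<Rightarrow> real"
  assumes prob: "\<And>N. N \<ge> 1 \<Longrightarrow> prob_space (M N)"
    and meas: "\<And>N. N \<ge> 1 \<Longrightarrow> S N \<in> borel_measurable (M N)"
    and int: "\<forall>\<^sub>F N in sequentially. integrable (M N) (S N) \<and> integrable (M N) (\<lambda>w. (S N w)\<^sup>2)"
    and lim1: "(\<lambda>N. \<integral>w. S N w \<partial>M N) \<longlonglongrightarrow> \<gamma>"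
    and lim2: "(\<lambda>N. \<integral>w. (S N w)\<^sup>2 \<partial>M N) \<longlonglongrightarrow> \<gamma>\<^sup>2"
  shows "converges_in_prob M (\<lambda>N w. complex_of_real (S N w)) (complex_of_real \<gamma>)"
  unfolding converges_in_prob_def
proof (intro conjI allI impI)
  show "\<forall>\<^sub>F N in sequentially. (\<lambda>w. complex_of_real (S N w)) \<in> borel_measurable (M N)"
    using eventually_ge_at_top[of 1]
  proof eventually_elim
    case (elim N)
    show ?case using meas[OF elim] by measurable
  qed
  fix \<epsilon> :: real assume \<epsilon>: "\<epsilon> > 0"
  let ?D = "\<lambda>N. {w \<in> space (M N). norm (complex_of_real (S N w) - complex_of_real \<gamma>) > \<epsilon>}"
  let ?V = "\<lambda>N. (\<integral>w. (S N w)\<^sup>2 \<partial>M N) - 2 * \<gamma> * (\<integral>w. S N w \<partial>M N) + \<gamma>\<^sup>2"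
  have "?V \<longlonglongrightarrow> \<gamma>\<^sup>2 - 2 * \<gamma> * \<gamma> + \<gamma>\<^sup>2" by (intro tendsto_intros lim1 lim2)
  then have V0: "?V \<longlonglongrightarrow> 0" by (simp add: power2_eq_square)
  have bound: "\<forall>\<^sub>F N in sequentially. measure (M N) (?D N) \<le> ?V N / \<epsilon>\<^sup>2"
    using int eventually_ge_at_top[of 1]
  proof eventually_elim
    case (elim N)
    interpret prob_space "M N" using elim by (intro prob) auto
    have [measurable]: "S N \<in> borel_measurable (M N)" using elim by (intro meas) auto
    have i: "integrable (M N) (S N)" "integrable (M N) (\<lambda>w. (S N w)\<^sup>2)" using elim by auto
    have sq: "(\<lambda>w. (S N w - \<gamma>)\<^sup>2) = (\<lambda>w. (S N w)\<^sup>2 - 2 * \<gamma> * S N w + \<gamma>\<^sup>2)"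
      by (auto simp: power2_eq_square algebra_simps)
    have isq: "integrable (M N) (\<lambda>w. (S N w - \<gamma>)\<^sup>2)"
      unfolding sq by (intro Bochner_Integration.integrable_add Bochner_Integration.integrable_diff integrable_mult_right i) auto
    have "measure (M N) (?D N)
        \<le> measure (M N) {w \<in> space (M N). \<bar>S N w - \<gamma>\<bar> \<ge> \<epsilon>}"
    proof (rule finite_measure_mono)
      show "(?D N) \<subseteq> {w \<in> space (M N). \<bar>S N w - \<gamma>\<bar> \<ge> \<epsilon>}"
      proof
        fix w assume "w \<in> (?D N)"
        moreover have "norm (complex_of_real (S N w) - complex_of_real \<gamma>) = \<bar>S N w - \<gamma>\<bar>"
          by (metis norm_of_real of_real_diff)
        ultimately show "w \<in> {w \<in> space (M N). \<bar>S N w - \<gamma>\<bar> \<ge> \<epsilon>}" by simp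
      qed
    qed measurable
    also have "... \<le> (\<integral>w. (S N w - \<gamma>)\<^sup>2 \<partial>M N) / \<epsilon>\<^sup>2"
      using isq \<epsilon> by (intro second_moment_method) auto
    also have "(\<integral>w. (S N w - \<gamma>)\<^sup>2 \<partial>M N) = ?V N"
      unfolding sq using i by (simp add: prob_space)
    finally show ?case .
  qed
  have V0': "(\<lambda>N. ?V N / \<epsilon>\<^sup>2) \<longlonglongrightarrow> 0"
    using tendsto_divide[OF V0 tendsto_const[of "\<epsilon>\<^sup>2"]] \<epsilon> by simp
  show "(\<lambda>N. measure (M N) (?D N)) \<longlonglongrightarrow> 0" by (rule tendsto_sandwich[OF _ bound tendsto_const V0']) simp
qed

text \<open>The exponential is uniformly continuous on bounded sets only. The radius is therefore reduced until \<open>\<Psi>\<close> is bounded, and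
then the logarithms are bounded uniformly in \<open>N\<close>.\<close>
lemma log_limit_imp_mgf_limit:
  fixes F L :: "nat \<Rightarrow> (nat \<Rightarrow> complex) \<Rightarrow> complex"
  assumes V: "open V" "0 \<in> V" and \<Psi>: "\<Psi> holomorphic_on V" and \<rho>: "\<rho> > 0"
    and expL: "\<forall>\<^sub>F N in sequentially. \<forall>x\<in>polydisc r \<rho>. exp (L N x) = F N x"
    and lim: "uniform_limit (polydisc r \<rho>) L (\<lambda>x. \<Sum>i<r. \<Psi> (x i)) sequentially"
  obtains R where "0 < R" "R \<le> \<rho>" "uniform_limit (polydisc r R) F (\<lambda>x. exp (\<Sum>i<r. \<Psi> (x i))) sequentially"
proof -
  let ?G = "\<lambda>x. \<Sum>i<r. \<Psi> (x i)"
  obtain R0 where R0: "R0 > 0" "ball 0 R0 \<subseteq> V" using V openE by blast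
  define R where "R = min \<rho> (R0 / 2)"
  have R: "0 < R" "R \<le> \<rho>" "R < R0" using R0 \<rho> by (auto simp: R_def)
  have cb: "cball 0 R \<subseteq> V" using R R0 by (auto simp: subset_iff)
  have "compact (\<Psi> ` cball 0 R)"
    by (intro compact_continuous_image holomorphic_on_imp_continuous_on holomorphic_on_subset[OF \<Psi> cb]) auto
  then have "bounded (\<Psi> ` cball 0 R)" by (rule compact_imp_bounded)
  then obtain B where "\<forall>y\<in>\<Psi> ` cball 0 R. norm y \<le> B" unfolding bounded_iff by (elim exE)
  then have B: "norm (\<Psi> z) \<le> B" if "z \<in> cball 0 R" for z using that by simp
  define C where "C = real r * B + 1"
  have sub: "polydisc r R \<subseteq> polydisc r \<rho>" using R by (fastforce simp: polydisc_def)
  note limR = uniform_limit_on_subset[OF lim sub]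
  have G: "norm (?G x) \<le> real r * B" if "x \<in> polydisc r R" for x
  proof -
    have "norm (?G x) \<le> (\<Sum>i<r. B)"
      using that by (intro sum_norm_le B) (auto simp: polydisc_def intro: less_imp_le)
    then show ?thesis by simp
  qed
  have ev: "\<forall>\<^sub>F N in sequentially. \<forall>x\<in>polydisc r R. L N x \<in> cball 0 C"
    using uniform_limitD[OF limR, of 1, simplified]
  proof eventually_elim
    case (elim N)
    show ?case
    proof
      fix x assume x: "x \<in> polydisc r R"
      have "norm (L N x) \<le> norm (L N x - (?G x)) + norm (?G x)"
        using norm_triangle_ineq[of "L N x - (?G x)" "\<Sum>i<r. \<Psi> (x i)"] by simp
      also have "... \<le> 1 + real r * B" using elim x G[OF x] by (intro add_mono) (auto simp: dist_norm intro: less_imp_le)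
      finally show "L N x \<in> cball 0 C" by (simp add: C_def)
    qed
  qed
  have "uniform_limit (polydisc r R) (\<lambda>N x. exp (L N x)) (\<lambda>x. exp (?G x)) sequentially"
    by (rule uniform_limit_compose_uniformly_continuous_on[OF limR _ ev])
      (auto intro!: compact_uniformly_continuous continuous_intros)
  moreover have "\<forall>\<^sub>F N in sequentially. \<forall>x\<in>polydisc r R. exp (L N x) = F N x"
    using expL by eventually_elim (use sub in blast)
  ultimately have "uniform_limit (polydisc r R) F (\<lambda>x. exp (?G x)) sequentially"
    by (subst uniform_limit_cong[symmetric]) auto
  with R show thesis by (intro that)
qed

theorem theorem10:
  fixes M :: "nat \<Rightarrow> 'a measure"
    and A :: "nat \<Rightarrow> 'a \<Rightarrow> complex mat"
    and haar :: "nat \<Rightarrow> complex mat measure"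
    and \<Psi> :: "complex \<Rightarrow> complex"
    and V :: "complex set"
    and k :: nat
  assumes prob: "\<And>N. N \<ge> 1 \<Longrightarrow> prob_space (M N)"
    and herm: "\<And>N. N \<ge> 1 \<Longrightarrow> random_hermitian (M N) N (A N)"
    and haar: "\<And>N. N \<ge> 1 \<Longrightarrow> haar_prob N (haar N)"
    and V: "open V" "0 \<in> V"
    and \<Psi>: "\<Psi> holomorphic_on V"
    and conv: "\<And>r. r \<ge> 1 \<Longrightarrow>
      \<exists>\<rho>>0. \<exists>L.
        (\<forall>\<^sub>F N in sequentially.
          (\<forall>x \<in> polydisc r \<rho>. integrable (M N) (\<lambda>\<omega>. HC (haar N) N x (eigval (A N \<omega>)))) \<and>
          log_branch (polydisc r \<rho>) (\<lambda>x. \<integral>\<omega>. HC (haar N) N x (eigval (A N \<omega>)) \<partial>M N) (L N)) \<and>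
        uniform_limit (polydisc r \<rho>) L (\<lambda>x. \<Sum>i<r. \<Psi> (x i)) sequentially"
    and k: "k \<ge> 1"
  shows "converges_in_prob M
      (\<lambda>N \<omega>. complex_of_real (\<Sum>i<N. (eigval (A N \<omega>) i / real N) ^ k))
      ((deriv ^^ k) \<Psi> 0 / fact (k - 1))"
proof -
  let ?log = "\<lambda>r \<rho> L N. (\<forall>x \<in> polydisc r \<rho>. integrable (M N) (\<lambda>w. HC (haar N) N x (eigval (A N w)))) \<and>
    log_branch (polydisc r \<rho>) (\<lambda>x. \<integral>w. HC (haar N) N x (eigval (A N w)) \<partial>M N) (L N)"
  define P where "P N = M N \<Otimes>\<^sub>M haar N" for N
  define B where "B N = rotated_hermitian.b N (A N)" for N
  have rot: "rotated_hermitian N (haar N) (M N) (A N)" if "N \<ge> 1" for N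
    using that by (intro rotated_hermitian.intro haar_unitary.intro rotated_hermitian_axioms.intro prob herm haar)
  let ?e = "\<lambda>r N x w. exp (\<Sum>i<r. x i * B N i i w)"
  have ens: "invariant_hermitian_entries (P N) N (B N)" if N: "N \<ge> 1" for N
  proof -
    interpret rotated_hermitian N "haar N" "M N" "A N" by (rule rot[OF N])
    show ?thesis unfolding P_def B_def by (rule invariant_hermitian_entries_axioms)
  qed
  have \<Psi>0: "\<Psi> 0 = 0"
  proof -
    obtain \<rho> L where "\<rho> > 0"
      and ev: "\<forall>\<^sub>F N in sequentially. ?log 1 \<rho> L N"
      and lim: "uniform_limit (polydisc 1 \<rho>) L (\<lambda>x. \<Sum>i<1. \<Psi> (x i)) sequentially"
      using conv[of 1] by blast
    have "(\<lambda>_. 0) \<in> polydisc 1 \<rho>" using \<open>\<rho> > 0\<close> by (simp add: polydisc_def)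
    from tendsto_uniform_limitI[OF lim this] have "(\<lambda>N. L N (\<lambda>_. 0)) \<longlonglongrightarrow> \<Psi> 0" by simp
    moreover have "(\<lambda>N. L N (\<lambda>_. 0)) \<longlonglongrightarrow> 0"
    proof (rule tendsto_eventually)
      show "\<forall>\<^sub>F N in sequentially. L N (\<lambda>_. 0) = 0"
        using ev by eventually_elim (simp add: log_branch_def)
    qed
    ultimately show ?thesis by (rule LIMSEQ_unique)
  qed
  have mgf: "\<exists>R>0. (\<forall>\<^sub>F N in sequentially. \<forall>x\<in>polydisc r R. integrable (P N) (\<lambda>w. ?e r N x w)) \<and>
       uniform_limit (polydisc r R) (\<lambda>N x. \<integral>w. ?e r N x w \<partial>P N)
         (\<lambda>x. exp (\<Sum>i<r. \<Psi> (x i))) sequentially" if r: "r \<ge> 1" for r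
  proof -
    obtain \<rho> L where \<rho>: "\<rho> > 0"
      and ev: "\<forall>\<^sub>F N in sequentially. ?log r \<rho> L N"
      and lim: "uniform_limit (polydisc r \<rho>) L (\<lambda>x. \<Sum>i<r. \<Psi> (x i)) sequentially"
      using conv[OF r] by blast
    have both: "\<forall>\<^sub>F N in sequentially. \<forall>x\<in>polydisc r \<rho>.
        integrable (P N) (\<lambda>w. ?e r N x w) \<and>
        exp (L N x) = (\<integral>w. ?e r N x w \<partial>P N)"
      using ev eventually_ge_at_top[of r]
    proof eventually_elim
      case (elim N)
      interpret rotated_hermitian N "haar N" "M N" "A N" using elim r by (intro rot) auto
      show ?case
      proof
        fix x assume x: "x \<in> polydisc r \<rho>"
        have "exp (L N x) = (\<integral>w. HC (haar N) N x (eigval (A N w)) \<partial>M N)"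
          using elim x by (simp add: log_branch_def)
        then show "integrable (P N) (\<lambda>w. ?e r N x w) \<and>
            exp (L N x) = (\<integral>w. ?e r N x w \<partial>P N)"
          using exp_diagonal_integrable[OF _ x] elim by (simp add: P_def B_def)
      qed
    qed
    then have "\<forall>\<^sub>F N in sequentially. \<forall>x\<in>polydisc r \<rho>. exp (L N x) = (\<integral>w. ?e r N x w \<partial>P N)"
      by (rule eventually_mono) blast
    from log_limit_imp_mgf_limit[OF V \<Psi> \<rho> this lim] obtain R where R: "0 < R" "R \<le> \<rho>"
      and limR: "uniform_limit (polydisc r R) (\<lambda>N x. \<integral>w. ?e r N x w \<partial>P N)
         (\<lambda>x. exp (\<Sum>i<r. \<Psi> (x i))) sequentially" by blast
    have "polydisc r R \<subseteq> polydisc r \<rho>" using R by (fastforce simp: polydisc_def)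
    then have "\<forall>\<^sub>F N in sequentially. \<forall>x\<in>polydisc r R. integrable (P N) (\<lambda>w. ?e r N x w)"
      using both by (rule_tac eventually_mono) blast+
    with R limR show ?thesis by blast
  qed
  define S where "S N w = (\<Sum>i<N. (eigval (A N w) i / real N) ^ k)" for N w
  define c where "c = limit_moment \<Psi> k"
  let ?T = "\<lambda>N k w. cyc_sum N k (\<lambda>i j. B N i j w)"
  have T0: "?T N 0 w = 1" for N w by (simp add: cyc_sum_def)
  have S_meas: "S N \<in> borel_measurable (M N)" if N: "N \<ge> 1" for N
  proof -
    interpret rotated_hermitian N "haar N" "M N" "A N" by (rule rot[OF N])
    show ?thesis using scaled_power_sum_measurable[OF k] by (simp add: S_def[abs_def] scaled_power_sum_def[abs_def])
  qed
  have T_eq: "?T N k p = of_real (real N ^ k * S N (fst p))" if N: "N \<ge> 1" and p: "p \<in> space (P N)" for N p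
  proof -
    interpret rotated_hermitian N "haar N" "M N" "A N" by (rule rot[OF N])
    show ?thesis using cyc_sum_eq_scaled_power_sum[OF k, of p] p
      by (simp add: B_def P_def S_def scaled_power_sum_def del: of_real_mult)
  qed
  have k0: "k + 0 \<ge> 1" and kk: "k + k \<ge> 1" using k by auto
  have lim1a: "\<forall>\<^sub>F N in sequentially. integrable (P N) (\<lambda>w. ?T N k w * ?T N 0 w)"
    by (rule cyc_sum_limit(1)[OF ens V \<Psi> \<Psi>0 mgf k0])
  have lim1b: "(\<lambda>N. (\<integral>w. ?T N k w * ?T N 0 w \<partial>P N) / of_nat N ^ (k + 0)) \<longlonglongrightarrow> limit_moment \<Psi> k * limit_moment \<Psi> 0"
    by (rule cyc_sum_limit(2)[OF ens V \<Psi> \<Psi>0 mgf k0])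
  have lim2a: "\<forall>\<^sub>F N in sequentially. integrable (P N) (\<lambda>w. ?T N k w * ?T N k w)"
    by (rule cyc_sum_limit(1)[OF ens V \<Psi> \<Psi>0 mgf kk])
  have lim2b: "(\<lambda>N. (\<integral>w. ?T N k w * ?T N k w \<partial>P N) / of_nat N ^ (k + k)) \<longlonglongrightarrow> limit_moment \<Psi> k * limit_moment \<Psi> k"
    by (rule cyc_sum_limit(2)[OF ens V \<Psi> \<Psi>0 mgf kk])
  have m1: "\<forall>\<^sub>F N in sequentially. integrable (M N) (S N) \<and>
      (\<integral>w. ?T N k w * ?T N 0 w \<partial>P N) / of_nat N ^ (k + 0) = of_real (\<integral>w. S N w \<partial>M N)"
    using lim1a eventually_ge_at_top[of 1]
  proof eventually_elim
    case (elim N)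
    interpret rotated_hermitian N "haar N" "M N" "A N" using elim by (intro rot) auto
    have "real N ^ k \<noteq> 0" using elim by simp
    from cyc_sum_integral[OF S_meas[OF elim(2)] this, of "\<lambda>w. ?T N k w * ?T N 0 w"] elim
    show ?case by (simp add: T_eq T0 P_def[symmetric])
  qed
  have m2: "\<forall>\<^sub>F N in sequentially. integrable (M N) (\<lambda>w. (S N w)\<^sup>2) \<and>
      (\<integral>w. ?T N k w * ?T N k w \<partial>P N) / of_nat N ^ (k + k) = of_real (\<integral>w. (S N w)\<^sup>2 \<partial>M N)"
    using lim2a eventually_ge_at_top[of 1]
  proof eventually_elim
    case (elim N)
    interpret rotated_hermitian N "haar N" "M N" "A N" using elim by (intro rot) auto
    have N: "real N ^ (k + k) \<noteq> 0" using elim by simp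
    have "(\<lambda>w. (S N w)\<^sup>2) \<in> borel_measurable (M N)" using S_meas[OF elim(2)] by measurable
    from cyc_sum_integral[OF this N, of "\<lambda>w. ?T N k w * ?T N k w"] elim
    show ?case by (simp add: T_eq P_def[symmetric] power_add power2_eq_square mult_ac)
  qed
  have c1: "(\<lambda>N. complex_of_real (\<integral>w. S N w \<partial>M N)) \<longlonglongrightarrow> c"
    using Lim_transform_eventually[OF lim1b eventually_mono[OF m1 conjunct2]] by (simp add: c_def limit_moment_def)
  have c2: "(\<lambda>N. complex_of_real (\<integral>w. (S N w)\<^sup>2 \<partial>M N)) \<longlonglongrightarrow> c * c"
    using Lim_transform_eventually[OF lim2b eventually_mono[OF m2 conjunct2]] by (simp add: c_def)
  \<comment> \<open>a limit of real numbers is real, so the variance can be taken over the reals\<close>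
  define \<gamma> where "\<gamma> = Re c"
  have g1: "(\<lambda>N. \<integral>w. S N w \<partial>M N) \<longlonglongrightarrow> \<gamma>"
    using tendsto_Re[OF c1] by (simp add: \<gamma>_def)
  have c_real: "c = of_real \<gamma>" by (rule LIMSEQ_unique[OF c1 tendsto_of_real[OF g1]])
  have g2: "(\<lambda>N. \<integral>w. (S N w)\<^sup>2 \<partial>M N) \<longlonglongrightarrow> \<gamma>\<^sup>2"
    using tendsto_Re[OF c2] by (simp add: c_real power2_eq_square)
  have "converges_in_prob M (\<lambda>N w. complex_of_real (S N w)) (complex_of_real \<gamma>)"
    using m1 m2 by (intro converges_in_prob_second_moment prob S_meas g1 g2) (auto elim: eventually_elim2)
  then show ?thesis
    using k by (simp add: S_def c_real[symmetric] c_def limit_moment_def)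
qed

end
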